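(* Assume (A1), (A2), (A4), (A5) of the context, and let $F$ be strongly convex with parameter $\mu>0$ in the sense of the context. Let $\theta>0$, $\epsilon>0$, $p\in(0,1]$, $x_0\in\mathbb{R}^d$, and fix one of the gradient estimation methods FD, GS, SS, RC, RS. Let $\{x_k : k\in\mathbb{Z}_{++}\}$ be generated by $x_{k+1}=x_k-\alpha_k g_{S_k,T_k}(x_k)$, where $|S_k|$ is chosen so that Condition 1, Condition 2 or Condition 3 holds with constant $\theta$ at every iteration, $|T_k|=N$ for all $k\in\mathbb{Z}_+$ ($N=d$ for FD, $N\le d$ for RC and RS), $\alpha_k=\bar\alpha$ for all $k\in\mathbb{Z}_+$ with $\bar\alpha$ as given in the context for the chosen method, and the sampling radius is $\nu=\hat\nu$, where, with $\Omega_5=\sqrt{\frac{4\epsilon p\mu}{3L_{\nabla F}^2d}}$, $$\hat\nu=\Omega_5\ (\mathrm{FD},\mathrm{RC},\mathrm{RS}),\quad \hat\nu=\sqrt{\tfrac{2(N+4.5d)}{8N+24d+(d+2)(d+4)}}\;\Omega_5\ (\mathrm{GS}),\quad \hat\nu=\sqrt{\tfrac{2(N+4.5d)d}{8N+24d+d^2}}\;\Omega_5\ (\mathrm{SS}).$$ Let $\rho$ be the rate constant given in the context for the chosen method and set $$\mathcal{K}(\epsilon)=\frac{\log(F(x_0)-F(x^* ))-\log(\epsilon p/2)}{\log((1-\rho)^{-1})}.$$ Then for every integer $k\ge\mathcal{K}(\epsilon)$, $x_k$ is an $\epsilon$-accurate solution, i.e. $F(x_k)-F(x^* )\le\epsilon$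 with probability at least $1-p$. Moreover $$\mathcal{K}(\epsilon)=\mathcal{O}\!\left(\frac{\log(\epsilon^{-1}p^{-1})}{\rho}\right),$$ that is, with $\Omega_6=\log(1/(\epsilon p))\frac{L_{\nabla F}}{\mu}$: $\mathcal{K}(\epsilon)=\mathcal{O}(\Omega_6)$ for FD; $\mathcal{K}(\epsilon)=\mathcal{O}\big(\frac{\max\{N,d\}}{N}\Omega_6\big)$ for GS and for SS; $\mathcal{K}(\epsilon)=\mathcal{O}\big(\frac{d}{N}\Omega_6\big)$ for RC and for RS.
   Context: **Problem and notation.** $\mathbb{Z}_+=\{0,1,2,\dots\}$, $\mathbb{Z}_{++}=\{1,2,\dots\}$, $\|\cdot\|$ is the Euclidean norm. $\zeta$ is a random variable with associated probability space $(\Xi,\mathcal{F},P)$, $f:\mathbb{R}^d\times\Xi\to\mathbb{R}$, and $F(x)=\mathbb{E}_\zeta[f(x,\zeta)]$ is continuously differentiable on $\mathbb{R}^d$; $x^*$ denotes a minimizer of $F$. **Gradient estimator.** At iteration $k$, given a sample set $S_k=\{\zeta_1,\dots,\zeta_{|S_k|}\}$, put $F_{S_k}(x)=\frac{1}{|S_k|}\sum_{\zeta_i\in S_k}f(x,\zeta_i)$. Given a finite collection $T_k$ of direction vectors, a sampling radius $\nu>0$ and a scaling $\gamma_k>0$, put $$g_{S_k,T_k}(x_k)=\gamma_k\sum_{u_j\in T_k}\frac{F_{S_k}(x_k+\nu u_j)-F_{S_k}(x_k)}{\nu}\,u_j ,$$ and let $g_{\zeta_i,T_k}(x_k)$ be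 the same expression with $F_{S_k}$ replaced by $f(\cdot,\zeta_i)$. **Methods.** FD: $\gamma_k=1$, $T_k=\{e_1,\dots,e_d\}$ (canonical basis, deterministic, $|T_k|=d$). GS: $\gamma_k=1/|T_k|$, $u_j$ i.i.d. $\mathcal{N}(0,I)$. SS: $\gamma_k=d/|T_k|$, $u_j$ i.i.d. uniform on the unit sphere of $\mathbb{R}^d$. RC: $\gamma_k=d/|T_k|$, $T_k$ sampled uniformly without replacement from $\{e_1,\dots,e_d\}$, $|T_k|\le d$. RS: $\gamma_k=d/|T_k|$, $T_k$ sampled uniformly without replacement from a random orthonormal basis $\tilde T_k$ of $\mathbb{R}^d$, $|T_k|\le d$. The directions are drawn afresh at each iteration; $|T_k|$ is non-random. **Conditional expectations.** $\mathcal{F}_k$ is the $\sigma$-algebra generated by $x_0$ and all direction and sample sets used before iteration $k$; $\mathcal{F}_{k+1/2}$ is generated by $\mathcal{F}_k$ and $T_k$. $\mathbb{E}_k[\cdot]=\mathbb{E}_{T_k}[\cdot]=\mathbb{E}[\cdot\mid\mathcal{F}_k]$, $\mathbb{E}_{S_k}[\cdot]=\mathbb{E}[\cdot\mid\mathcal{F}_{k+1/2}]$. $\mathbb{E}_{\zeta_i}$ is expectation over a single sample $\zeta_i$ of $\zeta$, with $x_k,T_k$ held fixed. $g_{T_k}(x_k)=\mathbb{E}_{S_k}[g_{S_k,T_k}(x_k)]$ and $g(x_k)=\mathbb{E}_{T_k}[g_{T_k}(x_k)]$. **Assumptions.** (A1) At every iteration, $S_k$ consists of i.i.d. samples of $\zeta$,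 so $\mathbb{E}_{\zeta_i}[f(x,\zeta_i)]=F(x)$ for all $x$ and $\zeta_i\in S_k$. (A2) At every iteration, the vectors in $T_k$ are chosen independently of the samples of $\zeta$ in $S_k$ (the size $|S_k|$ may depend on $x_k$ and $T_k$). (A4) For every $\zeta$, $f(\cdot,\zeta)$ is continuously differentiable with $\|\nabla f(x,\zeta)-\nabla f(y,\zeta)\|\le L_{\nabla f}\|x-y\|$ for all $x,y$, $L_{\nabla f}<\infty$. This implies $\|\nabla F(x)-\nabla F(y)\|\le L_{\nabla F}\|x-y\|$ for all $x,y$ with some constant $L_{\nabla F}\le L_{\nabla f}$; $L_{\nabla F}>0$ denotes such a constant. (A5) There are $\beta_1,\beta_2\ge0$ with $\mathbb{E}_{\zeta_i}[\|\nabla f(x,\zeta_i)-\nabla F(x)\|^2]\le\beta_1\|\nabla F(x)\|^2+\beta_2$ for all $x\in\mathbb{R}^d$. **Sample size conditions** (with $\theta>0$). Write $V_k=\mathbb{E}_{\zeta_i}[\|g_{\zeta_i,T_k}(x_k)-g_{T_k}(x_k)\|^2]$. Condition 1: $V_k/|S_k|\le\theta^2\|g_{T_k}(x_k)\|^2$. Condition 2: $V_k/|S_k|\le\theta^2\,\mathbb{E}_{T_k}[\|g_{T_k}(x_k)\|^2]$. Condition 3: $\mathbb{E}_{T_k}[V_k]/|S_k|\le\theta^2\,\mathbb{E}_{T_k}[\|g_{T_k}(x_k)\|^2]$. **Strong convexity.** $F$ is called strongly convex with parameter $\mu>0$ if $\|\nabla F(x)\|^2\ge2\mu(F(x)-F(x^*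 ))$ for all $x\in\mathbb{R}^d$, where $x^*$ is the optimal solution. It is understood that $\mu\le L_{\nabla F}$ (automatic unless $F$ is constant). **Constants.** With $\Omega_1=\frac{1}{4(1+\theta^2)L_{\nabla F}}$ and $\Omega_3=\frac{\mu}{8(1+\theta^2)L_{\nabla F}}$: FD: $\bar\alpha=\Omega_1$, $\rho=\Omega_3$. GS and SS: $\bar\alpha=\frac{N}{N+4.5d}\Omega_1$, $\rho=\frac{N}{N+4.5d}\Omega_3$. RC and RS: $\bar\alpha=\frac{N}{d}\Omega_1$, $\rho=\frac{N}{d}\Omega_3$. **Conventions.** $\log 0=-\infty$. The $\mathcal{O}$-statements are for small $\epsilon p$ (say $\epsilon p\le\frac12$), with implied constants depending only on $F(x_0)-F(x^* )$ and $\theta$ (both regarded as $\mathcal{O}(1)$). *)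

theory Defs
  imports "HOL-Probability.Probability"
begin

subsection \<open>Gradient estimation methods and the constants attached to them\<close>

text \<open>
  Finite differences, Gaussian smoothing, sphere smoothing, randomized coordinate directions and
  randomized subspace directions.  Below, \<open>d\<close> is the dimension, \<open>N\<close> the number of directions,
  \<open>L\<close> a Lipschitz constant of the gradient of the objective and \<open>\<mu>\<close> the strong convexity parameter.
\<close>

datatype grad_method = FD | GS | SS | RC | RS

definition admissible :: "grad_method \<Rightarrow> nat \<Rightarrow> nat \<Rightarrow> bool" where
  "admissible m d N \<longleftrightarrow> N \<ge> 1 \<and>
     (case m of FD \<Rightarrow> N = d | GS \<Rightarrow> True | SS \<Rightarrow> True | RC \<Rightarrow> N \<le> d | RS \<Rightarrow> N \<le> d)"

definition scaling :: "grad_method \<Rightarrow> nat \<Rightarrow> nat \<Rightarrow> real" where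
  "scaling m d N = (case m of FD \<Rightarrow> 1 | GS \<Rightarrow> 1 / N | SS \<Rightarrow> d / N | RC \<Rightarrow> d / N | RS \<Rightarrow> d / N)"

definition step_factor :: "grad_method \<Rightarrow> nat \<Rightarrow> nat \<Rightarrow> real" where
  "step_factor m d N =
     (case m of FD \<Rightarrow> 1 | GS \<Rightarrow> N / (N + 4.5 * d) | SS \<Rightarrow> N / (N + 4.5 * d)
      | RC \<Rightarrow> N / d | RS \<Rightarrow> N / d)"

definition Omega1 :: "real \<Rightarrow> real \<Rightarrow> real" where
  "Omega1 \<theta> L = 1 / (4 * (1 + \<theta>\<^sup>2) * L)"

definition Omega3 :: "real \<Rightarrow> real \<Rightarrow> real \<Rightarrow> real" where
  "Omega3 \<theta> \<mu> L = \<mu> / (8 * (1 + \<theta>\<^sup>2) * L)"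

definition Omega5 :: "nat \<Rightarrow> real \<Rightarrow> real \<Rightarrow> real \<Rightarrow> real \<Rightarrow> real" where
  "Omega5 d \<mu> L \<epsilon> p = sqrt (4 * \<epsilon> * p * \<mu> / (3 * L\<^sup>2 * d))"

definition Omega6 :: "real \<Rightarrow> real \<Rightarrow> real \<Rightarrow> real \<Rightarrow> real" where
  "Omega6 \<mu> L \<epsilon> p = ln (1 / (\<epsilon> * p)) * (L / \<mu>)"

definition step_size :: "grad_method \<Rightarrow> nat \<Rightarrow> nat \<Rightarrow> real \<Rightarrow> real \<Rightarrow> real" where
  "step_size m d N \<theta> L = step_factor m d N * Omega1 \<theta> L"

definition rate :: "grad_method \<Rightarrow> nat \<Rightarrow> nat \<Rightarrow> real \<Rightarrow> real \<Rightarrow> real \<Rightarrow> real" where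
  "rate m d N \<theta> \<mu> L = step_factor m d N * Omega3 \<theta> \<mu> L"

definition radius :: "grad_method \<Rightarrow> nat \<Rightarrow> nat \<Rightarrow> real \<Rightarrow> real \<Rightarrow> real \<Rightarrow> real \<Rightarrow> real" where
  "radius m d N \<mu> L \<epsilon> p =
     (case m of
        FD \<Rightarrow> 1
      | GS \<Rightarrow> sqrt (2 * (N + 4.5 * d) / (8 * N + 24 * d + (d + 2) * (d + 4)))
      | SS \<Rightarrow> sqrt (2 * (N + 4.5 * d) * d / (8 * N + 24 * d + d\<^sup>2))
      | RC \<Rightarrow> 1
      | RS \<Rightarrow> 1) * Omega5 d \<mu> L \<epsilon> p"

text \<open>Order of \<open>1 / rate\<close> in units of \<open>L / \<mu>\<close>.\<close>

definition dim_factor :: "grad_method \<Rightarrow> nat \<Rightarrow> nat \<Rightarrow> real" where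
  "dim_factor m d N =
     (case m of FD \<Rightarrow> 1 | GS \<Rightarrow> real (max N d) / N | SS \<Rightarrow> real (max N d) / N
      | RC \<Rightarrow> d / N | RS \<Rightarrow> d / N)"

text \<open>Extended logarithm with value \<open>-\<infinity>\<close> at 0; the HOL function \<open>ln\<close> has \<open>ln 0 = 0\<close>.\<close>

definition log_ext :: "real \<Rightarrow> ereal" where
  "log_ext t = (if t = 0 then -\<infinity> else ereal (ln t))"

text \<open>\<open>\<Delta>\<close> stands for the initial optimality gap.\<close>

definition iteration_bound :: "real \<Rightarrow> real \<Rightarrow> real \<Rightarrow> real \<Rightarrow> ereal" where
  "iteration_bound \<Delta> \<epsilon> p \<rho> =
     (log_ext \<Delta> - log_ext (\<epsilon> * p / 2)) / ereal (ln (inverse (1 - \<rho>)))"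


subsection \<open>Gradient estimator\<close>

definition grad_est ::
  "real \<Rightarrow> real \<Rightarrow> nat \<Rightarrow> ('a::real_vector \<Rightarrow> real) \<Rightarrow> 'a \<Rightarrow> (nat \<Rightarrow> 'a) \<Rightarrow> 'a" where
  "grad_est \<gamma> \<nu> N h x u =
     \<gamma> *\<^sub>R (\<Sum>j<N. ((h (x + \<nu> *\<^sub>R u j) - h x) / \<nu>) *\<^sub>R u j)"

definition sample_mean :: "('a \<Rightarrow> 'z \<Rightarrow> real) \<Rightarrow> nat \<Rightarrow> (nat \<Rightarrow> 'z) \<Rightarrow> 'a \<Rightarrow> real" where
  "sample_mean f n \<zeta> x = (\<Sum>i<n. f x (\<zeta> i)) / n"


subsection \<open>Distributions of the directions\<close>

text \<open>The standard Gaussian law \<open>N(0, I)\<close>.\<close>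

definition std_gaussian :: "'a::euclidean_space measure" where
  "std_gaussian = density lborel (\<lambda>x. ennreal (\<Prod>b\<in>Basis. std_normal_density (x \<bullet> b)))"

text \<open>
  Normalized surface measure of the unit sphere: the mass of a set of unit vectors is the
  normalized volume of the cone over it inside the unit ball.
\<close>

definition uniform_sphere :: "'a::euclidean_space measure" where
  "uniform_sphere = distr (uniform_measure lborel (ball 0 1)) borel (\<lambda>x. x /\<^sub>R norm x)"

text \<open>Sampling \<open>N\<close> of the indices \<open>0, \<dots>, d - 1\<close> uniformly without replacement, as an ordered tuple.\<close>

definition without_replacement :: "nat \<Rightarrow> nat \<Rightarrow> (nat \<Rightarrow> nat) measure" where
  "without_replacement d N =
     uniform_count_measure {J \<in> {..<N} \<rightarrow>\<^sub>E {..<d}. inj_on J {..<N}}"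

abbreviation tuple_space :: "nat \<Rightarrow> (nat \<Rightarrow> 'a::euclidean_space) measure" where
  "tuple_space N \<equiv> Pi\<^sub>M {..<N} (\<lambda>_. borel)"

text \<open>
  \<open>direction_law m N D\<close>: the law \<open>D\<close> on \<open>N\<close>-tuples of vectors is one that method \<open>m\<close> may use.
  Tuples are used instead of sets because directions may repeat (sphere smoothing in dimension 1).
  For RS the law \<open>Q\<close> of the random orthonormal basis is arbitrary.
\<close>

definition direction_law ::
  "grad_method \<Rightarrow> nat \<Rightarrow> (nat \<Rightarrow> 'a::euclidean_space) measure \<Rightarrow> bool" where
  "direction_law m N D =
     (case m of
        FD \<Rightarrow> (\<exists>e. bij_betw e {..<N} (Basis :: 'a set) \<and>
                 D = return (tuple_space N) (restrict e {..<N}))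
      | GS \<Rightarrow> D = Pi\<^sub>M {..<N} (\<lambda>_. std_gaussian)
      | SS \<Rightarrow> D = Pi\<^sub>M {..<N} (\<lambda>_. uniform_sphere)
      | RC \<Rightarrow> (\<exists>e. bij_betw e {..<DIM('a)} (Basis :: 'a set) \<and>
                 D = distr (without_replacement DIM('a) N) (tuple_space N)
                       (\<lambda>J. \<lambda>j\<in>{..<N}. e (J j)))
      | RS \<Rightarrow> (\<exists>Q. prob_space Q \<and> sets Q = sets (tuple_space DIM('a)) \<and>
                 (AE b in Q. \<forall>i<DIM('a). \<forall>j<DIM('a). b i \<bullet> b j = (if i = j then 1 else 0)) \<and>
                 D = distr (Q \<Otimes>\<^sub>M without_replacement DIM('a) N) (tuple_space N)
                       (\<lambda>(b, J). \<lambda>j\<in>{..<N}. b (J j))))"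


subsection \<open>Information available to the algorithm\<close>

text \<open>
  \<open>u k j\<close> is the \<open>j\<close>-th direction of iteration \<open>k\<close> (\<open>j < N\<close>), and the sample set of iteration \<open>k\<close>
  consists of the first \<open>n k\<close> members of the sequence \<open>\<zeta> k 0, \<zeta> k 1, \<dots>\<close>.  Only the samples that are
  actually used enter the \<open>\<sigma>\<close>-algebras.  The initial point is deterministic and contributes nothing.
\<close>

definition past ::
  "'w measure \<Rightarrow> 'z measure \<Rightarrow> nat \<Rightarrow> (nat \<Rightarrow> nat \<Rightarrow> 'w \<Rightarrow> 'a::topological_space) \<Rightarrow>
   (nat \<Rightarrow> 'w \<Rightarrow> nat) \<Rightarrow> (nat \<Rightarrow> nat \<Rightarrow> 'w \<Rightarrow> 'z) \<Rightarrow> nat \<Rightarrow> 'w measure" where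
  "past M P N u n \<zeta> k = sigma (space M)
     ((\<Union>l<k. \<Union>j<N. {u l j -` B \<inter> space M | B. B \<in> sets borel}) \<union>
      (\<Union>l<k. \<Union>i. {{\<omega> \<in> space M. i < n l \<omega> \<and> \<zeta> l i \<omega> \<in> A} | A. A \<in> sets P}))"

definition past_half ::
  "'w measure \<Rightarrow> 'z measure \<Rightarrow> nat \<Rightarrow> (nat \<Rightarrow> nat \<Rightarrow> 'w \<Rightarrow> 'a::topological_space) \<Rightarrow>
   (nat \<Rightarrow> 'w \<Rightarrow> nat) \<Rightarrow> (nat \<Rightarrow> nat \<Rightarrow> 'w \<Rightarrow> 'z) \<Rightarrow> nat \<Rightarrow> 'w measure" where
  "past_half M P N u n \<zeta> k = sigma (space M)
     (sets (past M P N u n \<zeta> k) \<union> (\<Union>j<N. {u k j -` B \<inter> space M | B. B \<in> sets borel}))"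

definition indep_of_algebra ::
  "'w measure \<Rightarrow> 'w measure \<Rightarrow> 's measure \<Rightarrow> ('w \<Rightarrow> 's) \<Rightarrow> bool" where
  "indep_of_algebra M G S X \<longleftrightarrow>
     prob_space.indep_set M (sets (vimage_algebra (space M) X S)) (sets G)"

text \<open>Conditional expectation of a vector-valued random variable, taken componentwise.\<close>

definition vec_cond_exp ::
  "'w measure \<Rightarrow> 'w measure \<Rightarrow> ('w \<Rightarrow> 'a::euclidean_space) \<Rightarrow> 'w \<Rightarrow> 'a" where
  "vec_cond_exp M G X \<omega> = (\<Sum>b\<in>Basis. real_cond_exp M G (\<lambda>\<omega>. X \<omega> \<bullet> b) \<omega> *\<^sub>R b)"

end

theory Submission
  imports Defs
begin

text \<open>
  Each step decreases the expected optimality gap by a factor \<open>1 - \<rho>\<close> up to an error \<open>\<rho> \<epsilon> p / 2\<close>; the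
  probability bound is then Markov's inequality.  Conditioning on the past and on the directions turns
  the mini-batch estimator \<open>g\<close> into \<open>g\<^sub>T\<close>, and every sample size condition gives
  \<open>E \<parallel>g\<parallel>\<^sup>2 \<le> (1 + \<theta>\<^sup>2) E \<parallel>g\<^sub>T\<parallel>\<^sup>2\<close>, so the descent lemma reduces the claim to
  \<open>s / 8 E \<parallel>g\<^sub>T\<parallel>\<^sup>2 - \<langle>\<nabla>F, E g\<^sub>T\<rangle> \<le> \<mu> \<epsilon> p / 4 - \<parallel>\<nabla>F\<parallel>\<^sup>2 / 4\<close> for a fixed point and fresh directions, where \<open>s\<close> is
  the step factor.  For coordinate and subspace directions this is a computation in an orthonormal
  basis.  For the smoothing methods the bias of \<open>g\<^sub>T\<close> must be bounded by \<open>L \<nu> sqrt d\<close> (Gaussian) or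
  \<open>L \<nu>\<close> (sphere); both bounds follow from the invariance of the direction law under reflections,
  without integration by parts.
\<close>

subsection \<open>Functions with Lipschitz gradient\<close>

text \<open>The prescribed radii fix how large the bias of a smoothing method may be. The pointwise
  bound \<open>L * \<nu> / 2 * (norm u)^2\<close> on the Taylor remainder only gives a bias of order
  \<open>L * \<nu> * d\<close> (Gaussian) or \<open>L * \<nu> * sqrt d\<close> (sphere), too large
  by a factor of order \<open>sqrt d\<close>. Testing the bias against a unit vector
  \<open>v\<close> and comparing \<open>u\<close> with its mirror image recovers this factor, since
  only the variation of the remainder along \<open>v\<close> enters. With the resulting bounds the
  error weight \<open>12 N + 36 d\<close> of the descent inequality is exactly 3/2 times the part
  \<open>8 N + 24 d\<close> of the radius denominators. A second obstacle is Condition 3: it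
  averages the variance over the directions but not the sample size, which may depend on them, so
  the quotient cannot be averaged directly. Finally, every expectation has to exist. A finite
  expected gap is carried through the induction; it makes the squared gradient integrable, and sixth
  moments of the directions do the rest.\<close>

lemma GDERIV_along_line:
  fixes F :: "'a::euclidean_space \<Rightarrow> real"
  assumes "\<And>y. GDERIV F y :> G y"
  shows "((\<lambda>t. F (a + t *\<^sub>R v)) has_real_derivative (v \<bullet> G (a + t *\<^sub>R v))) (at t)"
proof -
  have "((\<lambda>t. F (a + t *\<^sub>R v)) has_derivative (\<lambda>h. (h *\<^sub>R v) \<bullet> G (a + t *\<^sub>R v))) (at t)"
    by (rule has_derivative_compose[where g=F, OF _ assms[unfolded gderiv_def]])
       (auto intro!: derivative_eq_intros)
  then show ?thesis
    by (simp add: has_field_derivative_def mult_commute_abs)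
qed

lemma lipschitz_inner_le:
  fixes G :: "'a::euclidean_space \<Rightarrow> 'a"
  assumes "L-lipschitz_on UNIV G"
  shows "\<bar>v \<bullet> (G y - G z)\<bar> \<le> norm v * (L * norm (y - z))"
proof -
  have "norm (G y - G z) \<le> L * norm (y - z)"
    using lipschitz_onD[OF assms, of y z] by (simp add: dist_norm)
  then show ?thesis
    by (meson Cauchy_Schwarz_ineq2 mult_left_mono norm_ge_zero order_trans)
qed

lemma lipschitz_gradient_upper:
  fixes F :: "'a::euclidean_space \<Rightarrow> real"
  assumes F: "\<And>y. GDERIV F y :> G y" and L: "L-lipschitz_on UNIV G"
  shows "F (a + v) \<le> F a + v \<bullet> G a + L / 2 * (norm v)\<^sup>2"
proof -
  \<comment> \<open>The difference of the two sides along the segment from \<open>a\<close> to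
    \<open>a + v\<close>; it is nonincreasing, so no integral of the gradient has to be
    formed.\<close>
  define \<phi> where "\<phi> t = F (a + t *\<^sub>R v) - t * (v \<bullet> G a) - L / 2 * (norm v)\<^sup>2 * t\<^sup>2" for t
  have "\<phi> 1 \<le> \<phi> 0"
  proof (rule DERIV_nonpos_imp_nonincreasing[where a=0 and b=1 and f=\<phi>])
    fix t :: real assume t: "0 \<le> t" "t \<le> 1"
    have "(\<phi> has_real_derivative (v \<bullet> G (a + t *\<^sub>R v) - v \<bullet> G a - L * (norm v)\<^sup>2 * t)) (at t)"
      unfolding \<phi>_def by (rule derivative_eq_intros GDERIV_along_line[OF F] refl | simp)+
    moreover have "v \<bullet> (G (a + t *\<^sub>R v) - G a) \<le> norm v * (L * norm (t *\<^sub>R v))"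
      using lipschitz_inner_le[OF L, of v "a + t *\<^sub>R v" a] by simp
    then have "v \<bullet> G (a + t *\<^sub>R v) - v \<bullet> G a - L * (norm v)\<^sup>2 * t \<le> 0"
      using t by (simp add: inner_diff_right power2_eq_square mult_ac)
    ultimately show "\<exists>y. (\<phi> has_real_derivative y) (at t) \<and> y \<le> 0" by blast
  qed simp
  then show ?thesis by (simp add: \<phi>_def)
qed

lemma lipschitz_gradient_abs:
  fixes F :: "'a::euclidean_space \<Rightarrow> real"
  assumes F: "\<And>y. GDERIV F y :> G y" and L: "L-lipschitz_on UNIV G"
  shows "\<bar>F (a + v) - F a - v \<bullet> G a\<bar> \<le> L / 2 * (norm v)\<^sup>2"
proof -
  have "GDERIV (\<lambda>y. - F y) y :> - G y" for y using F by (rule GDERIV_minus)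
  moreover have "L-lipschitz_on UNIV (\<lambda>y. - G y)"
    using L by (simp add: lipschitz_on_def dist_norm norm_minus_commute)
  ultimately have "- F (a + v) \<le> - F a + v \<bullet> (- G a) + L / 2 * (norm v)\<^sup>2"
    by (rule lipschitz_gradient_upper)
  then show ?thesis using lipschitz_gradient_upper[OF F L, of a v] by (intro abs_leI) simp_all
qed

lemma lipschitz_gradient_diff_le:
  fixes F :: "'a::euclidean_space \<Rightarrow> real"
  assumes F: "\<And>y. GDERIV F y :> G y" and L: "L-lipschitz_on UNIV G"
  shows "\<bar>F (a + v) - F a\<bar> \<le> norm v * (norm (G a) + L * norm v)"
proof -
  have "0 \<le> L" using L by (rule lipschitz_on_nonneg)
  then have "L / 2 * (norm v)\<^sup>2 \<le> L * (norm v)\<^sup>2" by (intro mult_right_mono) auto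
  moreover have "\<bar>v \<bullet> G a\<bar> \<le> norm v * norm (G a)" by (rule Cauchy_Schwarz_ineq2)
  moreover have "norm v * (norm (G a) + L * norm v) = norm v * norm (G a) + L * (norm v)\<^sup>2"
    by (simp add: algebra_simps power2_eq_square)
  ultimately show ?thesis using lipschitz_gradient_abs[OF F L, of a v] by linarith
qed

text \<open>At the gradient step \<open>y - G y / L\<close> the quadratic upper bound has dropped by
  \<open>(norm (G y))^2 / (2 * L)\<close>, yet the function value is still at least
  \<open>c\<close>. This turns an integrable optimality gap into a square-integrable
  gradient.\<close>

lemma norm_gradient_le_gap:
  fixes F :: "'a::euclidean_space \<Rightarrow> real"
  assumes F: "\<And>y. GDERIV F y :> G y" and L: "L-lipschitz_on UNIV G" "0 < L"
    and min: "\<And>y. c \<le> F y"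
  shows "(norm (G y))\<^sup>2 \<le> 2 * L * (F y - c)"
proof -
  have "c \<le> F (y + (- 1 / L) *\<^sub>R G y)" by (rule min)
  also have "\<dots> \<le> F y + ((- 1 / L) *\<^sub>R G y) \<bullet> G y + L / 2 * (norm ((- 1 / L) *\<^sub>R G y))\<^sup>2"
    by (rule lipschitz_gradient_upper[OF F L(1)])
  also have "\<dots> = F y - (norm (G y))\<^sup>2 / (2 * L)"
    using L(2) by (simp add: dot_square_norm power_divide field_simps power2_eq_square)
  finally show ?thesis using L(2) by (simp add: field_simps)
qed

lemma GDERIV_imp_continuous_on:
  fixes F :: "'a::euclidean_space \<Rightarrow> real"
  assumes "\<And>y. GDERIV F y :> G y"
  shows "continuous_on UNIV F"
  using assms has_derivative_continuous[OF assms[unfolded gderiv_def]]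
  by (auto simp: continuous_on_eq_continuous_at)

text \<open>The first-order Taylor remainder divided by \<open>\<nu>\<close>: the error of the
  forward difference quotient as a directional derivative. The rest of the quotient is linear in
  \<open>u\<close>, so the whole bias of the estimator sits here.\<close>

definition taylor_rem :: "('a::real_inner \<Rightarrow> real) \<Rightarrow> 'a \<Rightarrow> 'a \<Rightarrow> real \<Rightarrow> 'a \<Rightarrow> real" where
  "taylor_rem F g x \<nu> u = (F (x + \<nu> *\<^sub>R u) - F x) / \<nu> - u \<bullet> g"

lemma taylor_rem_abs_le:
  fixes F :: "'a::euclidean_space \<Rightarrow> real"
  assumes F: "\<And>y. GDERIV F y :> G y" and L: "L-lipschitz_on UNIV G" and \<nu>: "0 < \<nu>"
  shows "\<bar>taylor_rem F (G x) x \<nu> u\<bar> \<le> L * \<nu> / 2 * (norm u)\<^sup>2"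
proof -
  have "\<nu> * taylor_rem F (G x) x \<nu> u = F (x + \<nu> *\<^sub>R u) - F x - (\<nu> *\<^sub>R u) \<bullet> G x"
    using \<nu> by (simp add: taylor_rem_def field_simps)
  then have "\<bar>\<nu> * taylor_rem F (G x) x \<nu> u\<bar> \<le> L / 2 * (norm (\<nu> *\<^sub>R u))\<^sup>2"
    using lipschitz_gradient_abs[OF F L, of x "\<nu> *\<^sub>R u"] by simp
  then have "\<nu> * \<bar>taylor_rem F (G x) x \<nu> u\<bar> \<le> \<nu> * (L * \<nu> / 2 * (norm u)\<^sup>2)"
    using \<nu> by (simp add: abs_mult power_mult_distrib power2_eq_square mult_ac)
  then show ?thesis using \<nu> by simp
qed

text \<open>
  The derivative in \<open>t\<close> of the difference of the remainders is at most
  \<open>2 L \<nu> sqrt (\<parallel>w\<parallel>\<^sup>2 + t\<^sup>2) \<le> L \<nu> ((\<parallel>w\<parallel>\<^sup>2 + t\<^sup>2) / c + c)\<close>.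
\<close>

lemma taylor_rem_reflection_le:
  fixes F :: "'a::euclidean_space \<Rightarrow> real"
  assumes F: "\<And>y. GDERIV F y :> G y" and L: "L-lipschitz_on UNIV G" and \<nu>: "0 < \<nu>"
    and v: "norm v = 1" and w: "w \<bullet> v = 0" and c: "0 < c"
  shows "t * (taylor_rem F (G x) x \<nu> (w + t *\<^sub>R v) - taylor_rem F (G x) x \<nu> (w - t *\<^sub>R v))
         \<le> L * \<nu> * (((norm w)\<^sup>2 * t\<^sup>2 + t^4 / 3) / c + c * t\<^sup>2)"
proof -
  let ?R = "taylor_rem F (G x) x \<nu>"
  have L0: "0 \<le> L" using L by (rule lipschitz_on_nonneg)
  \<comment> \<open>Replacing \<open>t\<close> by \<open>- t\<close> changes the sign of both
    factors on the left, and the right side is even in \<open>t\<close>; nonnegative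
    \<open>t\<close> therefore suffices.\<close>
  have main: "t * (?R (w + t *\<^sub>R v) - ?R (w - t *\<^sub>R v))
         \<le> L * \<nu> * (((norm w)\<^sup>2 * t\<^sup>2 + t^4 / 3) / c + c * t\<^sup>2)" if t: "0 \<le> t" for t
  proof -
    have R: "?R (w + s *\<^sub>R v') = (F ((x + \<nu> *\<^sub>R w) + s *\<^sub>R (\<nu> *\<^sub>R v')) - F x) / \<nu> - w \<bullet> G x - s * (v' \<bullet> G x)" for s v'
      by (simp add: taylor_rem_def algebra_simps)
    \<comment> \<open>The direction stays a parameter because both \<open>v\<close> and
      \<open>- v\<close> are used: \<open>w - t v\<close> is reached from \<open>w\<close> along
      \<open>- v\<close>.\<close>
    have DR: "((\<lambda>s. ?R (w + s *\<^sub>R v')) has_real_derivative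
        v' \<bullet> (G (x + \<nu> *\<^sub>R (w + s *\<^sub>R v')) - G x)) (at s)" for s v'
    proof -
      have "((\<lambda>s. (F ((x + \<nu> *\<^sub>R w) + s *\<^sub>R (\<nu> *\<^sub>R v')) - F x) / \<nu> - w \<bullet> G x - s * (v' \<bullet> G x)) has_real_derivative
        (\<nu> *\<^sub>R v') \<bullet> G ((x + \<nu> *\<^sub>R w) + s *\<^sub>R (\<nu> *\<^sub>R v')) / \<nu> - v' \<bullet> G x) (at s)"
        using GDERIV_along_line[of F G "x + \<nu> *\<^sub>R w" "\<nu> *\<^sub>R v'" s, OF F]
        by (auto intro!: derivative_eq_intros)
      then show ?thesis unfolding R using \<nu> by (simp add: algebra_simps inner_diff_right)
    qed
    have le: "v \<bullet> (G (x + \<nu> *\<^sub>R (w + s *\<^sub>R v')) - G x) \<le> L * \<nu> * (((norm w)\<^sup>2 + s\<^sup>2) / c + c) / 2"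
      if v': "v' = v \<or> v' = - v" for s v'
    proof -
      have n: "(norm (w + s *\<^sub>R v'))\<^sup>2 = (norm w)\<^sup>2 + s\<^sup>2"
      proof -
        have vv: "v' \<bullet> v' = 1" "w \<bullet> v' = 0" using v v' w by (auto simp: norm_eq_1)
        show ?thesis unfolding power2_norm_eq_inner
          using vv by (simp add: inner_add_left inner_add_right inner_commute[of v' w] power2_eq_square)
      qed
      \<comment> \<open>The AM-GM inequality with weight \<open>c\<close> replaces the norm, a
        square root in \<open>s\<close>, by a polynomial that has an explicit
        antiderivative.\<close>
      have "0 \<le> (norm (w + s *\<^sub>R v') - c)\<^sup>2" by simp
      then have "2 * norm (w + s *\<^sub>R v') * c \<le> (norm w)\<^sup>2 + s\<^sup>2 + c * c"
        by (simp add: power2_diff n) (simp add: power2_eq_square)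
      then have am: "norm (w + s *\<^sub>R v') \<le> (((norm w)\<^sup>2 + s\<^sup>2) / c + c) / 2"
        using c by (simp add: field_simps)
      have "v \<bullet> (G (x + \<nu> *\<^sub>R (w + s *\<^sub>R v')) - G x) \<le> norm v * (L * norm (\<nu> *\<^sub>R (w + s *\<^sub>R v')))"
        using lipschitz_inner_le[OF L, of v "x + \<nu> *\<^sub>R (w + s *\<^sub>R v')" x]
        by (simp only: add_diff_cancel_left')
      also have "\<dots> = L * \<nu> * norm (w + s *\<^sub>R v')" using v v' \<nu> by auto
      also have "\<dots> \<le> L * \<nu> * ((((norm w)\<^sup>2 + s\<^sup>2) / c + c) / 2)"
        using am L0 \<nu> by (intro mult_left_mono) auto
      finally show ?thesis by simp
    qed
    define \<phi> where "\<phi> s = ?R (w + s *\<^sub>R v) - ?R (w + s *\<^sub>R (- v)) - L * \<nu> * (((norm w)\<^sup>2 * s + s^3 / 3) / c + c * s)" for s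
    have "\<phi> t \<le> \<phi> 0"
    proof (rule DERIV_nonpos_imp_nonincreasing[where a=0 and b=t and f=\<phi>])
      fix s :: real
      have "(\<phi> has_real_derivative
         (v \<bullet> (G (x + \<nu> *\<^sub>R (w + s *\<^sub>R v)) - G x) - (- v) \<bullet> (G (x + \<nu> *\<^sub>R (w + s *\<^sub>R (- v))) - G x)
          - L * \<nu> * (((norm w)\<^sup>2 + s\<^sup>2) / c + c))) (at s)"
      proof -
        have "((\<lambda>s. L * \<nu> * (((norm w)\<^sup>2 * s + s^3 / 3) / c + c * s)) has_real_derivative
            L * \<nu> * (((norm w)\<^sup>2 + s\<^sup>2) / c + c)) (at s)"
          using c by (auto intro!: derivative_eq_intros simp: power2_eq_square)
        then show ?thesis
          unfolding \<phi>_def by (intro DERIV_diff DR)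
      qed
      moreover have "v \<bullet> (G (x + \<nu> *\<^sub>R (w + s *\<^sub>R v)) - G x) - (- v) \<bullet> (G (x + \<nu> *\<^sub>R (w + s *\<^sub>R (- v))) - G x)
          - L * \<nu> * (((norm w)\<^sup>2 + s\<^sup>2) / c + c) \<le> 0"
      proof -
        have "v \<bullet> (G (x + \<nu> *\<^sub>R (w + s *\<^sub>R v)) - G x) \<le> L * \<nu> * (((norm w)\<^sup>2 + s\<^sup>2) / c + c) / 2"
          by (rule le) simp
        moreover have "v \<bullet> (G (x + \<nu> *\<^sub>R (w + s *\<^sub>R (- v))) - G x) \<le> L * \<nu> * (((norm w)\<^sup>2 + s\<^sup>2) / c + c) / 2"
          by (rule le) simp
        moreover have "p + q - B \<le> 0" if "p \<le> B / 2" "q \<le> B / 2" for p q B :: real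
          using that by linarith
        ultimately show ?thesis by (simp only: inner_minus_left diff_minus_eq_add)
      qed
      ultimately show "\<exists>y. (\<phi> has_real_derivative y) (at s) \<and> y \<le> 0" by blast
    qed (use t in simp)
    then have "?R (w + t *\<^sub>R v) - ?R (w - t *\<^sub>R v) \<le> L * \<nu> * (((norm w)\<^sup>2 * t + t^3 / 3) / c + c * t)"
      by (simp add: \<phi>_def)
    then have "t * (?R (w + t *\<^sub>R v) - ?R (w - t *\<^sub>R v)) \<le> t * (L * \<nu> * (((norm w)\<^sup>2 * t + t^3 / 3) / c + c * t))"
      using t by (rule mult_left_mono)
    also have "\<dots> = L * \<nu> * (((norm w)\<^sup>2 * t\<^sup>2 + t^4 / 3) / c + c * t\<^sup>2)"
      using c by (simp add: field_simps power2_eq_square eval_nat_numeral)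
    finally show ?thesis .
  qed
  show ?thesis
  proof (cases "0 \<le> t")
    case False
    then show ?thesis using main[of "- t"] by (simp add: algebra_simps)
  qed (rule main)
qed

subsection \<open>Rotation invariance of Lebesgue measure\<close>

lemma lborel_distr_uminus_euclidean:
  "distr lborel borel uminus = (lborel :: 'a::euclidean_space measure)"
  using lborel_affine[of "-1" "0::'a"] by (simp add: density_1)

lemma distr_plus_lborel:
  fixes c :: "'a::euclidean_space"
  shows "distr lborel borel (\<lambda>x. x + c) = lborel"
proof -
  have "(\<lambda>x. x + c) = (+) c" by (simp add: fun_eq_iff add.commute)
  then show ?thesis by (simp add: lborel_distr_plus)
qed

text \<open>
  For translation invariant \<open>\<mu>\<close> and \<open>\<lambda>\<close> the identity
  \<open>\<mu> A * \<lambda> B = \<integral> \<integral> 1\<^sub>A (x) 1\<^sub>B (x + y) = \<mu> B * \<lambda> (- A)\<close> determines \<open>\<mu>\<close> up to a factor.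
\<close>

lemma translation_invariant_eq_lborel:
  fixes \<mu> :: "'a::euclidean_space measure"
  assumes sets: "sets \<mu> = sets borel" and sf: "sigma_finite_measure \<mu>"
    and inv: "\<And>c. distr \<mu> borel (\<lambda>x. x + c) = \<mu>"
    and ball: "emeasure \<mu> (ball 0 1) = emeasure lborel (ball 0 1 :: 'a set)"
  shows "\<mu> = lborel"
proof (rule measure_eqI)
  interpret mu: sigma_finite_measure \<mu> by (rule sf)
  interpret pair_sigma_finite \<mu> lborel ..
  note [measurable_cong] = sets
  have sp: "space \<mu> = UNIV" using sets_eq_imp_space_eq[OF sets] by simp
  have inv_lborel: "(\<integral>\<^sup>+y. f (x + y) \<partial>lborel) = (\<integral>\<^sup>+y. f y \<partial>lborel)"
    if [measurable]: "f \<in> borel_measurable borel" for f and x :: 'a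
    by (subst (2) lborel_distr_plus[of x, symmetric]) (simp add: nn_integral_distr)
  have inv_mu: "(\<integral>\<^sup>+y. f (y + x) \<partial>\<mu>) = (\<integral>\<^sup>+y. f y \<partial>\<mu>)"
    if [measurable]: "f \<in> borel_measurable borel" for f and x :: 'a
    by (subst (2) inv[of x, symmetric]) (simp add: nn_integral_distr)
  have neg: "(\<integral>\<^sup>+y. f (- y) \<partial>lborel) = (\<integral>\<^sup>+y. f y \<partial>lborel)"
    if [measurable]: "f \<in> borel_measurable borel" for f :: "'a \<Rightarrow> ennreal"
    by (subst (2) lborel_distr_uminus_euclidean[symmetric]) (simp add: nn_integral_distr)
  have key: "emeasure \<mu> A * emeasure lborel B = emeasure \<mu> B * emeasure lborel A"
    if [measurable]: "A \<in> sets borel" "B \<in> sets borel" for A B :: "'a set"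
  proof -
    have "emeasure \<mu> A * emeasure lborel B = (\<integral>\<^sup>+x. indicator A x * (\<integral>\<^sup>+y. indicator B y \<partial>lborel) \<partial>\<mu>)"
      by (simp add: nn_integral_multc)
    also have "\<dots> = (\<integral>\<^sup>+x. indicator A x * (\<integral>\<^sup>+y. indicator B (x + y) \<partial>lborel) \<partial>\<mu>)"
      by (subst inv_lborel) auto
    also have "\<dots> = (\<integral>\<^sup>+x. (\<integral>\<^sup>+y. indicator A x * indicator B (x + y) \<partial>lborel) \<partial>\<mu>)"
      by (intro nn_integral_cong nn_integral_cmult[symmetric]) measurable
    also have "\<dots> = (\<integral>\<^sup>+y. (\<integral>\<^sup>+x. indicator A x * indicator B (x + y) \<partial>\<mu>) \<partial>lborel)"
      by (rule Fubini'[symmetric]) measurable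
    also have "\<dots> = (\<integral>\<^sup>+y. (\<integral>\<^sup>+x. indicator A (x - y) * indicator B x \<partial>\<mu>) \<partial>lborel)"
    proof (rule nn_integral_cong)
      fix y :: 'a
      show "(\<integral>\<^sup>+x. indicator A x * indicator B (x + y) \<partial>\<mu>) = (\<integral>\<^sup>+x. indicator A (x - y) * indicator B x \<partial>\<mu>)"
        using inv_mu[of "\<lambda>x. indicator A (x - y) * indicator B x" y] by simp
    qed
    also have "\<dots> = (\<integral>\<^sup>+x. (\<integral>\<^sup>+y. indicator A (x - y) * indicator B x \<partial>lborel) \<partial>\<mu>)"
      by (rule Fubini') measurable
    also have "\<dots> = (\<integral>\<^sup>+x. (\<integral>\<^sup>+y. indicator A (x - y) \<partial>lborel) * indicator B x \<partial>\<mu>)"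
      by (intro nn_integral_cong nn_integral_multc) measurable
    \<comment> \<open>Lebesgue measure is also invariant under \<open>y\<close> to
      \<open>x - y\<close>, a point reflection followed by a translation, so the mass of
      \<open>- A\<close> is that of \<open>A\<close>.\<close>
    also have "\<dots> = (\<integral>\<^sup>+x. (\<integral>\<^sup>+y. indicator A y \<partial>lborel) * indicator B x \<partial>\<mu>)"
    proof (rule nn_integral_cong)
      fix x :: 'a
      have "(\<integral>\<^sup>+y. indicator A (x - y) \<partial>lborel) = (\<integral>\<^sup>+y. indicator A (x + y) \<partial>lborel)"
        using neg[of "\<lambda>y. indicator A (x + y)"] by simp
      then show "(\<integral>\<^sup>+y. indicator A (x - y) \<partial>lborel) * indicator B x = (\<integral>\<^sup>+y. indicator A y \<partial>lborel) * indicator B x"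
        by (simp add: inv_lborel)
    qed
    also have "\<dots> = emeasure \<mu> B * emeasure lborel A"
      by (simp add: nn_integral_multc mult.commute)
    finally show ?thesis .
  qed
  show "sets \<mu> = sets lborel" using sets by simp
  \<comment> \<open>The unit ball serves as \<open>B\<close>: its mass is the same under both
    measures and neither zero nor infinite, so it cancels.\<close>
  fix A assume "A \<in> sets \<mu>"
  then have "emeasure \<mu> A * emeasure lborel (ball 0 (1::real) :: 'a set)
      = emeasure lborel A * emeasure lborel (ball 0 (1::real) :: 'a set)"
    using key[of A "ball 0 1"] sets by (simp add: ball mult.commute)
  moreover have "emeasure lborel (ball 0 (1::real) :: 'a set) \<noteq> 0"
    using content_ball_pos[of 1 "0::'a"] by (auto simp: measure_def)
  moreover have "emeasure lborel (ball 0 (1::real) :: 'a set) \<noteq> \<infinity>"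
    using emeasure_lborel_ball_finite[of "0::'a" 1] by (simp add: less_top)
  ultimately show "emeasure \<mu> A = emeasure lborel A"
    by (simp add: ennreal_mult_cancel_left mult.commute[of _ "emeasure lborel (ball 0 1)"])
qed

section \<open>Hyperplane reflections\<close>

definition reflect :: "'a::euclidean_space \<Rightarrow> 'a \<Rightarrow> 'a" where
  "reflect v u = u - (2 * (v \<bullet> u)) *\<^sub>R v"

lemma reflect_measurable [measurable]: "reflect v \<in> borel_measurable borel"
  unfolding reflect_def by measurable

lemma norm_reflect [simp]:
  assumes "norm v = 1" shows "norm (reflect v u) = norm u"
proof -
  have "v \<bullet> v = 1" using assms by (simp add: norm_eq_1)
  then have "reflect v u \<bullet> reflect v u = u \<bullet> u"
    by (simp add: reflect_def inner_diff_left inner_diff_right inner_commute algebra_simps)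
  then show ?thesis by (simp add: norm_eq_sqrt_inner)
qed

lemma inner_reflect:
  assumes "norm v = 1" shows "v \<bullet> reflect v u = - (v \<bullet> u)"
proof -
  have "v \<bullet> v = 1" using assms by (simp add: norm_eq_1)
  then show ?thesis by (simp add: reflect_def inner_diff_right)
qed

lemma reflect_add: "reflect v (a + b) = reflect v a + reflect v b"
  by (simp add: reflect_def inner_add_right algebra_simps)

lemma reflect_reflect:
  assumes "norm v = 1" shows "reflect v (reflect v u) = u"
  using inner_reflect[OF assms, of u] by (simp add: reflect_def[of v "reflect v u"]) (simp add: reflect_def)

text \<open>A reflection turns translation by \<open>c\<close> into translation by
  \<open>reflect v c\<close>, so the image measure is again translation invariant. It maps centred
  balls onto themselves, which yields both the normalization and a countable cover by sets of finite
  mass.\<close>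

lemma distr_reflect_lborel:
  fixes v :: "'a::euclidean_space"
  assumes v: "norm v = 1"
  shows "distr lborel borel (reflect v) = lborel"
proof (rule translation_invariant_eq_lborel)
  have vimage_ball: "reflect v -` ball 0 r = ball 0 r" for r
    using v by (auto simp: dist_norm)
  show "emeasure (distr lborel borel (reflect v)) (ball 0 1) = emeasure lborel (ball 0 1 :: 'a set)"
    by (simp add: emeasure_distr vimage_ball)
  show "sigma_finite_measure (distr lborel borel (reflect v))"
  proof
    have "(\<Union>n::nat. ball (0::'a) (real n)) = UNIV"
      by (auto simp: reals_Archimedean2)
    then show "\<exists>A. countable A \<and> A \<subseteq> sets (distr lborel borel (reflect v)) \<and>
        \<Union> A = space (distr lborel borel (reflect v)) \<and>
        (\<forall>a\<in>A. emeasure (distr lborel borel (reflect v)) a \<noteq> \<infinity>)"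
      using emeasure_lborel_ball_finite[of "0::'a"]
      by (intro exI[of _ "range (\<lambda>n::nat. ball 0 (real n))"])
         (auto simp: emeasure_distr vimage_ball less_top)
  qed
  fix c :: 'a
  have "distr (distr lborel borel (reflect v)) borel (\<lambda>x. x + c)
      = distr (distr lborel borel (\<lambda>x. x + reflect v c)) borel (reflect v)"
    by (simp add: distr_distr comp_def reflect_add reflect_reflect[OF v])
  then show "distr (distr lborel borel (reflect v)) borel (\<lambda>x. x + c) = distr lborel borel (reflect v)"
    by (simp add: distr_plus_lborel)
qed simp

subsection \<open>Reflection invariant distributions\<close>

text \<open>Reflection symmetry is the structure that the Gaussian and the sphere law share. Degree
  six is what the squared estimator asks for: the squared remainder grows like
  \<open>norm u ^ 4\<close> and is multiplied by \<open>(norm u)^2\<close>.\<close>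

locale isotropic = prob_space Q for Q :: "'a::euclidean_space measure" +
  assumes sets_Q [measurable_cong, simp]: "sets Q = sets borel"
    and distr_reflect: "\<And>v. norm v = 1 \<Longrightarrow> distr Q borel (reflect v) = Q"
    and integrable_norm_6: "integrable Q (\<lambda>u. norm u ^ 6)"
begin

lemma integrable_bound_norm_6:
  assumes [measurable]: "(h :: 'a \<Rightarrow> 'b::{banach, second_countable_topology}) \<in> borel_measurable borel"
    and "\<And>u. norm (h u) \<le> C * (1 + norm u ^ 6)"
  shows "integrable Q h"
proof (rule Bochner_Integration.integrable_bound)
  show "integrable Q (\<lambda>u. C * (1 + norm u ^ 6))" using integrable_norm_6 by auto
  show "AE x in Q. norm (h x) \<le> norm (C * (1 + norm x ^ 6))"
    using assms(2) by (auto intro!: AE_I2 intro: order_trans[OF _ abs_ge_self])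
qed measurable

lemma integrable_bound_norm_power:
  assumes h: "(h :: 'a \<Rightarrow> 'b::{banach, second_countable_topology}) \<in> borel_measurable borel"
    and "\<And>u. norm (h u) \<le> C * norm u ^ k" and k: "k \<le> 6" and C: "0 \<le> C"
  shows "integrable Q h"
proof (rule integrable_bound_norm_6[OF h])
  fix u :: 'a
  have "norm u ^ k \<le> 1 + norm u ^ 6"
  proof (cases "norm u \<le> 1")
    case True then show ?thesis by (smt (verit) power_le_one norm_ge_zero zero_le_power)
  next
    case False
    then have "norm u ^ k \<le> norm u ^ 6" using k by (intro power_increasing) auto
    then show ?thesis by linarith
  qed
  then have "C * norm u ^ k \<le> C * (1 + norm u ^ 6)" using C by (rule mult_left_mono)
  then show "norm (h u) \<le> C * (1 + norm u ^ 6)" using assms(2)[of u] by linarith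
qed

lemma integral_reflect:
  assumes "norm v = 1" and [measurable]: "h \<in> borel_measurable borel"
  shows "(\<integral>u. h (reflect v u) \<partial>Q) = (\<integral>u. (h u :: real) \<partial>Q)"
  by (subst (2) distr_reflect[OF assms(1), symmetric]) (simp add: integral_distr)

text \<open>Two distinct unit vectors are mirror images of each other in the hyperplane orthogonal
  to \<open>v - w\<close>, and the reflection keeps the norm of \<open>u\<close>.\<close>

lemma integral_inner_swap:
  assumes v: "norm v = 1" and w: "norm w = 1"
    and h [measurable]: "(\<lambda>u. h (v \<bullet> u) (norm u) :: real) \<in> borel_measurable borel"
  shows "(\<integral>u. h (w \<bullet> u) (norm u) \<partial>Q) = (\<integral>u. h (v \<bullet> u) (norm u) \<partial>Q)"
proof (cases "v = w")
  case False
  define z where "z = (1 / norm (v - w)) *\<^sub>R (v - w)"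
  have z: "norm z = 1" using False by (simp add: z_def)
  have vv: "v \<bullet> v = 1" "w \<bullet> w = 1" using v w by (auto simp: norm_eq_1)
  have n2: "(norm (v - w))\<^sup>2 = 2 - 2 * (v \<bullet> w)"
    by (simp add: power2_norm_eq_inner inner_diff_left inner_diff_right vv inner_commute[of w v])
  have "v \<bullet> reflect z u = w \<bullet> u" for u
  proof -
    have half: "v \<bullet> (v - w) = (norm (v - w))\<^sup>2 / 2"
      using n2 by (simp add: inner_diff_right vv)
    have "2 * (z \<bullet> u) * (v \<bullet> z) = 2 * ((v - w) \<bullet> u) * (v \<bullet> (v - w)) / (norm (v - w))\<^sup>2"
      by (simp add: z_def power2_eq_square)
    also have "\<dots> = (v - w) \<bullet> u"
      unfolding half using False by simp
    finally show ?thesis by (simp add: reflect_def inner_diff_right inner_diff_left)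
  qed
  then show ?thesis using integral_reflect[OF z h] z by simp
qed simp

text \<open>Over an orthonormal basis the squared components add up to the squared norm, and by
  \<open>integral_inner_swap\<close> all of them have the same weighted expectation; each therefore
  takes an equal share.\<close>

lemma integral_inner_square:
  assumes k: "k \<le> 4"
  shows "(\<integral>u. (a \<bullet> u)\<^sup>2 * norm u ^ k \<partial>Q) = (norm a)\<^sup>2 / DIM('a) * (\<integral>u. norm u ^ (k + 2) \<partial>Q)"
proof -
  have int: "integrable Q (\<lambda>u. (c \<bullet> u)\<^sup>2 * norm u ^ k)" for c
  proof (rule integrable_bound_norm_power)
    fix u
    have "(c \<bullet> u)\<^sup>2 \<le> (norm c * norm u)\<^sup>2"
      using Cauchy_Schwarz_ineq2[of c u] by (metis abs_ge_zero power2_abs power_mono)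
    then have "(c \<bullet> u)\<^sup>2 * norm u ^ k \<le> (norm c * norm u)\<^sup>2 * norm u ^ k"
      by (rule mult_right_mono) simp
    then show "norm ((c \<bullet> u)\<^sup>2 * norm u ^ k) \<le> (norm c)\<^sup>2 * norm u ^ (k + 2)"
      by (simp add: power_add power_mult_distrib mult_ac abs_mult power2_eq_square)
  qed (use k in auto)
  have unit: "(\<integral>u. (v \<bullet> u)\<^sup>2 * norm u ^ k \<partial>Q) = (\<integral>u. norm u ^ (k + 2) \<partial>Q) / DIM('a)"
    if v: "norm v = 1" for v
  proof -
    have "(\<integral>u. norm u ^ (k + 2) \<partial>Q) = (\<integral>u. (\<Sum>b\<in>Basis. (b \<bullet> u)\<^sup>2 * norm u ^ k) \<partial>Q)"
    proof (rule Bochner_Integration.integral_cong[OF refl])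
      fix u
      have "(norm u)\<^sup>2 = (\<Sum>b\<in>Basis. (b \<bullet> u)\<^sup>2)"
        unfolding power2_norm_eq_inner
        by (subst euclidean_inner) (simp add: power2_eq_square inner_commute)
      then show "norm u ^ (k + 2) = (\<Sum>b\<in>Basis. (b \<bullet> u)\<^sup>2 * norm u ^ k)"
        by (simp only: add.commute[of k] power_add sum_distrib_right)
    qed
    also have "\<dots> = (\<Sum>b\<in>(Basis::'a set). \<integral>u. (b \<bullet> u)\<^sup>2 * norm u ^ k \<partial>Q)"
      by (rule Bochner_Integration.integral_sum) (rule int)
    also have "\<dots> = (\<Sum>b\<in>(Basis::'a set). \<integral>u. (v \<bullet> u)\<^sup>2 * norm u ^ k \<partial>Q)"
      using v by (intro sum.cong refl integral_inner_swap[where h="\<lambda>x y. x\<^sup>2 * y ^ k"]) auto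
    finally show ?thesis by simp
  qed
  show ?thesis
  proof (cases "a = 0")
    case False
    define v where "v = (1 / norm a) *\<^sub>R a"
    have "(\<integral>u. (a \<bullet> u)\<^sup>2 * norm u ^ k \<partial>Q) = (\<integral>u. (norm a)\<^sup>2 * ((v \<bullet> u)\<^sup>2 * norm u ^ k) \<partial>Q)"
      using False by (intro Bochner_Integration.integral_cong refl) (simp add: v_def power_divide)
    also have "\<dots> = (norm a)\<^sup>2 * (\<integral>u. (v \<bullet> u)\<^sup>2 * norm u ^ k \<partial>Q)" by simp
    finally show ?thesis using unit[of v] False by (simp add: v_def)
  qed simp
qed

text \<open>Polarization of the quadratic case. It makes the mean of the linear part of a smoothing
  estimator a multiple of the gradient.\<close>

lemma integral_inner_inner:
  "(\<integral>u. (a \<bullet> u) * (b \<bullet> u) \<partial>Q) = (a \<bullet> b) / DIM('a) * (\<integral>u. (norm u)\<^sup>2 \<partial>Q)"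
proof -
  have int: "integrable Q (\<lambda>u. (c \<bullet> u)\<^sup>2)" for c
  proof (rule integrable_bound_norm_power)
    show "norm ((c \<bullet> u)\<^sup>2) \<le> (norm c)\<^sup>2 * norm u ^ 2" for u
      using power_mono[OF Cauchy_Schwarz_ineq2[of c u], of 2] by (simp add: power_mult_distrib)
  qed auto
  have sq: "(\<integral>u. (c \<bullet> u)\<^sup>2 \<partial>Q) = (c \<bullet> c) / DIM('a) * (\<integral>u. (norm u)\<^sup>2 \<partial>Q)" for c
    using integral_inner_square[of 0 c] by (simp add: dot_square_norm power2_eq_square)
  have "(\<integral>u. (a \<bullet> u) * (b \<bullet> u) \<partial>Q) = (\<integral>u. (((a + b) \<bullet> u)\<^sup>2 - ((a - b) \<bullet> u)\<^sup>2) / 4 \<partial>Q)"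
    by (intro Bochner_Integration.integral_cong refl)
       (simp add: inner_add_left inner_diff_left power2_eq_square algebra_simps)
  also have "\<dots> = ((\<integral>u. ((a + b) \<bullet> u)\<^sup>2 \<partial>Q) - (\<integral>u. ((a - b) \<bullet> u)\<^sup>2 \<partial>Q)) / 4"
    by (simp add: int)
  also have "\<dots> = (((a + b) \<bullet> (a + b) - (a - b) \<bullet> (a - b)) / 4) / DIM('a) * (\<integral>u. (norm u)\<^sup>2 \<partial>Q)"
    by (simp add: sq field_simps)
  also have "((a + b) \<bullet> (a + b) - (a - b) \<bullet> (a - b)) / 4 = a \<bullet> b"
    by (simp add: inner_add_left inner_diff_left inner_add_right inner_diff_right inner_commute)
  finally show ?thesis .
qed

text \<open>Pairing \<open>u\<close> with its reflection along \<open>v\<close> replaces the usual Gaussian integration by parts.\<close>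

lemma integral_taylor_rem_inner_le:
  assumes F: "\<And>y. GDERIV F y :> G y" and L: "L-lipschitz_on UNIV G" and \<nu>: "0 < \<nu>"
    and v: "norm v = 1" and c: "0 < c"
  shows "(\<integral>u. taylor_rem F (G x) x \<nu> u * (v \<bullet> u) \<partial>Q)
    \<le> L * \<nu> / 2 * (((\<integral>u. norm u ^ 4 \<partial>Q) / DIM('a) - 2 / 3 * (\<integral>u. (v \<bullet> u) ^ 4 \<partial>Q)) / c
                    + c * (\<integral>u. (norm u)\<^sup>2 \<partial>Q) / DIM('a))"
proof -
  let ?R = "taylor_rem F (G x) x \<nu>"
  have [measurable]: "F \<in> borel_measurable borel"
    by (rule borel_measurable_continuous_onI[OF GDERIV_imp_continuous_on[OF F]])
  have [measurable]: "?R \<in> borel_measurable borel" unfolding taylor_rem_def by measurable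
  have L0: "0 \<le> L" using L by (rule lipschitz_on_nonneg)
  have tn: "\<bar>v \<bullet> u\<bar> \<le> norm u" for u using Cauchy_Schwarz_ineq2[of v u] v by simp
  have intR: "integrable Q (\<lambda>u. ?R u * (v \<bullet> u))"
  proof (rule integrable_bound_norm_power)
    show "norm (?R u * (v \<bullet> u)) \<le> L * \<nu> / 2 * norm u ^ 3" for u
    proof -
      have "\<bar>?R u\<bar> * \<bar>v \<bullet> u\<bar> \<le> (L * \<nu> / 2 * (norm u)\<^sup>2) * norm u"
        using taylor_rem_abs_le[OF F L \<nu>, of x u] tn[of u] by (intro mult_mono) auto
      then show ?thesis by (simp add: abs_mult power3_eq_cube power2_eq_square mult_ac)
    qed
  qed (use L0 \<nu> in auto)
  have int4: "integrable Q (\<lambda>u. (v \<bullet> u) ^ 4)"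
    by (rule integrable_bound_norm_power[where C=1 and k=4])
       (use power_mono[OF tn abs_ge_zero, where n=4] in auto)
  have int2: "integrable Q (\<lambda>u. (v \<bullet> u)\<^sup>2)"
    by (rule integrable_bound_norm_power[where C=1 and k=2])
       (use power_mono[OF tn abs_ge_zero, where n=2] in auto)
  have int22: "integrable Q (\<lambda>u. (v \<bullet> u)\<^sup>2 * (norm u)\<^sup>2)"
  proof (rule integrable_bound_norm_power[where C=1 and k=4])
    show "norm ((v \<bullet> u)\<^sup>2 * (norm u)\<^sup>2) \<le> 1 * norm u ^ 4" for u
    proof -
      have "(v \<bullet> u)\<^sup>2 \<le> (norm u)\<^sup>2" using tn[of u] by (simp add: abs_le_square_iff[symmetric])
      then have "(v \<bullet> u)\<^sup>2 * (norm u)\<^sup>2 \<le> (norm u)\<^sup>2 * (norm u)\<^sup>2" by (rule mult_right_mono) simp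
      then show ?thesis by (simp add: power_add[symmetric])
    qed
  qed auto
  have "(\<integral>u. ?R u * (v \<bullet> u) \<partial>Q) = (\<integral>u. ?R (reflect v u) * (v \<bullet> reflect v u) \<partial>Q)"
    by (rule integral_reflect[OF v, symmetric]) measurable
  then have neg: "(\<integral>u. ?R u * (v \<bullet> u) \<partial>Q) = - (\<integral>u. ?R (reflect v u) * (v \<bullet> u) \<partial>Q)"
    by (simp add: inner_reflect[OF v])
  have intR': "integrable Q (\<lambda>u. ?R (reflect v u) * (v \<bullet> u))"
  proof -
    have "integrable (distr Q borel (reflect v)) (\<lambda>u. ?R u * (v \<bullet> u))"
      using intR by (simp add: distr_reflect[OF v])
    then have "integrable Q (\<lambda>u. ?R (reflect v u) * (v \<bullet> reflect v u))"
      by (subst (asm) integrable_distr_eq) auto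
    then show ?thesis by (simp add: inner_reflect[OF v])
  qed
  \<comment> \<open>The reflection changes the sign of \<open>v \<bullet> u\<close>, so adding the
    integral to its reflected form leaves the difference of the remainder at two mirror
    points.\<close>
  have "2 * (\<integral>u. ?R u * (v \<bullet> u) \<partial>Q) = (\<integral>u. ?R u * (v \<bullet> u) - ?R (reflect v u) * (v \<bullet> u) \<partial>Q)"
    using neg by (simp add: intR intR')
  also have "\<dots> \<le> (\<integral>u. L * \<nu> * (((v \<bullet> u)\<^sup>2 * (norm u)\<^sup>2 - 2 / 3 * (v \<bullet> u) ^ 4) / c + c * (v \<bullet> u)\<^sup>2) \<partial>Q)"
  proof (rule integral_mono)
    fix u
    \<comment> \<open>With \<open>w\<close> the part of \<open>u\<close> orthogonal to
      \<open>v\<close> and \<open>t = v \<bullet> u\<close>, the mirror points are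
      \<open>w + t v\<close> and \<open>w - t v\<close>. Eliminating the norm of \<open>w\<close>
      gives \<open>t^4\<close> the coefficient \<open>1/3 - 1 = - 2/3\<close>.\<close>
    define w where "w = u - (v \<bullet> u) *\<^sub>R v"
    have vv: "v \<bullet> v = 1" using v by (simp add: norm_eq_1)
    have w: "w \<bullet> v = 0" by (simp add: w_def inner_diff_left vv inner_commute[of u v])
    have u: "u = w + (v \<bullet> u) *\<^sub>R v" by (simp add: w_def)
    have ru: "reflect v u = w - (v \<bullet> u) *\<^sub>R v"
      by (simp add: w_def reflect_def algebra_simps)
        (simp add: scaleR_left_distrib[symmetric] mult.commute)
    have nw: "(norm w)\<^sup>2 = (norm u)\<^sup>2 - (v \<bullet> u)\<^sup>2"
      unfolding power2_norm_eq_inner w_def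
      by (simp add: inner_diff_left inner_diff_right vv inner_commute[of u v] power2_eq_square)
    have "(v \<bullet> u) * (?R u - ?R (reflect v u))
        \<le> L * \<nu> * (((norm w)\<^sup>2 * (v \<bullet> u)\<^sup>2 + (v \<bullet> u)^4 / 3) / c + c * (v \<bullet> u)\<^sup>2)"
      using taylor_rem_reflection_le[OF F L \<nu> v w c, of "v \<bullet> u" x] unfolding ru u[symmetric] .
    also have "(norm w)\<^sup>2 * (v \<bullet> u)\<^sup>2 + (v \<bullet> u)^4 / 3 = (v \<bullet> u)\<^sup>2 * (norm u)\<^sup>2 - 2 / 3 * (v \<bullet> u) ^ 4"
      by (simp add: nw algebra_simps power_add[symmetric])
    finally show "?R u * (v \<bullet> u) - ?R (reflect v u) * (v \<bullet> u)
        \<le> L * \<nu> * (((v \<bullet> u)\<^sup>2 * (norm u)\<^sup>2 - 2 / 3 * (v \<bullet> u) ^ 4) / c + c * (v \<bullet> u)\<^sup>2)"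
      by (simp add: algebra_simps)
  qed (auto simp: intR intR' int4 int2 int22)
  also have "\<dots> = L * \<nu> * (((\<integral>u. (v \<bullet> u)\<^sup>2 * (norm u)\<^sup>2 \<partial>Q) - 2 / 3 * (\<integral>u. (v \<bullet> u) ^ 4 \<partial>Q)) / c
                    + c * (\<integral>u. (v \<bullet> u)\<^sup>2 \<partial>Q))"
    by (simp add: int4 int2 int22)
  also have "\<dots> = L * \<nu> * (((\<integral>u. norm u ^ 4 \<partial>Q) / DIM('a) - 2 / 3 * (\<integral>u. (v \<bullet> u) ^ 4 \<partial>Q)) / c
                    + c * (\<integral>u. (norm u)\<^sup>2 \<partial>Q) / DIM('a))"
    using integral_inner_square[of 2 v] integral_inner_square[of 0 v] v
    by (simp add: numeral_2_eq_2[symmetric])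
  finally show ?thesis by simp
qed

end

lemma distr_reflect_density:
  fixes v :: "'a::euclidean_space"
  assumes v: "norm v = 1" and [measurable]: "g \<in> borel_measurable borel"
    and g: "\<And>x. g (reflect v x) = g x"
  shows "distr (density lborel g) borel (reflect v) = density lborel g"
proof (rule measure_eqI)
  fix A assume "A \<in> sets (distr (density lborel g) borel (reflect v))"
  then have [measurable]: "A \<in> sets borel" by simp
  have "emeasure (distr (density lborel g) borel (reflect v)) A = (\<integral>\<^sup>+x. g x * indicator A (reflect v x) \<partial>lborel)"
  proof -
    have [measurable]: "reflect v -` A \<in> sets borel"
      using measurable_sets[OF reflect_measurable, of A v] by simp
    show ?thesis
      by (subst emeasure_distr) (auto simp: emeasure_density indicator_def intro!: nn_integral_cong)
  qed
  also have "\<dots> = (\<integral>\<^sup>+x. g (reflect v x) * indicator A (reflect v x) \<partial>lborel)"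
    by (simp add: g)
  also have "\<dots> = (\<integral>\<^sup>+x. g x * indicator A x \<partial>distr lborel borel (reflect v))"
    by (subst nn_integral_distr) auto
  also have "\<dots> = emeasure (density lborel g) A"
    by (simp add: distr_reflect_lborel[OF v] emeasure_density)
  finally show "emeasure (distr (density lborel g) borel (reflect v)) A = emeasure (density lborel g) A" .
qed simp

subsection \<open>Averages of independent copies\<close>

lemma norm_square_integrable_imp_integrable:
  fixes X :: "'w \<Rightarrow> 'a::euclidean_space"
  assumes "prob_space M" and [measurable]: "X \<in> borel_measurable M"
    and sq: "integrable M (\<lambda>\<omega>. (norm (X \<omega>))\<^sup>2)"
  shows "integrable M X"
proof -
  interpret prob_space M by fact
  show ?thesis
  proof (rule Bochner_Integration.integrable_bound)
    show "integrable M (\<lambda>\<omega>. 1 + (norm (X \<omega>))\<^sup>2)" using sq by auto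
    have "t \<le> 1 + t\<^sup>2" for t :: real
      using zero_le_power2[of "t - 1 / 2"] by (simp add: power2_diff power_divide)
    then show "AE \<omega> in M. norm (X \<omega>) \<le> norm (1 + (norm (X \<omega>))\<^sup>2)"
      by (auto intro!: AE_I2 simp: abs_of_nonneg)
  qed measurable
qed

lemma square_integrable_inner:
  fixes X Y :: "'w \<Rightarrow> 'a::euclidean_space"
  assumes [measurable]: "X \<in> borel_measurable M" "Y \<in> borel_measurable M"
    and sq: "integrable M (\<lambda>\<omega>. (norm (X \<omega>))\<^sup>2)" "integrable M (\<lambda>\<omega>. (norm (Y \<omega>))\<^sup>2)"
  shows "integrable M (\<lambda>\<omega>. X \<omega> \<bullet> Y \<omega>)"
proof (rule Bochner_Integration.integrable_bound)
  show "integrable M (\<lambda>\<omega>. (norm (X \<omega>))\<^sup>2 + (norm (Y \<omega>))\<^sup>2)" using sq by auto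
  show "AE \<omega> in M. norm (X \<omega> \<bullet> Y \<omega>) \<le> norm ((norm (X \<omega>))\<^sup>2 + (norm (Y \<omega>))\<^sup>2)"
  proof (rule AE_I2)
    fix \<omega>
    have "\<bar>X \<omega> \<bullet> Y \<omega>\<bar> \<le> norm (X \<omega>) * norm (Y \<omega>)" by (rule Cauchy_Schwarz_ineq2)
    also have "\<dots> \<le> (norm (X \<omega>))\<^sup>2 + (norm (Y \<omega>))\<^sup>2"
      using zero_le_power2[of "norm (X \<omega>) - norm (Y \<omega>)"]
        mult_nonneg_nonneg[OF norm_ge_zero[of "X \<omega>"] norm_ge_zero[of "Y \<omega>"]]
      unfolding power2_diff mult.assoc by linarith
    finally show "norm (X \<omega> \<bullet> Y \<omega>) \<le> norm ((norm (X \<omega>))\<^sup>2 + (norm (Y \<omega>))\<^sup>2)" by simp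
  qed
qed measurable

lemma (in prob_space) integral_norm_sub_mean_square:
  fixes X :: "'a \<Rightarrow> 'b::euclidean_space"
  assumes [measurable]: "X \<in> borel_measurable M" and sq: "integrable M (\<lambda>\<omega>. (norm (X \<omega>))\<^sup>2)"
  shows "(\<integral>\<omega>. (norm (X \<omega> - expectation X))\<^sup>2 \<partial>M)
      = (\<integral>\<omega>. (norm (X \<omega>))\<^sup>2 \<partial>M) - (norm (expectation X))\<^sup>2"
proof -
  have X: "integrable M X" by (rule norm_square_integrable_imp_integrable[OF prob_space_axioms assms])
  have eq: "(norm (X \<omega> - expectation X))\<^sup>2
      = (norm (X \<omega>))\<^sup>2 - 2 * (X \<omega> \<bullet> expectation X) + (norm (expectation X))\<^sup>2" for \<omega>
    by (simp add: power2_norm_eq_inner inner_diff_left inner_diff_right inner_commute)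
  have "(\<integral>\<omega>. X \<omega> \<bullet> expectation X \<partial>M) = (norm (expectation X))\<^sup>2"
    using X by (simp add: power2_norm_eq_inner)
  then show "(\<integral>\<omega>. (norm (X \<omega> - expectation X))\<^sup>2 \<partial>M)
      = (\<integral>\<omega>. (norm (X \<omega>))\<^sup>2 \<partial>M) - (norm (expectation X))\<^sup>2"
    unfolding eq using sq X by (simp add: prob_space)
qed

text \<open>The vector of all coordinates is the identity, whose law is the product of the
  coordinate laws.\<close>

lemma indep_vars_PiM_coordinates:
  assumes Q: "prob_space Q" and I: "I \<noteq> {}"
  shows "prob_space.indep_vars (Pi\<^sub>M I (\<lambda>_. Q)) (\<lambda>_. Q) (\<lambda>i \<omega>. \<omega> i) I"
proof -
  interpret Q: prob_space Q by (rule Q)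
  interpret product_prob_space "\<lambda>_. Q" I by unfold_locales
  have "distr (Pi\<^sub>M I (\<lambda>_. Q)) (Pi\<^sub>M I (\<lambda>_. Q)) (\<lambda>x. \<lambda>i\<in>I. x i) = distr (Pi\<^sub>M I (\<lambda>_. Q)) (Pi\<^sub>M I (\<lambda>_. Q)) (\<lambda>x. x)"
    by (rule distr_cong) (auto simp: space_PiM)
  moreover have "Pi\<^sub>M I (\<lambda>i. distr (Pi\<^sub>M I (\<lambda>_. Q)) Q (\<lambda>\<omega>. \<omega> i)) = Pi\<^sub>M I (\<lambda>_. Q)"
    by (rule PiM_cong) (auto simp: PiM_component)
  ultimately show ?thesis
    using P.indep_vars_iff_distr_eq_PiM'[OF I, of "\<lambda>i \<omega>. \<omega> i" "\<lambda>_. Q"] by (simp add: distr_id2)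
qed

context
  fixes Q :: "'z measure" and \<phi> :: "'z \<Rightarrow> 'a::euclidean_space" and I J :: "'i set"
  assumes Q: "prob_space Q" and \<phi> [measurable]: "\<phi> \<in> borel_measurable Q"
    and sq: "integrable Q (\<lambda>z. (norm (\<phi> z))\<^sup>2)"
    and J: "finite J" "J \<noteq> {}" "J \<subseteq> I"
begin

lemma PiM_coordinate_integral:
  assumes "i \<in> I" and [measurable]: "h \<in> borel_measurable Q"
  shows "integral\<^sup>L (Pi\<^sub>M I (\<lambda>_. Q)) (\<lambda>\<omega>. h (\<omega> i)) = (integral\<^sup>L Q h :: 'b::{banach, second_countable_topology})"
    and "integrable (Pi\<^sub>M I (\<lambda>_. Q)) (\<lambda>\<omega>. h (\<omega> i)) \<longleftrightarrow> integrable Q h"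
proof -
  interpret Q: prob_space Q by (rule Q)
  have d: "distr (Pi\<^sub>M I (\<lambda>_. Q)) Q (\<lambda>\<omega>. \<omega> i) = Q"
    using assms by (intro distr_PiM_component Q)
  have [measurable]: "(\<lambda>\<omega>. \<omega> i) \<in> measurable (Pi\<^sub>M I (\<lambda>_. Q)) Q"
    using assms by simp
  show "integral\<^sup>L (Pi\<^sub>M I (\<lambda>_. Q)) (\<lambda>\<omega>. h (\<omega> i)) = integral\<^sup>L Q h"
    by (subst (2) d[symmetric]) (simp add: integral_distr)
  show "integrable (Pi\<^sub>M I (\<lambda>_. Q)) (\<lambda>\<omega>. h (\<omega> i)) \<longleftrightarrow> integrable Q h"
    by (subst (2) d[symmetric]) (simp add: integrable_distr_eq)
qed

text \<open>The index set \<open>I\<close> and the averaged subset \<open>J\<close> are kept apart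
  to serve two purposes: averages over \<open>N\<close> directions, with both sets equal, and
  averages over the first members of an infinite sample sequence. The square expands into a double
  sum whose diagonal terms alone exceed \<open>(norm m)^2\<close>, each by the variance on
  average.\<close>

lemma iid_average:
  defines "A \<equiv> (\<lambda>\<omega>. (1 / real (card J)) *\<^sub>R (\<Sum>j\<in>J. \<phi> (\<omega> j)))" and "m \<equiv> integral\<^sup>L Q \<phi>"
  shows "A \<in> borel_measurable (Pi\<^sub>M I (\<lambda>_. Q))" (is ?meas)
    and "integrable (Pi\<^sub>M I (\<lambda>_. Q)) (\<lambda>\<omega>. (norm (A \<omega>))\<^sup>2)" (is ?int)
    and "integral\<^sup>L (Pi\<^sub>M I (\<lambda>_. Q)) A = m" (is ?mean)
    and "(\<integral>\<omega>. (norm (A \<omega>))\<^sup>2 \<partial>Pi\<^sub>M I (\<lambda>_. Q)) = (norm m)\<^sup>2 + (\<integral>z. (norm (\<phi> z - m))\<^sup>2 \<partial>Q) / card J" (is ?var)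
proof -
  interpret Q: prob_space Q by (rule Q)
  let ?P = "Pi\<^sub>M I (\<lambda>_. Q)"
  interpret P: prob_space ?P by (intro prob_space_PiM Q)
  have JI: "j \<in> I" if "j \<in> J" for j using J that by auto
  have meas: "(\<lambda>\<omega>. \<phi> (\<omega> j)) \<in> borel_measurable ?P" if "j \<in> J" for j
    using JI[OF that] by measurable
  show meas_A: ?meas
    unfolding A_def using meas by (intro borel_measurable_scaleR borel_measurable_sum) auto
  have \<phi>_int: "integrable Q \<phi>" using Q \<phi> sq by (rule norm_square_integrable_imp_integrable)
  have int_j: "integrable ?P (\<lambda>\<omega>. \<phi> (\<omega> j))" "(\<integral>\<omega>. \<phi> (\<omega> j) \<partial>?P) = m" if "j \<in> J" for j
    using PiM_coordinate_integral[of j \<phi>] JI[OF that] \<phi>_int by (auto simp: m_def)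
  have sq_j: "integrable ?P (\<lambda>\<omega>. (norm (\<phi> (\<omega> j)))\<^sup>2)"
      "(\<integral>\<omega>. (norm (\<phi> (\<omega> j)))\<^sup>2 \<partial>?P) = (\<integral>z. (norm (\<phi> z))\<^sup>2 \<partial>Q)" if "j \<in> J" for j
    using PiM_coordinate_integral[of j "\<lambda>z. (norm (\<phi> z))\<^sup>2"] JI[OF that] sq by auto
  have n0: "real (card J) \<noteq> 0" using J by (simp add: card_gt_0_iff)
  show ?mean
    unfolding A_def using int_j n0 by (simp add: Bochner_Integration.integral_sum sum_constant_scaleR)
  have norm_A: "(norm (A \<omega>))\<^sup>2 = (\<Sum>i\<in>J. \<Sum>j\<in>J. \<phi> (\<omega> i) \<bullet> \<phi> (\<omega> j)) / (card J)\<^sup>2" for \<omega>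
  proof -
    have "(\<Sum>i\<in>J. \<phi> (\<omega> i)) \<bullet> (\<Sum>j\<in>J. \<phi> (\<omega> j)) = (\<Sum>i\<in>J. \<Sum>j\<in>J. \<phi> (\<omega> i) \<bullet> \<phi> (\<omega> j))"
      by (subst inner_sum_left, subst inner_sum_right) (rule refl)
    then show ?thesis unfolding A_def by (simp add: dot_square_norm power_divide)
  qed
  have ip: "integrable ?P (\<lambda>\<omega>. \<phi> (\<omega> i) \<bullet> \<phi> (\<omega> j))" if "i \<in> J" "j \<in> J" for i j
    using that by (intro square_integrable_inner meas sq_j)
  show ?int unfolding norm_A using ip by auto
  \<comment> \<open>Products of independent factors are available for real variables, so the inner
    product is expanded in the standard basis and treated one coordinate at a time.\<close>
  have off: "(\<integral>\<omega>. \<phi> (\<omega> i) \<bullet> \<phi> (\<omega> j) \<partial>?P) = (norm m)\<^sup>2" if ij: "i \<in> J" "j \<in> J" "i \<noteq> j" for i j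
  proof -
    have indep: "P.indep_vars (\<lambda>_. Q) (\<lambda>i \<omega>. \<omega> i) I"
      using J by (intro indep_vars_PiM_coordinates Q) auto
    have *: "(\<integral>\<omega>. (\<phi> (\<omega> i) \<bullet> b) * (\<phi> (\<omega> j) \<bullet> b) \<partial>?P) = (m \<bullet> b) * (m \<bullet> b)"
      and **: "integrable ?P (\<lambda>\<omega>. (\<phi> (\<omega> i) \<bullet> b) * (\<phi> (\<omega> j) \<bullet> b))" for b
    proof -
      have "P.indep_vars (\<lambda>_. borel) (\<lambda>i \<omega>. \<phi> (\<omega> i) \<bullet> b) I"
        by (rule P.indep_vars_compose2[OF indep]) measurable
      then have iv: "P.indep_vars (\<lambda>_. borel) (\<lambda>i \<omega>. \<phi> (\<omega> i) \<bullet> b) {i, j}"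
        by (rule P.indep_vars_subset) (use ij JI in auto)
      have int: "integrable ?P (\<lambda>\<omega>. \<phi> (\<omega> l) \<bullet> b)" if "l \<in> {i, j}" for l
        using that int_j ij by auto
      show "(\<integral>\<omega>. (\<phi> (\<omega> i) \<bullet> b) * (\<phi> (\<omega> j) \<bullet> b) \<partial>?P) = (m \<bullet> b) * (m \<bullet> b)"
        using P.indep_vars_lebesgue_integral[OF _ iv int] ij int_j by simp
      show "integrable ?P (\<lambda>\<omega>. (\<phi> (\<omega> i) \<bullet> b) * (\<phi> (\<omega> j) \<bullet> b))"
        using P.indep_vars_integrable[OF _ iv int] ij by simp
    qed
    have "(\<integral>\<omega>. \<phi> (\<omega> i) \<bullet> \<phi> (\<omega> j) \<partial>?P) = (\<integral>\<omega>. (\<Sum>b\<in>Basis. (\<phi> (\<omega> i) \<bullet> b) * (\<phi> (\<omega> j) \<bullet> b)) \<partial>?P)"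
      by (simp only: euclidean_inner[symmetric])
    also have "\<dots> = (\<Sum>b\<in>Basis. (m \<bullet> b) * (m \<bullet> b))"
      by (subst Bochner_Integration.integral_sum) (simp_all add: * **)
    also have "\<dots> = (norm m)\<^sup>2"
      by (simp only: euclidean_inner[symmetric] power2_norm_eq_inner)
    finally show ?thesis .
  qed
  have var: "(\<integral>z. (norm (\<phi> z - m))\<^sup>2 \<partial>Q) = (\<integral>z. (norm (\<phi> z))\<^sup>2 \<partial>Q) - (norm m)\<^sup>2"
    unfolding m_def by (rule Q.integral_norm_sub_mean_square[OF \<phi> sq])
  have "(\<integral>\<omega>. (norm (A \<omega>))\<^sup>2 \<partial>?P) = (\<Sum>i\<in>J. \<Sum>j\<in>J. \<integral>\<omega>. \<phi> (\<omega> i) \<bullet> \<phi> (\<omega> j) \<partial>?P) / (card J)\<^sup>2"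
    unfolding norm_A using ip by (simp add: Bochner_Integration.integral_sum)
  also have "(\<Sum>i\<in>J. \<Sum>j\<in>J. \<integral>\<omega>. \<phi> (\<omega> i) \<bullet> \<phi> (\<omega> j) \<partial>?P)
      = (\<Sum>i\<in>J. \<Sum>j\<in>J. (norm m)\<^sup>2 + (if i = j then (\<integral>z. (norm (\<phi> z - m))\<^sup>2 \<partial>Q) else 0))"
    by (intro sum.cong refl) (auto simp: off var sq_j dot_square_norm)
  also have "\<dots> = (card J)\<^sup>2 * (norm m)\<^sup>2 + card J * (\<integral>z. (norm (\<phi> z - m))\<^sup>2 \<partial>Q)"
    using J by (simp add: sum.distrib power2_eq_square algebra_simps)
  finally show ?var using n0 by (simp add: add_divide_distrib power2_eq_square)
qed

end

subsection \<open>Sampling without replacement\<close>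

lemma
  fixes N d :: nat
  assumes "N \<le> d"
  shows finite_injections: "finite {J \<in> {..<N} \<rightarrow>\<^sub>E {..<d}. inj_on J {..<N}}"
    and injections_nonempty: "{J \<in> {..<N} \<rightarrow>\<^sub>E {..<d}. inj_on J {..<N}} \<noteq> {}"
proof -
  show "finite {J \<in> {..<N} \<rightarrow>\<^sub>E {..<d}. inj_on J {..<N}}"
    by (rule finite_subset[OF _ finite_PiE[of "{..<N}" "\<lambda>_. {..<d}"]]) auto
  have "restrict id {..<N} \<in> {J \<in> {..<N} \<rightarrow>\<^sub>E {..<d}. inj_on J {..<N}}"
    using assms by (auto simp: inj_on_def)
  then show "{J \<in> {..<N} \<rightarrow>\<^sub>E {..<d}. inj_on J {..<N}} \<noteq> {}" by blast
qed

lemma prob_space_without_replacement: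
  "N \<le> d \<Longrightarrow> prob_space (without_replacement d N)"
  unfolding without_replacement_def
  by (intro prob_space_uniform_count_measure finite_injections injections_nonempty)

text \<open>Every single position is uniform on the \<open>d\<close> indices: composing with the
  transposition of \<open>i\<close> and \<open>i'\<close> injects the tuples with value
  \<open>i\<close> at position \<open>j\<close> into those with value \<open>i'\<close>, and the
  converse holds by symmetry.\<close>

lemma without_replacement_marginal:
  fixes h :: "nat \<Rightarrow> 'b::{banach, second_countable_topology}"
  assumes N: "N \<le> d" and j: "j < N"
  shows "(\<integral>J. h (J j) \<partial>without_replacement d N) = (1 / real d) *\<^sub>R (\<Sum>i<d. h i)"
proof -
  define S where "S = {J \<in> {..<N} \<rightarrow>\<^sub>E {..<d}. inj_on J {..<N}}"
  have S: "finite S" "S \<noteq> {}" unfolding S_def using finite_injections[OF N] injections_nonempty[OF N] .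
  define c where "c i = card {J \<in> S. J j = i}" for i
  have c_le: "c i \<le> c i'" if i: "i < d" "i' < d" for i i'
  proof -
    let ?T = "\<lambda>J. restrict (Transposition.transpose i i' \<circ> J) {..<N}"
    have d: "Transposition.transpose i i' a < d" if "a < d" for a
      using i that by (auto simp: Transposition.transpose_def)
    have "inj_on ?T {J \<in> S. J j = i}"
    proof (rule inj_onI)
      fix J J' assume J: "J \<in> {J \<in> S. J j = i}" "J' \<in> {J \<in> S. J j = i}" and eq: "?T J = ?T J'"
      have "J a = J' a" if "a < N" for a
      proof -
        have "Transposition.transpose i i' (J a) = Transposition.transpose i i' (J' a)"
          using fun_cong[OF eq, of a] that by simp
        then show ?thesis by (rule injD[OF inj_transpose])
      qed
      then show "J = J'" using J by (intro PiE_ext[of J "{..<N}" "\<lambda>_. {..<d}"]) (auto simp: S_def)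
    qed
    moreover have "?T ` {J \<in> S. J j = i} \<subseteq> {J \<in> S. J j = i'}"
    proof (rule image_subsetI)
      fix J assume "J \<in> {J \<in> S. J j = i}"
      then have J: "J \<in> S" "J j = i" by auto
      have "inj_on (Transposition.transpose i i' \<circ> J) {..<N}"
        using J by (intro comp_inj_on) (auto simp: S_def intro: inj_on_subset[OF inj_transpose])
      then have "inj_on (?T J) {..<N}" by (simp only: inj_on_restrict_eq)
      moreover have "?T J \<in> {..<N} \<rightarrow>\<^sub>E {..<d}"
        using J d by (auto simp: S_def PiE_iff)
      ultimately have "?T J \<in> S" by (simp add: S_def)
      then show "?T J \<in> {J \<in> S. J j = i'}" using J j by simp
    qed
    ultimately show ?thesis unfolding c_def using S by (intro card_inj_on_le) auto
  qed
  have d0: "0 < d" using N j by simp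
  have c_eq: "c i = c 0" if "i < d" for i using c_le[of i 0] c_le[of 0 i] that d0 by auto
  have Jd: "J j < d" if "J \<in> S" for J using that j by (auto simp: S_def PiE_iff)
  have sum_S: "(\<Sum>J\<in>S. g (J j)) = (\<Sum>i<d. real (c 0) *\<^sub>R g i)" for g :: "nat \<Rightarrow> 'c::real_vector"
  proof -
    have "(\<Sum>J\<in>S. g (J j)) = (\<Sum>i<d. \<Sum>J\<in>{J \<in> S. J j = i}. g (J j))"
      using S Jd by (intro sum.group[symmetric]) auto
    also have "\<dots> = (\<Sum>i<d. real (c i) *\<^sub>R g i)"
      by (intro sum.cong refl) (simp add: c_def sum_constant_scaleR)
    also have "\<dots> = (\<Sum>i<d. real (c 0) *\<^sub>R g i)"
    proof (rule sum.cong[OF refl])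
      fix i assume "i \<in> {..<d}"
      then have "c i = c 0" by (intro c_eq) simp
      then show "real (c i) *\<^sub>R g i = real (c 0) *\<^sub>R g i" by (rule arg_cong)
    qed
    finally show ?thesis .
  qed
  \<comment> \<open>Counting all tuples by their entry at position \<open>j\<close> identifies the
    common number \<open>c 0\<close>.\<close>
  have "real (card S) = real d * real (c 0)"
    using sum_S[of "\<lambda>_. 1::real"] by simp
  then have c0: "real (c 0) / card S = 1 / d" "real (c 0) \<noteq> 0"
    using S d0 by (auto simp: field_simps)
  have "(\<integral>J. h (J j) \<partial>without_replacement d N) = (1 / real (card S)) *\<^sub>R (\<Sum>J\<in>S. h (J j))"
    unfolding without_replacement_def S_def[symmetric] uniform_count_measure_def
    using S by (subst lebesgue_integral_point_measure_finite) (auto simp: scaleR_sum_right)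
  also have "\<dots> = (real (c 0) / card S) *\<^sub>R (\<Sum>i<d. h i)"
    unfolding sum_S by (simp add: scaleR_sum_right)
  finally show ?thesis using c0 by simp
qed

subsection \<open>The Gaussian and the spherical distribution\<close>

lemma prod_std_normal_density:
  "(\<Prod>b\<in>Basis. std_normal_density (x \<bullet> b)) = (1 / sqrt (2 * pi)) ^ DIM('a) * exp (- (norm x)\<^sup>2 / 2)"
  for x :: "'a::euclidean_space"
proof -
  have "(norm x)\<^sup>2 = (\<Sum>b\<in>Basis. (x \<bullet> b)\<^sup>2)"
    unfolding power2_norm_eq_inner by (subst euclidean_inner) (simp add: power2_eq_square)
  then have "(\<Sum>b\<in>Basis. - (x \<bullet> b)\<^sup>2 / 2) = - (norm x)\<^sup>2 / 2"
    by (simp add: sum_negf sum_divide_distrib)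
  then show ?thesis
    unfolding std_normal_density_def prod.distrib exp_sum[OF finite_Basis, symmetric] prod_constant by simp
qed

section \<open>Moments of the norm of a Gaussian vector\<close>

lemma nn_integral_std_normal_even:
  "(\<integral>\<^sup>+y. ennreal (std_normal_density y * (y\<^sup>2) ^ j) \<partial>lborel) = ennreal (fact (2 * j) / (2 ^ j * fact j))"
proof -
  have eq: "(y\<^sup>2) ^ j = y ^ (2 * j)" for y :: real by (simp add: power_mult)
  have "0 \<le> y ^ (2 * j)" for y :: real by (simp add: power_mult)
  then show ?thesis
    unfolding eq
    by (subst nn_integral_eq_integral)
       (auto simp: integrable_std_normal_moment integral_std_normal_moment_even intro!: AE_I2)
qed

text \<open>The \<open>i\<close>-th moment of a chi-square variable with as many degrees of freedom
  as \<open>B\<close> has elements. The index set is arbitrary to allow induction over it, and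
  values in \<open>ennreal\<close> make the recursion free of integrability questions.\<close>

definition gauss_moment :: "nat \<Rightarrow> 'b set \<Rightarrow> ennreal" where
  "gauss_moment i B = (\<integral>\<^sup>+f. ennreal ((\<Prod>a\<in>B. std_normal_density (f a)) * (\<Sum>a\<in>B. (f a)\<^sup>2) ^ i)
     \<partial>Pi\<^sub>M B (\<lambda>_. lborel))"

text \<open>One coordinate \<open>y\<close> is split off by Tonelli and
  \<open>(y^2 + rest)^i\<close> is expanded binomially; the even moments of \<open>y\<close> are the
  double factorials 1, 1, 3, 15.\<close>

lemma gauss_moment_insert:
  assumes B: "finite B" "b \<notin> B"
  shows "gauss_moment i (insert b B)
    = (\<Sum>j\<le>i. ennreal (real (i choose j) * (fact (2 * j) / (2 ^ j * fact j))) * gauss_moment (i - j) B)"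
proof -
  interpret product_sigma_finite "\<lambda>_. lborel :: real measure" by unfold_locales
  let ?p = "std_normal_density :: real \<Rightarrow> real"
  define T where "T k f = (\<Prod>a\<in>B. ?p (f a)) * (\<Sum>a\<in>B. (f a)\<^sup>2) ^ k" for k and f :: "'a \<Rightarrow> real"
  have T0: "0 \<le> T k f" for k f
    unfolding T_def by (rule mult_nonneg_nonneg[OF prod_nonneg zero_le_power[OF sum_nonneg]]) simp_all
  have [measurable]: "T k \<in> borel_measurable (Pi\<^sub>M B (\<lambda>_. lborel))" for k
    unfolding T_def by measurable
  have "gauss_moment i (insert b B)
      = (\<integral>\<^sup>+f. \<integral>\<^sup>+y. ennreal ((\<Prod>a\<in>insert b B. ?p ((f(b := y)) a)) * (\<Sum>a\<in>insert b B. ((f(b := y)) a)\<^sup>2) ^ i)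
           \<partial>lborel \<partial>Pi\<^sub>M B (\<lambda>_. lborel))"
    unfolding gauss_moment_def by (rule product_nn_integral_insert[OF B]) measurable
  also have "\<dots> = (\<integral>\<^sup>+f. (\<Sum>j\<le>i. ennreal (real (i choose j) * (fact (2 * j) / (2 ^ j * fact j))) * ennreal (T (i - j) f))
       \<partial>Pi\<^sub>M B (\<lambda>_. lborel))"
  proof (rule nn_integral_cong)
    fix f :: "'a \<Rightarrow> real"
    have "(\<integral>\<^sup>+y. ennreal ((\<Prod>a\<in>insert b B. ?p ((f(b := y)) a)) * (\<Sum>a\<in>insert b B. ((f(b := y)) a)\<^sup>2) ^ i) \<partial>lborel)
       = (\<integral>\<^sup>+y. (\<Sum>j\<le>i. ennreal (real (i choose j) * T (i - j) f) * ennreal (?p y * (y\<^sup>2) ^ j)) \<partial>lborel)"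
    proof (rule nn_integral_cong)
      fix y :: real
      have "(\<Prod>a\<in>B. ?p ((f(b := y)) a)) = (\<Prod>a\<in>B. ?p (f a))" "(\<Sum>a\<in>B. ((f(b := y)) a)\<^sup>2) = (\<Sum>a\<in>B. (f a)\<^sup>2)"
        using B by (auto intro!: prod.cong sum.cong)
      then have "(\<Prod>a\<in>insert b B. ?p ((f(b := y)) a)) * (\<Sum>a\<in>insert b B. ((f(b := y)) a)\<^sup>2) ^ i
         = ?p y * (\<Prod>a\<in>B. ?p (f a)) * (y\<^sup>2 + (\<Sum>a\<in>B. (f a)\<^sup>2)) ^ i"
        using B by simp
      also have "\<dots> = (\<Sum>j\<le>i. (real (i choose j) * T (i - j) f) * (?p y * (y\<^sup>2) ^ j))"
        unfolding binomial_ring by (simp add: sum_distrib_left T_def mult_ac)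
      finally show "ennreal ((\<Prod>a\<in>insert b B. ?p ((f(b := y)) a)) * (\<Sum>a\<in>insert b B. ((f(b := y)) a)\<^sup>2) ^ i)
         = (\<Sum>j\<le>i. ennreal (real (i choose j) * T (i - j) f) * ennreal (?p y * (y\<^sup>2) ^ j))"
        using T0 by (subst ennreal_mult[symmetric]) (auto intro!: mult_nonneg_nonneg simp: sum_ennreal)
    qed
    also have "\<dots> = (\<Sum>j\<le>i. ennreal (real (i choose j) * T (i - j) f) * ennreal (fact (2 * j) / (2 ^ j * fact j)))"
      by (simp add: nn_integral_sum nn_integral_cmult nn_integral_std_normal_even)
    also have "\<dots> = (\<Sum>j\<le>i. ennreal (real (i choose j) * (fact (2 * j) / (2 ^ j * fact j))) * ennreal (T (i - j) f))"
    proof (rule sum.cong[OF refl])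
      fix j
      have "(0::real) \<le> fact (2 * j) / (2 ^ j * fact j)" by simp
      then show "ennreal (real (i choose j) * T (i - j) f) * ennreal (fact (2 * j) / (2 ^ j * fact j))
        = ennreal (real (i choose j) * (fact (2 * j) / (2 ^ j * fact j))) * ennreal (T (i - j) f)"
        using T0[of "i - j" f] by (simp only: ennreal_mult[symmetric] mult_nonneg_nonneg of_nat_0_le_iff mult_ac)
    qed
    finally show "(\<integral>\<^sup>+y. ennreal ((\<Prod>a\<in>insert b B. ?p ((f(b := y)) a)) * (\<Sum>a\<in>insert b B. ((f(b := y)) a)\<^sup>2) ^ i) \<partial>lborel)
       = (\<Sum>j\<le>i. ennreal (real (i choose j) * (fact (2 * j) / (2 ^ j * fact j))) * ennreal (T (i - j) f))" .
  qed
  also have "\<dots> = (\<Sum>j\<le>i. ennreal (real (i choose j) * (fact (2 * j) / (2 ^ j * fact j))) * (\<integral>\<^sup>+f. ennreal (T (i - j) f) \<partial>Pi\<^sub>M B (\<lambda>_. lborel)))"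
    by (simp add: nn_integral_sum nn_integral_cmult)
  finally show ?thesis by (simp only: T_def gauss_moment_def)
qed

text \<open>The recursion for one moment calls on all lower moments of the smaller set, so the four
  values are established together.\<close>

lemma gauss_moments:
  assumes "finite B"
  shows "gauss_moment 0 B = 1 \<and> gauss_moment 1 B = ennreal (card B) \<and>
    gauss_moment 2 B = ennreal (real (card B) * (real (card B) + 2)) \<and>
    gauss_moment 3 B = ennreal (real (card B) * (real (card B) + 2) * (real (card B) + 4))"
  using assms
proof induction
  case empty
  show ?case by (simp add: gauss_moment_def PiM_empty)
next
  case (insert b B)
  have atMost: "{..(0::nat)} = {0}" "{..(1::nat)} = {0, 1}" "{..(2::nat)} = {0, 1, 2}" "{..(3::nat)} = {0, 1, 2, 3}"
    by auto
  have facts: "fact 2 = (2::real)" "fact 3 = (6::real)" "fact 4 = (24::real)" "fact 6 = (720::real)"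
    "(2::nat) choose 2 = 1" "3 choose 2 = (3::nat)" "(3::nat) choose 3 = 1"
    by (simp_all add: fact_numeral eval_nat_numeral)
  define n where "n = real (card B)"
  have n: "0 \<le> n" by (simp add: n_def)
  have IH: "gauss_moment 0 B = ennreal 1" "gauss_moment 1 B = ennreal n"
    "gauss_moment 2 B = ennreal (n * (n + 2))" "gauss_moment 3 B = ennreal (n * (n + 2) * (n + 4))"
    using insert.IH unfolding n_def[symmetric] by simp_all
  have "gauss_moment 0 (insert b B) = ennreal 1"
    unfolding gauss_moment_insert[OF insert.hyps] atMost using IH by simp
  moreover have "gauss_moment 1 (insert b B) = ennreal (n + 1)"
    unfolding gauss_moment_insert[OF insert.hyps] atMost using IH n by simp
  \<comment> \<open>The sum equals \<open>(n + 1) * (n + 3)\<close>; the third moment below likewise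
    equals \<open>(n + 1) * (n + 3) * (n + 5)\<close>.\<close>
  moreover have "gauss_moment 2 (insert b B) = ennreal (n * (n + 2) + 2 * n + 3)"
  proof -
    have "gauss_moment 2 (insert b B) = ennreal 1 * ennreal (n * (n + 2)) + (ennreal 2 * ennreal n + ennreal 3 * ennreal 1)"
      unfolding gauss_moment_insert[OF insert.hyps] atMost using IH by (simp add: facts)
    also have "\<dots> = ennreal (n * (n + 2) + 2 * n + 3)"
      using n by (simp only: ennreal_mult[symmetric] ennreal_plus[symmetric] zero_le_numeral zero_le_one
        mult_nonneg_nonneg add_nonneg_nonneg mult_1 mult_1_right add.assoc)
    finally show ?thesis .
  qed
  moreover have "gauss_moment 3 (insert b B) = ennreal (n * (n + 2) * (n + 4) + 3 * (n * (n + 2)) + 9 * n + 15)"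
  proof -
    have "gauss_moment 3 (insert b B) = ennreal 1 * ennreal (n * (n + 2) * (n + 4))
        + (ennreal 3 * ennreal (n * (n + 2)) + (ennreal 9 * ennreal n + ennreal 15 * ennreal 1))"
      unfolding gauss_moment_insert[OF insert.hyps] atMost using IH by (simp add: facts)
    also have "\<dots> = ennreal (n * (n + 2) * (n + 4) + 3 * (n * (n + 2)) + 9 * n + 15)"
      using n by (simp only: ennreal_mult[symmetric] ennreal_plus[symmetric] zero_le_numeral zero_le_one
        mult_nonneg_nonneg add_nonneg_nonneg mult_1 mult_1_right add.assoc)
    finally show ?thesis .
  qed
  moreover have "real (card (insert b B)) = n + 1" using insert.hyps by (simp add: n_def)
  ultimately show ?case by (simp add: algebra_simps)
qed

text \<open>In this form the density visibly depends on the norm alone, which yields its invariance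
  under reflections.\<close>

lemma std_gaussian_eq:
  "(std_gaussian :: 'a::euclidean_space measure)
     = density lborel (\<lambda>x. ennreal ((1 / sqrt (2 * pi)) ^ DIM('a) * exp (- (norm x)\<^sup>2 / 2)))"
  unfolding std_gaussian_def prod_std_normal_density ..

lemma nn_integral_std_gaussian_norm_power:
  assumes "i \<le> 3"
  shows "(\<integral>\<^sup>+u. ennreal (norm u ^ (2 * i)) \<partial>(std_gaussian :: 'a::euclidean_space measure)) = gauss_moment i (Basis :: 'a set)"
proof -
  have n: "norm (\<Sum>b\<in>Basis. f b *\<^sub>R b :: 'a) ^ (2 * i) = (\<Sum>b\<in>Basis. (f b)\<^sup>2) ^ i" for f
  proof -
    have "(norm (\<Sum>b\<in>Basis. f b *\<^sub>R b :: 'a))\<^sup>2 = (\<Sum>b\<in>Basis. (f b)\<^sup>2)"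
      unfolding power2_norm_eq_inner
      by (subst euclidean_inner) (simp add: power2_eq_square)
    then show ?thesis by (simp add: power_mult)
  qed
  have "(\<integral>\<^sup>+u. ennreal (norm u ^ (2 * i)) \<partial>(std_gaussian :: 'a measure))
      = (\<integral>\<^sup>+u. ennreal ((\<Prod>b\<in>Basis. std_normal_density (u \<bullet> b)) * norm u ^ (2 * i)) \<partial>(lborel :: 'a measure))"
    unfolding std_gaussian_def
    by (subst nn_integral_density) (auto intro!: nn_integral_cong simp: ennreal_mult prod_nonneg)
  also have "\<dots> = gauss_moment i (Basis :: 'a set)"
    unfolding gauss_moment_def
    by (subst lborel_eq, subst nn_integral_distr)
       (auto intro!: nn_integral_cong prod.cong arg_cong[where f=ennreal] simp: n)
  finally show ?thesis .
qed

lemma ennreal_integral_eqI: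
  assumes "h \<in> borel_measurable M" "\<And>x. 0 \<le> h x" "(\<integral>\<^sup>+x. ennreal (h x) \<partial>M) = ennreal c" "0 \<le> c"
  shows "integrable M h" "integral\<^sup>L M h = c"
proof -
  show "integrable M h"
    using assms by (intro integrableI_nonneg) auto
  show "integral\<^sup>L M h = c"
    using assms by (subst integral_eq_nn_integral) auto
qed

lemma sets_std_gaussian [simp, measurable_cong]: "sets std_gaussian = sets borel"
  unfolding std_gaussian_def by simp

lemma std_gaussian_norm_power:
  fixes i :: nat
  assumes i: "i \<le> 3"
  defines "d \<equiv> real DIM('a::euclidean_space)"
  shows "integrable (std_gaussian :: 'a measure) (\<lambda>u. norm u ^ (2 * i))"
    and "(\<integral>u. norm u ^ (2 * i) \<partial>(std_gaussian :: 'a measure)) = [1, d, d * (d + 2), d * (d + 2) * (d + 4)] ! i"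
proof -
  have "i = 0 \<or> i = 1 \<or> i = 2 \<or> i = 3" using i by auto
  then have "gauss_moment i (Basis :: 'a set) = ennreal ([1, d, d * (d + 2), d * (d + 2) * (d + 4)] ! i)"
    using gauss_moments[of "Basis :: 'a set"] unfolding d_def[symmetric] by auto
  moreover have "0 \<le> [1, d, d * (d + 2), d * (d + 2) * (d + 4)] ! i"
    using \<open>i = 0 \<or> i = 1 \<or> i = 2 \<or> i = 3\<close> by (auto simp: d_def)
  ultimately show "integrable (std_gaussian :: 'a measure) (\<lambda>u. norm u ^ (2 * i))"
    "(\<integral>u. norm u ^ (2 * i) \<partial>(std_gaussian :: 'a measure)) = [1, d, d * (d + 2), d * (d + 2) * (d + 4)] ! i"
    using ennreal_integral_eqI[of "\<lambda>u. norm u ^ (2 * i)" "std_gaussian :: 'a measure"]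
      nn_integral_std_gaussian_norm_power[OF i, where 'a='a] by auto
qed

lemma isotropic_std_gaussian: "isotropic (std_gaussian :: 'a::euclidean_space measure)"
proof (intro isotropic.intro prob_spaceI isotropic_axioms.intro)
  show "emeasure (std_gaussian :: 'a measure) (space std_gaussian) = 1"
    using nn_integral_std_gaussian_norm_power[of 0, where 'a='a] gauss_moments[of "Basis :: 'a set"] by simp
  show "distr std_gaussian borel (reflect v) = std_gaussian" if "norm v = 1" for v :: 'a
    unfolding std_gaussian_eq using that by (intro distr_reflect_density) auto
  show "integrable (std_gaussian :: 'a measure) (\<lambda>u. norm u ^ 6)"
    using std_gaussian_norm_power(1)[of 3, where 'a='a] by simp
qed simp

lemma std_gaussian_moments:
  defines "d \<equiv> real DIM('a::euclidean_space)"
  shows "(\<integral>u. (norm u)\<^sup>2 \<partial>(std_gaussian :: 'a measure)) = d"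
    and "(\<integral>u. norm u ^ 4 \<partial>(std_gaussian :: 'a measure)) = d * (d + 2)"
    and "(\<integral>u. norm u ^ 6 \<partial>(std_gaussian :: 'a measure)) = d * (d + 2) * (d + 4)"
  using std_gaussian_norm_power(2)[of 1, where 'a='a] std_gaussian_norm_power(2)[of 2, where 'a='a]
    std_gaussian_norm_power(2)[of 3, where 'a='a]
  by (simp_all add: d_def)

text \<open>By isotropy \<open>v\<close> may be exchanged for a basis vector \<open>b\<close>. Then
  the integrand factorizes over the coordinates: coordinate \<open>b\<close> contributes the fourth
  normal moment 3, every other one the factor 1.\<close>

lemma std_gaussian_inner_power_4:
  fixes v :: "'a::euclidean_space"
  assumes v: "norm v = 1"
  shows "(\<integral>u. (v \<bullet> u) ^ 4 \<partial>std_gaussian) = 3"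
proof -
  interpret isotropic "std_gaussian :: 'a measure" by (rule isotropic_std_gaussian)
  obtain b :: 'a where b: "b \<in> Basis" using nonempty_Basis by blast
  \<comment> \<open>The factor \<open>t ^ 4\<close> is absorbed into the density of coordinate
    \<open>b\<close>, so that the integrand becomes a pure product.\<close>
  define h where "h a t = (if a = b then std_normal_density t * t ^ 4 else std_normal_density t)" for a :: 'a and t :: real
  have four: "(\<integral>\<^sup>+t. ennreal (std_normal_density t * t ^ 4) \<partial>lborel) = 3"
    using nn_integral_std_normal_even[of 2] by (simp add: power_mult[symmetric] fact_numeral)
  have zero: "(\<integral>\<^sup>+t. ennreal (std_normal_density t) \<partial>lborel) = 1"
    using nn_integral_std_normal_even[of 0] by simp
  have "(\<integral>\<^sup>+u. ennreal ((b \<bullet> u) ^ 4) \<partial>std_gaussian)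
      = (\<integral>\<^sup>+u. ennreal (\<Prod>a\<in>Basis. std_normal_density (u \<bullet> a)) * ennreal ((b \<bullet> u) ^ 4) \<partial>lborel)"
    unfolding std_gaussian_def by (subst nn_integral_density) auto
  also have "\<dots> = (\<integral>\<^sup>+u. (\<Prod>a\<in>Basis. ennreal (h a (u \<bullet> a))) \<partial>lborel)"
  proof (rule nn_integral_cong)
    fix u :: 'a
    have "(\<Prod>a\<in>Basis. h a (u \<bullet> a)) = (\<Prod>a\<in>Basis. std_normal_density (u \<bullet> a)) * (b \<bullet> u) ^ 4"
    proof -
      have "(\<Prod>a\<in>Basis. h a (u \<bullet> a))
          = (\<Prod>a\<in>Basis. std_normal_density (u \<bullet> a) * (if a = b then (u \<bullet> b) ^ 4 else 1))"
        by (intro prod.cong refl) (simp add: h_def)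
      then show ?thesis using b by (simp add: prod.distrib prod.delta inner_commute[of b])
    qed
    then show "ennreal (\<Prod>a\<in>Basis. std_normal_density (u \<bullet> a)) * ennreal ((b \<bullet> u) ^ 4)
        = (\<Prod>a\<in>Basis. ennreal (h a (u \<bullet> a)))"
      by (subst prod_ennreal) (auto simp: h_def ennreal_mult[symmetric] prod_nonneg)
  qed
  also have "\<dots> = (\<Prod>a\<in>(Basis::'a set). \<integral>\<^sup>+t. ennreal (h a t) \<partial>lborel)"
    by (rule nn_integral_lborel_prod) (auto simp: h_def)
  also have "\<dots> = (\<Prod>a\<in>(Basis::'a set). if a = b then 3 else 1)"
    by (intro prod.cong refl) (auto simp: h_def four zero)
  also have "\<dots> = ennreal 3" using b by simp
  finally have "(\<integral>u. (b \<bullet> u) ^ 4 \<partial>std_gaussian) = 3"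
    by (intro ennreal_integral_eqI(2)) auto
  moreover have "(\<integral>u. (v \<bullet> u) ^ 4 \<partial>std_gaussian) = (\<integral>u. (b \<bullet> u) ^ 4 \<partial>std_gaussian)"
    using integral_inner_swap[of b v "\<lambda>s t. s ^ 4"] v b by simp
  ultimately show ?thesis by simp
qed

section \<open>The uniform distribution on the sphere\<close>

lemma
  shows prob_space_uniform_sphere: "prob_space (uniform_sphere :: 'a::euclidean_space measure)"
    and sets_uniform_sphere [simp]: "sets (uniform_sphere :: 'a measure) = sets borel"
    and AE_uniform_sphere: "AE u in (uniform_sphere :: 'a measure). norm u = 1"
    and distr_reflect_uniform_sphere:
      "norm v = 1 \<Longrightarrow> distr uniform_sphere borel (reflect v) = (uniform_sphere :: 'a measure)"
proof -
  have pos: "emeasure lborel (ball (0::'a) 1) \<noteq> 0" "emeasure lborel (ball (0::'a) 1) \<noteq> \<infinity>"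
    using content_ball_pos[of 1 "0::'a"] emeasure_lborel_ball_finite[of "0::'a" 1]
    by (auto simp: measure_def less_top)
  interpret U: prob_space "uniform_measure lborel (ball (0::'a) 1)"
    using pos by (rule prob_space_uniform_measure)
  show "prob_space (uniform_sphere :: 'a measure)"
    unfolding uniform_sphere_def by (rule U.prob_space_distr) measurable
  show "sets (uniform_sphere :: 'a measure) = sets borel" by (simp add: uniform_sphere_def)
  \<comment> \<open>At the origin the normalization returns 0, because \<open>inverse 0 = 0\<close>;
    this single point is a null set.\<close>
  have "AE x in uniform_measure lborel (ball (0::'a) 1). x \<noteq> 0"
    by (rule AE_uniform_measureI) (use AE_lborel_singleton[of "0::'a"] in auto)
  then have "AE x in uniform_measure lborel (ball (0::'a) 1). norm (x /\<^sub>R norm x) = 1"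
    by eventually_elim simp
  then show "AE u in (uniform_sphere :: 'a measure). norm u = 1"
    unfolding uniform_sphere_def by (subst AE_distr_iff) auto
  assume v: "norm v = 1"
  have U: "distr (uniform_measure lborel (ball (0::'a) 1)) borel (reflect v) = uniform_measure lborel (ball 0 1)"
    unfolding uniform_measure_def using v by (intro distr_reflect_density) (auto simp: indicator_def)
  \<comment> \<open>Normalization commutes with the reflection, so the symmetry of the ball passes
    to the sphere.\<close>
  have scale: "reflect v (x /\<^sub>R norm x) = reflect v x /\<^sub>R norm (reflect v x)" for x
    unfolding norm_reflect[OF v] by (simp add: reflect_def scaleR_diff_right)
  have "distr uniform_sphere borel (reflect v)
      = distr (distr (uniform_measure lborel (ball (0::'a) 1)) borel (reflect v)) borel (\<lambda>x. x /\<^sub>R norm x)"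
    unfolding uniform_sphere_def
    by (subst distr_distr, measurable, subst distr_distr, measurable) (simp add: comp_def scale)
  then show "distr uniform_sphere borel (reflect v) = (uniform_sphere :: 'a measure)"
    by (simp add: U uniform_sphere_def)
qed

lemma isotropic_uniform_sphere: "isotropic (uniform_sphere :: 'a::euclidean_space measure)"
proof -
  interpret prob_space "uniform_sphere :: 'a measure" by (rule prob_space_uniform_sphere)
  have [measurable_cong]: "sets (uniform_sphere :: 'a measure) = sets borel" by simp
  show ?thesis
  proof
    show "integrable (uniform_sphere :: 'a measure) (\<lambda>u. norm u ^ 6)"
      by (rule integrable_const_bound[where B=1]) (use AE_uniform_sphere in auto)
  qed (simp_all add: distr_reflect_uniform_sphere)
qed

lemma uniform_sphere_norm_power: "(\<integral>u. norm u ^ k \<partial>(uniform_sphere :: 'a::euclidean_space measure)) = 1"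
proof -
  interpret prob_space "uniform_sphere :: 'a measure" by (rule prob_space_uniform_sphere)
  have [measurable_cong]: "sets (uniform_sphere :: 'a measure) = sets borel" by simp
  have "(\<integral>u. norm u ^ k \<partial>(uniform_sphere :: 'a measure)) = (\<integral>u. 1 \<partial>(uniform_sphere :: 'a measure))"
    by (rule integral_cong_AE) (use AE_uniform_sphere in auto)
  then show ?thesis using prob_space by simp
qed

subsection \<open>Moments of the gradient estimator\<close>

lemma grad_est_cong: "(\<And>j. j < N \<Longrightarrow> u j = u' j) \<Longrightarrow> grad_est \<gamma> \<nu> N h x u = grad_est \<gamma> \<nu> N h x u'"
  by (simp add: grad_est_def)

lemma measurable_grad_est [measurable]:
  fixes F :: "'a::euclidean_space \<Rightarrow> real"
  assumes [measurable]: "F \<in> borel_measurable borel"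
  shows "grad_est \<gamma> \<nu> N F x \<in> borel_measurable (tuple_space N)"
  unfolding grad_est_def by measurable

text \<open>The part of a bound on the squared estimator that depends on the directions:
  \<open>\<gamma>\<close> is the scaling, the factor \<open>N\<close> comes from the Cauchy-Schwarz
  inequality for the sum, and 8 from \<open>(2 * (1 + t ^ 3))^2 <= 8 * (1 + t ^ 6)\<close>.\<close>

definition dir_weight :: "real \<Rightarrow> nat \<Rightarrow> (nat \<Rightarrow> 'a::real_normed_vector) \<Rightarrow> real" where
  "dir_weight \<gamma> N u = 8 * \<gamma>\<^sup>2 * real N * (\<Sum>j<N. 1 + norm (u j) ^ 6)"

lemma dir_weight_nonneg: "0 \<le> dir_weight \<gamma> N u"
  unfolding dir_weight_def by (intro mult_nonneg_nonneg sum_nonneg) auto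

text \<open>A crude bound that serves integrability. Its point is the separation of a factor in
  \<open>x\<close> from a factor in \<open>u\<close>: for directions independent of the iterate the
  expectation then splits.\<close>

lemma norm_grad_est_le:
  fixes F :: "'a::euclidean_space \<Rightarrow> real"
  assumes F: "\<And>y. GDERIV F y :> G y" and L: "L-lipschitz_on UNIV G" and \<nu>: "0 < \<nu>" and \<gamma>: "0 \<le> \<gamma>"
  shows "(norm (grad_est \<gamma> \<nu> N F x u))\<^sup>2 \<le> (norm (G x) + L * \<nu>)\<^sup>2 * dir_weight \<gamma> N u"
proof -
  define a where "a = norm (G x) + L * \<nu>"
  have L0: "0 \<le> L" using L by (rule lipschitz_on_nonneg)
  have a0: "0 \<le> a" using L0 \<nu> by (simp add: a_def)
  have sq_cube_le: "t\<^sup>2 + t ^ 3 \<le> 2 * (1 + t ^ 3)" if "0 \<le> t" for t :: real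
  proof -
    have "t\<^sup>2 \<le> 1 + t ^ 3"
    proof (cases "t \<le> 1")
      case True
      then have "t\<^sup>2 \<le> 1" using that by (simp add: power_le_one)
      then show ?thesis using zero_le_power[OF that, of 3] by linarith
    next
      case False
      then have "t\<^sup>2 \<le> t ^ 3" by (intro power_increasing) auto
      then show ?thesis by linarith
    qed
    then show ?thesis using zero_le_power[OF that, of 3] by (simp add: distrib_left)
  qed
  have summand: "norm (((F (x + \<nu> *\<^sub>R u j) - F x) / \<nu>) *\<^sub>R u j) \<le> a * (2 * (1 + norm (u j) ^ 3))" for j
  proof -
    let ?t = "norm (u j)"
    have "\<bar>F (x + \<nu> *\<^sub>R u j) - F x\<bar> \<le> norm (\<nu> *\<^sub>R u j) * (norm (G x) + L * norm (\<nu> *\<^sub>R u j))"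
      by (rule lipschitz_gradient_diff_le[OF F L])
    also have "\<dots> = \<nu> * (?t * (norm (G x) + L * \<nu> * ?t))" using \<nu> by simp
    finally have "\<bar>F (x + \<nu> *\<^sub>R u j) - F x\<bar> / \<nu> \<le> ?t * (norm (G x) + L * \<nu> * ?t)"
      using \<nu> by (simp add: field_simps)
    from mult_right_mono[OF this norm_ge_zero[of "u j"]]
    have "norm (((F (x + \<nu> *\<^sub>R u j) - F x) / \<nu>) *\<^sub>R u j) \<le> ?t * (norm (G x) + L * \<nu> * ?t) * ?t"
      using \<nu> by simp
    also have "\<dots> \<le> a * (?t\<^sup>2 + ?t ^ 3)"
    proof -
      have "0 \<le> L * \<nu> * ?t\<^sup>2" "0 \<le> norm (G x) * ?t ^ 3" using L0 \<nu> by auto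
      then show ?thesis
        unfolding a_def by (simp add: algebra_simps power2_eq_square power3_eq_cube)
    qed
    also have "\<dots> \<le> a * (2 * (1 + ?t ^ 3))"
    proof (rule mult_left_mono[OF _ a0])
      show "?t\<^sup>2 + ?t ^ 3 \<le> 2 * (1 + ?t ^ 3)" by (rule sq_cube_le) simp
    qed
    finally show ?thesis .
  qed
  have sq: "(2 * (1 + t ^ 3))\<^sup>2 \<le> 8 * (1 + t ^ 6)" for t :: real
  proof -
    have "0 \<le> (1 - t ^ 3)\<^sup>2" by simp
    then show ?thesis by (simp add: power2_eq_square algebra_simps flip: power_add)
  qed
  have "norm (grad_est \<gamma> \<nu> N F x u) \<le> \<gamma> * (\<Sum>j<N. a * (2 * (1 + norm (u j) ^ 3)))"
    unfolding grad_est_def using \<gamma> summand by (auto intro!: mult_left_mono sum_norm_le)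
  then have "(norm (grad_est \<gamma> \<nu> N F x u))\<^sup>2 \<le> (\<gamma> * (\<Sum>j<N. a * (2 * (1 + norm (u j) ^ 3))))\<^sup>2"
    by (rule power_mono) simp
  also have "\<dots> = a\<^sup>2 * \<gamma>\<^sup>2 * (\<Sum>j<N. 2 * (1 + norm (u j) ^ 3))\<^sup>2"
    by (simp add: sum_distrib_left[symmetric] power_mult_distrib mult_ac)
  also have "\<dots> \<le> a\<^sup>2 * \<gamma>\<^sup>2 * (real N * (\<Sum>j<N. (2 * (1 + norm (u j) ^ 3))\<^sup>2))"
  proof (rule mult_left_mono)
    show "(\<Sum>j<N. 2 * (1 + norm (u j) ^ 3))\<^sup>2 \<le> real N * (\<Sum>j<N. (2 * (1 + norm (u j) ^ 3))\<^sup>2)"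
      using sum_squared_le_sum_of_squares[of "\<lambda>j. 2 * (1 + norm (u j) ^ 3)" "{..<N}"]
      by (simp add: mult.commute)
  qed simp
  also have "\<dots> \<le> a\<^sup>2 * \<gamma>\<^sup>2 * (real N * (\<Sum>j<N. 8 * (1 + norm (u j) ^ 6)))"
    using sq by (intro mult_left_mono sum_mono) auto
  also have "\<dots> = a\<^sup>2 * dir_weight \<gamma> N u"
    unfolding dir_weight_def sum_distrib_left[symmetric] by (simp add: mult_ac)
  finally show ?thesis by (simp add: a_def)
qed

lemma integrable_dir_weight:
  assumes "prob_space D" "sets D = sets (tuple_space N)"
    and "\<And>j. j < N \<Longrightarrow> integrable D (\<lambda>u. norm (u j) ^ 6)"
  shows "integrable D (dir_weight \<gamma> N)"
proof -
  interpret prob_space D by fact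
  show ?thesis unfolding dir_weight_def using assms(3) by auto
qed

lemma integrable_grad_est:
  fixes F :: "'a::euclidean_space \<Rightarrow> real"
  assumes D: "prob_space D" "sets D = sets (tuple_space N)"
      "\<And>j. j < N \<Longrightarrow> integrable D (\<lambda>u. norm (u j) ^ 6)"
    and F: "\<And>y. GDERIV F y :> G y" and L: "L-lipschitz_on UNIV G" and \<nu>: "0 < \<nu>" and \<gamma>: "0 \<le> \<gamma>"
  shows "integrable D (\<lambda>u. (norm (grad_est \<gamma> \<nu> N F x u))\<^sup>2)"
    and "integrable D (grad_est \<gamma> \<nu> N F x)"
proof -
  note [measurable_cong] = D(2)
  have [measurable]: "F \<in> borel_measurable borel"
    by (rule borel_measurable_continuous_onI[OF GDERIV_imp_continuous_on[OF F]])
  show sq: "integrable D (\<lambda>u. (norm (grad_est \<gamma> \<nu> N F x u))\<^sup>2)"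
  proof (rule Bochner_Integration.integrable_bound)
    show "integrable D (\<lambda>u. (norm (G x) + L * \<nu>)\<^sup>2 * dir_weight \<gamma> N u)"
      using integrable_dir_weight[OF D] by simp
    show "AE u in D. norm ((norm (grad_est \<gamma> \<nu> N F x u))\<^sup>2) \<le> norm ((norm (G x) + L * \<nu>)\<^sup>2 * dir_weight \<gamma> N u)"
      using norm_grad_est_le[OF F L \<nu> \<gamma>, of N x] by (auto intro!: AE_I2 simp: dir_weight_nonneg abs_mult)
  qed measurable
  show "integrable D (grad_est \<gamma> \<nu> N F x)"
    by (rule norm_square_integrable_imp_integrable[OF D(1) _ sq]) measurable
qed

subsection \<open>Smoothing methods\<close>

text \<open>To be read with \<open>a\<close> the squared gradient norm, \<open>b\<close> the squared
  bias, \<open>t\<close> their inner product before squaring, so that \<open>a + 2 * t + b\<close>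
  is the squared mean, and \<open>S\<close> the second moment for one direction. Averaging
  \<open>N\<close> directions divides the variance by \<open>N\<close>.\<close>

lemma smoothing_descent_arith:
  fixes a b t N d S E B \<kappa> :: real
  assumes N: "1 \<le> N" and d: "1 \<le> d" and b: "0 \<le> b" "b \<le> B" and a: "0 \<le> a"
    and t: "- (a + b) \<le> 2 * t" "2 * t \<le> a + b"
    and S: "S \<le> 2 * (d + 2) * a + E"
    and \<kappa>: "B * (12 * N + 36 * d) + 2 * E \<le> 4 * \<kappa> * (N + 4.5 * d)"
  shows "(N / (N + 4.5 * d)) / 8 * ((a + 2 * t + b) + (S - (a + 2 * t + b)) / N) - (a + t) \<le> \<kappa> / 4 - a / 4"
proof -
  define W where "W = N + 4.5 * d"
  have W: "0 < W" using N d by (simp add: W_def)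
  have "(N / W) / 8 * ((a + 2 * t + b) + (S - (a + 2 * t + b)) / N) = ((N - 1) * (a + 2 * t + b) + S) / (8 * W)"
    using N W by (simp add: field_simps)
  moreover have "((N - 1) * (a + 2 * t + b) + S) / (8 * W) \<le> ((N - 1) * (2 * a + 2 * b) + (2 * (d + 2) * a + E)) / (8 * W)"
  proof -
    have "(N - 1) * (a + 2 * t + b) \<le> (N - 1) * (2 * a + 2 * b)" using N t by (intro mult_left_mono) auto
    then show ?thesis using S W by (intro divide_right_mono add_mono) auto
  qed
  \<comment> \<open>The term \<open>- b / 2\<close> pays for the estimate
    \<open>- t <= (a + b) / 2\<close> in the last line. It produces the weight
    \<open>12 N + 36 d\<close>: after clearing denominators the factor of \<open>b\<close> is
    \<open>4 * (N - 1) + 8 * (N + 4.5 * d)\<close>. The factor of \<open>a\<close> keeps the slack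
    \<open>14 * d - 4\<close>.\<close>
  moreover have "((N - 1) * (2 * a + 2 * b) + (2 * (d + 2) * a + E)) / (8 * W) \<le> \<kappa> / 4 + a / 4 - b / 2"
  proof -
    have "b * (12 * N + 36 * d) \<le> B * (12 * N + 36 * d)" using b N d by (intro mult_right_mono) auto
    moreover have "0 \<le> a * (14 * d - 4)" "0 \<le> b" using a b d by auto
    ultimately have "2 * ((N - 1) * (2 * a + 2 * b) + (2 * (d + 2) * a + E)) \<le> 4 * \<kappa> * W + 4 * a * W - 8 * b * W"
      using \<kappa> unfolding W_def by (simp add: algebra_simps)
    then show ?thesis using W by (simp add: field_simps)
  qed
  ultimately show ?thesis using t unfolding W_def[symmetric] by linarith
qed

text \<open>Both smoothing methods at once. The factor \<open>c\<^sub>0\<close> (1 for Gaussian,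
  \<open>d\<close> for sphere directions) is normalized so that the estimator is unbiased for linear
  functions; \<open>B\<close> bounds the bias, and the condition on \<open>\<kappa>\<close> collects
  bias and second-moment error.\<close>

lemma (in isotropic) smoothing_descent:
  fixes F :: "'a \<Rightarrow> real" and c\<^sub>0 :: real
  defines "d \<equiv> real DIM('a)"
  assumes F: "\<And>y. GDERIV F y :> G y" and L: "L-lipschitz_on UNIV G" and \<nu>: "0 < \<nu>" and N: "1 \<le> N"
    and c0: "0 < c\<^sub>0" "c\<^sub>0 * (\<integral>u. (norm u)\<^sup>2 \<partial>Q) = d"
    and bias: "\<And>v. norm v = 1 \<Longrightarrow> c\<^sub>0 * (\<integral>u. taylor_rem F (G x) x \<nu> u * (v \<bullet> u) \<partial>Q) \<le> B" and B: "0 \<le> B"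
    and m4: "c\<^sub>0\<^sup>2 * (\<integral>u. norm u ^ 4 \<partial>Q) \<le> d * (d + 2)"
    and \<kappa>: "B\<^sup>2 * (12 * N + 36 * d) + 2 * (L\<^sup>2 * \<nu>\<^sup>2 / 2 * (c\<^sub>0\<^sup>2 * (\<integral>u. norm u ^ 6 \<partial>Q))) \<le> 4 * \<kappa> * (N + 4.5 * d)"
  shows "(\<integral>u. (N / (N + 4.5 * d)) / 8 * (norm (grad_est (c\<^sub>0 / N) \<nu> N F x u))\<^sup>2
              - G x \<bullet> grad_est (c\<^sub>0 / N) \<nu> N F x u \<partial>Pi\<^sub>M {..<N} (\<lambda>_. Q))
         \<le> \<kappa> / 4 - (norm (G x))\<^sup>2 / 4"
proof -
  let ?R = "taylor_rem F (G x) x \<nu>"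
  let ?P = "Pi\<^sub>M {..<N} (\<lambda>_. Q)"
  interpret P: prob_space ?P by (intro prob_space_PiM prob_space_axioms)
  have [measurable]: "F \<in> borel_measurable borel"
    by (rule borel_measurable_continuous_onI[OF GDERIV_imp_continuous_on[OF F]])
  have [measurable]: "?R \<in> borel_measurable borel" unfolding taylor_rem_def by measurable
  have L0: "0 \<le> L" using L by (rule lipschitz_on_nonneg)
  have d1: "1 \<le> d" by (simp add: d_def Suc_le_eq)
  \<comment> \<open>The contribution of a single direction, including \<open>c\<^sub>0\<close>; the
    estimator is the average of \<open>N\<close> independent copies of it.\<close>
  define Y where "Y u = (c\<^sub>0 * ((F (x + \<nu> *\<^sub>R u) - F x) / \<nu>)) *\<^sub>R u" for u
  have Y_meas [measurable]: "Y \<in> borel_measurable borel" unfolding Y_def by measurable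
  have Y_eq: "Y u = (c\<^sub>0 * (u \<bullet> G x + ?R u)) *\<^sub>R u" for u
    by (simp add: Y_def taylor_rem_def)
  have est: "grad_est (c\<^sub>0 / N) \<nu> N F x u = (1 / real (card {..<N})) *\<^sub>R (\<Sum>j<N. Y (u j))" for u
    by (simp add: grad_est_def Y_def scaleR_sum_right mult_ac)
  have int_gu: "integrable Q (\<lambda>u. (G x \<bullet> u)\<^sup>2 * (norm u)\<^sup>2)"
  proof (rule integrable_bound_norm_power)
    fix u
    have "(G x \<bullet> u)\<^sup>2 \<le> (norm (G x) * norm u)\<^sup>2"
      using power_mono[OF Cauchy_Schwarz_ineq2[of "G x" u] abs_ge_zero, where n=2] by simp
    then have "(G x \<bullet> u)\<^sup>2 * (norm u)\<^sup>2 \<le> (norm (G x) * norm u)\<^sup>2 * (norm u)\<^sup>2"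
      by (rule mult_right_mono) simp
    also have "\<dots> = (norm (G x))\<^sup>2 * norm u ^ 4" by (simp add: power_mult_distrib flip: power_add)
    finally show "norm ((G x \<bullet> u)\<^sup>2 * (norm u)\<^sup>2) \<le> (norm (G x))\<^sup>2 * norm u ^ 4" by simp
  qed auto
  \<comment> \<open>Linear part and remainder are separated by
    \<open>(p + q)^2 <= 2 p^2 + 2 q^2\<close>, so the cross moments are avoided.\<close>
  have Y_le: "(norm (Y u))\<^sup>2 \<le> 2 * c\<^sub>0\<^sup>2 * ((G x \<bullet> u)\<^sup>2 * (norm u)\<^sup>2) + L\<^sup>2 * \<nu>\<^sup>2 / 2 * c\<^sub>0\<^sup>2 * norm u ^ 6" for u
  proof -
    have r2: "(?R u)\<^sup>2 \<le> (L * \<nu> / 2 * (norm u)\<^sup>2)\<^sup>2"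
      using power_mono[OF taylor_rem_abs_le[OF F L \<nu>, of x u] abs_ge_zero, where n=2] by simp
    have "0 \<le> (u \<bullet> G x - ?R u)\<^sup>2" by simp
    then have "(u \<bullet> G x + ?R u)\<^sup>2 \<le> 2 * (G x \<bullet> u)\<^sup>2 + 2 * (?R u)\<^sup>2"
      by (simp add: power2_sum power2_diff inner_commute)
    also have "\<dots> \<le> 2 * (G x \<bullet> u)\<^sup>2 + 2 * (L * \<nu> / 2 * (norm u)\<^sup>2)\<^sup>2" using r2 by simp
    finally have "c\<^sub>0\<^sup>2 * (norm u)\<^sup>2 * (u \<bullet> G x + ?R u)\<^sup>2
        \<le> c\<^sub>0\<^sup>2 * (norm u)\<^sup>2 * (2 * (G x \<bullet> u)\<^sup>2 + 2 * (L * \<nu> / 2 * (norm u)\<^sup>2)\<^sup>2)"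
      by (rule mult_left_mono) simp
    moreover have "(norm (Y u))\<^sup>2 = c\<^sub>0\<^sup>2 * (norm u)\<^sup>2 * (u \<bullet> G x + ?R u)\<^sup>2"
      by (simp add: Y_eq power_mult_distrib mult_ac)
    moreover have "c\<^sub>0\<^sup>2 * (norm u)\<^sup>2 * (2 * (G x \<bullet> u)\<^sup>2 + 2 * (L * \<nu> / 2 * (norm u)\<^sup>2)\<^sup>2)
       = 2 * c\<^sub>0\<^sup>2 * ((G x \<bullet> u)\<^sup>2 * (norm u)\<^sup>2) + L\<^sup>2 * \<nu>\<^sup>2 / 2 * c\<^sub>0\<^sup>2 * norm u ^ 6"
      by (simp add: power_mult_distrib power_divide algebra_simps flip: power_add)
    ultimately show ?thesis by linarith
  qed
  have int_dom: "integrable Q (\<lambda>u. 2 * c\<^sub>0\<^sup>2 * ((G x \<bullet> u)\<^sup>2 * (norm u)\<^sup>2) + L\<^sup>2 * \<nu>\<^sup>2 / 2 * c\<^sub>0\<^sup>2 * norm u ^ 6)"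
    using int_gu integrable_norm_6 by auto
  have Y_sq: "integrable Q (\<lambda>u. (norm (Y u))\<^sup>2)"
    by (rule Bochner_Integration.integrable_bound[OF int_dom])
       (use Y_le in \<open>auto intro!: AE_I2 intro: order_trans[OF _ abs_ge_self]\<close>)
  have Y_int: "integrable Q Y"
    by (rule norm_square_integrable_imp_integrable[OF prob_space_axioms _ Y_sq]) measurable
  define S where "S = (\<integral>u. (norm (Y u))\<^sup>2 \<partial>Q)"
  define E where "E = L\<^sup>2 * \<nu>\<^sup>2 / 2 * (c\<^sub>0\<^sup>2 * (\<integral>u. norm u ^ 6 \<partial>Q))"
  have S_le: "S \<le> 2 * (d + 2) * (norm (G x))\<^sup>2 + E"
  proof -
    have "S \<le> (\<integral>u. 2 * c\<^sub>0\<^sup>2 * ((G x \<bullet> u)\<^sup>2 * (norm u)\<^sup>2) + L\<^sup>2 * \<nu>\<^sup>2 / 2 * c\<^sub>0\<^sup>2 * norm u ^ 6 \<partial>Q)"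
      unfolding S_def by (rule integral_mono[OF Y_sq int_dom Y_le])
    also have "\<dots> = 2 * c\<^sub>0\<^sup>2 * ((norm (G x))\<^sup>2 / d * (\<integral>u. norm u ^ 4 \<partial>Q)) + E"
      using int_gu integrable_norm_6 integral_inner_square[of 2 "G x"] by (simp add: d_def E_def)
    also have "2 * c\<^sub>0\<^sup>2 * ((norm (G x))\<^sup>2 / d * (\<integral>u. norm u ^ 4 \<partial>Q))
        = 2 * (norm (G x))\<^sup>2 / d * (c\<^sub>0\<^sup>2 * (\<integral>u. norm u ^ 4 \<partial>Q))" by simp
    also have "\<dots> \<le> 2 * (norm (G x))\<^sup>2 / d * (d * (d + 2))"
      using m4 d1 by (intro mult_left_mono) auto
    also have "\<dots> = 2 * (d + 2) * (norm (G x))\<^sup>2" using d1 by simp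
    finally show ?thesis by simp
  qed
  define e where "e = expectation Y - G x"
  have intR: "integrable Q (\<lambda>u. ?R u * (v \<bullet> u))" for v
  proof (rule integrable_bound_norm_power)
    fix u
    have "\<bar>?R u\<bar> * \<bar>v \<bullet> u\<bar> \<le> (L * \<nu> / 2 * (norm u)\<^sup>2) * (norm v * norm u)"
      using taylor_rem_abs_le[OF F L \<nu>, of x u] Cauchy_Schwarz_ineq2[of v u] by (intro mult_mono) auto
    then show "norm (?R u * (v \<bullet> u)) \<le> L * \<nu> / 2 * norm v * norm u ^ 3"
      by (simp add: abs_mult power3_eq_cube power2_eq_square mult_ac)
  qed (use L0 \<nu> in auto)
  have e_inner: "v \<bullet> e = c\<^sub>0 * (\<integral>u. ?R u * (v \<bullet> u) \<partial>Q)" for v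
  proof -
    have int1: "integrable Q (\<lambda>u. (G x \<bullet> u) * (v \<bullet> u))"
    proof (rule integrable_bound_norm_power)
      fix u
      have "\<bar>G x \<bullet> u\<bar> * \<bar>v \<bullet> u\<bar> \<le> (norm (G x) * norm u) * (norm v * norm u)"
        by (intro mult_mono Cauchy_Schwarz_ineq2) auto
      then show "norm ((G x \<bullet> u) * (v \<bullet> u)) \<le> norm (G x) * norm v * norm u ^ 2"
        by (simp add: abs_mult power2_eq_square mult_ac)
    qed auto
    have "v \<bullet> expectation Y = (\<integral>u. v \<bullet> Y u \<partial>Q)" using Y_int by simp
    also have "\<dots> = (\<integral>u. c\<^sub>0 * ((G x \<bullet> u) * (v \<bullet> u)) + c\<^sub>0 * (?R u * (v \<bullet> u)) \<partial>Q)"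
      by (intro Bochner_Integration.integral_cong refl) (simp add: Y_eq inner_commute algebra_simps)
    also have "\<dots> = c\<^sub>0 * ((G x \<bullet> v) / d * (\<integral>u. (norm u)\<^sup>2 \<partial>Q)) + c\<^sub>0 * (\<integral>u. ?R u * (v \<bullet> u) \<partial>Q)"
      using int1 intR by (simp add: integral_inner_inner d_def)
    also have "c\<^sub>0 * ((G x \<bullet> v) / d * (\<integral>u. (norm u)\<^sup>2 \<partial>Q)) = (G x \<bullet> v) / d * (c\<^sub>0 * (\<integral>u. (norm u)\<^sup>2 \<partial>Q))"
      by simp
    also have "\<dots> = v \<bullet> G x" using c0 d1 by (simp add: inner_commute)
    finally show ?thesis by (simp add: e_def inner_diff_right)
  qed
  \<comment> \<open>The normalized bias itself is taken as the test direction
    \<open>v\<close>.\<close>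
  have e_le: "norm e \<le> B"
  proof (cases "e = 0")
    case False
    then have "((1 / norm e) *\<^sub>R e) \<bullet> e \<le> B" unfolding e_inner by (intro bias) simp
    then show ?thesis using False by (simp add: dot_square_norm power2_eq_square)
  qed (simp add: B)
  have EY: "expectation Y = G x + e" by (simp add: e_def)
  have Ynorm: "(norm (expectation Y))\<^sup>2 = (norm (G x))\<^sup>2 + 2 * (G x \<bullet> e) + (norm e)\<^sup>2"
    unfolding EY power2_norm_eq_inner by (simp add: inner_add_left inner_add_right inner_commute)
  have fin: "finite {..<N}" "{..<N} \<noteq> {}" "{..<N} \<subseteq> {..<N}" using N by (auto simp: lessThan_empty_iff)
  have Y_meas': "Y \<in> borel_measurable Q" by measurable
  note avg = iid_average[OF prob_space_axioms Y_meas' Y_sq fin]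
  define A where "A = (\<lambda>u. (1 / real (card {..<N})) *\<^sub>R (\<Sum>j<N. Y (u j)))"
  have avg: "A \<in> borel_measurable ?P" "integrable ?P (\<lambda>u. (norm (A u))\<^sup>2)" "integral\<^sup>L ?P A = expectation Y"
    "(\<integral>u. (norm (A u))\<^sup>2 \<partial>?P) = (norm (expectation Y))\<^sup>2 + (\<integral>u. (norm (Y u - expectation Y))\<^sup>2 \<partial>Q) / card {..<N}"
    unfolding A_def using avg .
  have est: "grad_est (c\<^sub>0 / N) \<nu> N F x = A" by (simp add: fun_eq_iff est A_def)
  have avg_int: "integrable ?P A"
    by (rule norm_square_integrable_imp_integrable[OF P.prob_space_axioms avg(1,2)])
  have "(\<integral>u. (norm (Y u - expectation Y))\<^sup>2 \<partial>Q) = S - (norm (expectation Y))\<^sup>2"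
    unfolding S_def by (rule integral_norm_sub_mean_square[OF Y_meas' Y_sq])
  then have "(\<integral>u. (N / (N + 4.5 * d)) / 8 * (norm (grad_est (c\<^sub>0 / N) \<nu> N F x u))\<^sup>2
              - G x \<bullet> grad_est (c\<^sub>0 / N) \<nu> N F x u \<partial>?P)
     = (N / (N + 4.5 * d)) / 8 * ((norm (expectation Y))\<^sup>2 + (S - (norm (expectation Y))\<^sup>2) / N) - G x \<bullet> expectation Y"
    unfolding est using avg(2,3,4) avg_int by simp
  also have "\<dots> = (real N / (real N + 4.5 * d)) / 8 * (((norm (G x))\<^sup>2 + 2 * (G x \<bullet> e) + (norm e)\<^sup>2)
        + (S - ((norm (G x))\<^sup>2 + 2 * (G x \<bullet> e) + (norm e)\<^sup>2)) / N) - ((norm (G x))\<^sup>2 + G x \<bullet> e)"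
    unfolding Ynorm by (simp add: EY inner_add_right dot_square_norm)
  also have "\<dots> \<le> \<kappa> / 4 - (norm (G x))\<^sup>2 / 4"
  proof (rule smoothing_descent_arith)
    have cs: "\<bar>G x \<bullet> e\<bar> \<le> norm (G x) * norm e" by (rule Cauchy_Schwarz_ineq2)
    have "2 * (norm (G x) * norm e) \<le> (norm (G x))\<^sup>2 + (norm e)\<^sup>2"
      using zero_le_power2[of "norm (G x) - norm e"] by (simp add: power2_diff)
    then show "- ((norm (G x))\<^sup>2 + (norm e)\<^sup>2) \<le> 2 * (G x \<bullet> e)" "2 * (G x \<bullet> e) \<le> (norm (G x))\<^sup>2 + (norm e)\<^sup>2"
      using cs by linarith+
    show "(norm e)\<^sup>2 \<le> B\<^sup>2" using e_le by (rule power_mono) simp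
    show "B\<^sup>2 * (12 * real N + 36 * d) + 2 * E \<le> 4 * \<kappa> * (real N + 4.5 * d)"
      using \<kappa> by (simp add: E_def)
  qed (use N d1 S_le in auto)
  finally show ?thesis .
qed

subsection \<open>Orthonormal directions\<close>

context
  fixes b :: "nat \<Rightarrow> 'a::euclidean_space"
  assumes orthonormal: "\<And>i j. i < DIM('a) \<Longrightarrow> j < DIM('a) \<Longrightarrow> b i \<bullet> b j = (if i = j then 1 else 0)"
begin

lemma inner_orthonormal_sum:
  assumes "inj_on J I" "J ` I \<subseteq> {..<DIM('a)}" "finite I" "i \<in> I"
  shows "b (J i) \<bullet> (\<Sum>j\<in>I. c (J j) *\<^sub>R b (J j)) = c (J i)"
proof -
  have "b (J i) \<bullet> (\<Sum>j\<in>I. c (J j) *\<^sub>R b (J j)) = (\<Sum>j\<in>I. if i = j then c (J i) else 0)"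
    unfolding inner_sum_right
  proof (rule sum.cong[OF refl])
    fix j assume j: "j \<in> I"
    have "J i < DIM('a)" "J j < DIM('a)" "J i = J j \<longleftrightarrow> i = j"
      using assms j by (auto dest: inj_onD)
    then show "b (J i) \<bullet> c (J j) *\<^sub>R b (J j) = (if i = j then c (J i) else 0)"
      by (simp add: orthonormal)
  qed
  then show ?thesis using assms by simp
qed

lemma norm_orthonormal_sum:
  assumes "inj_on J I" "J ` I \<subseteq> {..<DIM('a)}" "finite I"
  shows "(norm (\<Sum>j\<in>I. c (J j) *\<^sub>R b (J j)))\<^sup>2 = (\<Sum>j\<in>I. (c (J j))\<^sup>2)"
proof -
  have "(norm (\<Sum>j\<in>I. c (J j) *\<^sub>R b (J j)))\<^sup>2
      = (\<Sum>i\<in>I. c (J i) * (b (J i) \<bullet> (\<Sum>j\<in>I. c (J j) *\<^sub>R b (J j))))"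
    unfolding power2_norm_eq_inner by (subst inner_sum_left) simp
  then show ?thesis using inner_orthonormal_sum[OF assms] by (simp add: power2_eq_square)
qed

text \<open>The vectors are independent and as many as the dimension, so they span the space; the
  difference of the two sides is orthogonal to all of them and hence to itself.\<close>

lemma orthonormal_expansion: "x = (\<Sum>i<DIM('a). (x \<bullet> b i) *\<^sub>R b i)"
proof -
  define B where "B = b ` {..<DIM('a)}"
  have inj: "inj_on b {..<DIM('a)}"
    using orthonormal by (auto simp: inj_on_def) (metis zero_neq_one)
  have "pairwise orthogonal B"
    unfolding B_def pairwise_def orthogonal_def using orthonormal by (auto split: if_splits)
  moreover have "0 \<notin> B"
    unfolding B_def using orthonormal by (auto simp: image_iff) (metis inner_zero_left zero_neq_one)
  ultimately have "independent B" by (rule pairwise_orthogonal_independent)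
  moreover have "card B = DIM('a)" unfolding B_def using inj by (simp add: card_image)
  ultimately have span: "span B = UNIV"
    using card_ge_dim_independent[of B UNIV] by (auto simp: dim_UNIV)
  define y where "y = x - (\<Sum>i<DIM('a). (x \<bullet> b i) *\<^sub>R b i)"
  have "orthogonal y z" if "z \<in> B" for z
  proof -
    obtain i where i: "i < DIM('a)" "z = b i" using \<open>z \<in> B\<close> by (auto simp: B_def)
    then show ?thesis
      using inner_orthonormal_sum[of id "{..<DIM('a)}" i "\<lambda>i. x \<bullet> b i"]
      by (simp add: y_def orthogonal_def inner_commute[of _ "b i"] inner_diff_right)
  qed
  then have "orthogonal y y" using orthogonal_to_span[of y B y] span by auto
  then show ?thesis by (simp add: y_def orthogonal_def)
qed

text \<open>Along an orthonormal basis the inequality decouples into scalar ones for a partial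
  derivative \<open>g\<close> with error \<open>r\<close>. Summing the errors gives
  \<open>L^2 \<nu>^2 d / 8\<close>, which is at most \<open>\<kappa> / 6\<close>.\<close>

lemma orthonormal_descent:
  fixes F :: "'a \<Rightarrow> real" and x :: 'a and \<nu> :: real
  assumes F: "\<And>y. GDERIV F y :> G y" and L: "L-lipschitz_on UNIV G" and \<nu>: "0 < \<nu>"
    and \<kappa>: "3 * L\<^sup>2 * \<nu>\<^sup>2 * DIM('a) \<le> 4 * \<kappa>" "0 \<le> \<kappa>"
  defines "a \<equiv> (\<lambda>i. (F (x + \<nu> *\<^sub>R b i) - F x) / \<nu>)"
  shows "(\<Sum>i<DIM('a). (a i)\<^sup>2) / 8 - (\<Sum>i<DIM('a). a i * (G x \<bullet> b i)) \<le> \<kappa> / 4 - (norm (G x))\<^sup>2 / 4"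
proof -
  have nx: "(norm (G x))\<^sup>2 = (\<Sum>i<DIM('a). (G x \<bullet> b i)\<^sup>2)"
    using norm_orthonormal_sum[of id "{..<DIM('a)}" "\<lambda>i. G x \<bullet> b i"] orthonormal_expansion[of "G x"] by simp
  have "(a i)\<^sup>2 / 8 - a i * (G x \<bullet> b i) \<le> L\<^sup>2 * \<nu>\<^sup>2 / 8 - (G x \<bullet> b i)\<^sup>2 / 4" if i: "i < DIM('a)" for i
  proof -
    define r g where "r = taylor_rem F (G x) x \<nu> (b i)" and "g = G x \<bullet> b i"
    have n1: "norm (b i) = 1" using orthonormal[OF i i] by (simp add: norm_eq_1)
    have a: "a i = g + r" by (simp add: a_def r_def g_def taylor_rem_def inner_commute)
    have "\<bar>r\<bar> \<le> L * \<nu> / 2" using taylor_rem_abs_le[OF F L \<nu>, of x "b i"] by (simp add: r_def n1)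
    then have "r\<^sup>2 \<le> (L * \<nu> / 2)\<^sup>2" using power_mono[of "\<bar>r\<bar>" "L * \<nu> / 2" 2] by simp
    then have r2: "r\<^sup>2 \<le> L\<^sup>2 * \<nu>\<^sup>2 / 4" by (simp add: power_mult_distrib power_divide)
    \<comment> \<open>The difference of the two sides written as a nonnegative combination of
      squares.\<close>
    have "r\<^sup>2 / 2 - g\<^sup>2 / 4 - ((g + r)\<^sup>2 / 8 - (g + r) * g) = (3 * (g + r)\<^sup>2 + 2 * g\<^sup>2) / 8"
      by (simp add: power2_eq_square field_simps)
    then have "(g + r)\<^sup>2 / 8 - (g + r) * g \<le> r\<^sup>2 / 2 - g\<^sup>2 / 4"
      by (smt (verit) divide_nonneg_pos zero_le_power2)
    then show ?thesis using r2 unfolding a g_def[symmetric] by linarith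
  qed
  then have "(\<Sum>i<DIM('a). (a i)\<^sup>2 / 8 - a i * (G x \<bullet> b i)) \<le> (\<Sum>i<DIM('a). L\<^sup>2 * \<nu>\<^sup>2 / 8 - (G x \<bullet> b i)\<^sup>2 / 4)"
    by (intro sum_mono) auto
  then have "(\<Sum>i<DIM('a). (a i)\<^sup>2) / 8 - (\<Sum>i<DIM('a). a i * (G x \<bullet> b i))
      \<le> L\<^sup>2 * \<nu>\<^sup>2 * DIM('a) / 8 - (norm (G x))\<^sup>2 / 4"
    by (simp add: sum_subtractf sum_divide_distrib[symmetric] nx mult_ac)
  then show ?thesis using \<kappa> by (simp add: mult_ac)
qed

text \<open>The chosen directions are orthogonal, so the squared norm has no cross terms and only
  the uniform law of single positions matters. The step factor \<open>N / d\<close> cancels the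
  inflation by the scaling \<open>d / N\<close>; what remains is the expression for the full
  basis.\<close>

lemma orthonormal_without_replacement:
  fixes F :: "'a \<Rightarrow> real" and x :: 'a and \<nu> :: real
  defines "a \<equiv> (\<lambda>i. (F (x + \<nu> *\<^sub>R b i) - F x) / \<nu>)" and "d \<equiv> DIM('a)"
  assumes N: "1 \<le> N" "N \<le> d"
  shows "(\<integral>J. N / d / 8 * (norm (grad_est (d / N) \<nu> N F x (\<lambda>j. b (J j))))\<^sup>2
            - g \<bullet> grad_est (d / N) \<nu> N F x (\<lambda>j. b (J j)) \<partial>without_replacement d N)
     = (\<Sum>i<d. (a i)\<^sup>2) / 8 - (\<Sum>i<d. a i * (g \<bullet> b i))"
proof -
  let ?W = "without_replacement d N"
  interpret W: prob_space ?W using N by (intro prob_space_without_replacement) auto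
  have Wint: "integrable ?W (\<lambda>J. h (J j))" for h :: "nat \<Rightarrow> real" and j
    unfolding without_replacement_def uniform_count_measure_def
    by (rule integrable_point_measure_finite[OF finite_injections[OF N(2)]])
  have est: "grad_est (d / N) \<nu> N F x (\<lambda>j. b (J j)) = (real d / N) *\<^sub>R (\<Sum>j<N. a (J j) *\<^sub>R b (J j))" for J
    by (simp add: grad_est_def a_def)
  have "(\<integral>J. N / d / 8 * (norm (grad_est (d / N) \<nu> N F x (\<lambda>j. b (J j))))\<^sup>2
            - g \<bullet> grad_est (d / N) \<nu> N F x (\<lambda>j. b (J j)) \<partial>?W)
     = (\<integral>J. d / N / 8 * (\<Sum>j<N. (a (J j))\<^sup>2) - d / N * (\<Sum>j<N. a (J j) * (g \<bullet> b (J j))) \<partial>?W)"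
  proof (rule Bochner_Integration.integral_cong[OF refl])
    fix J assume "J \<in> space ?W"
    then have J: "inj_on J {..<N}" "J ` {..<N} \<subseteq> {..<DIM('a)}"
      by (auto simp: without_replacement_def space_uniform_count_measure d_def)
    have "(norm ((real d / N) *\<^sub>R (\<Sum>j<N. a (J j) *\<^sub>R b (J j))))\<^sup>2 = (d / N)\<^sup>2 * (\<Sum>j<N. (a (J j))\<^sup>2)"
      using norm_orthonormal_sum[OF J, of a] by (simp add: power_mult_distrib power_divide)
    moreover have "N / d / 8 * ((d / N)\<^sup>2 * s) = d / N / 8 * s" for s :: real
      using N by (simp add: power2_eq_square field_simps)
    ultimately show "N / d / 8 * (norm (grad_est (d / N) \<nu> N F x (\<lambda>j. b (J j))))\<^sup>2
            - g \<bullet> grad_est (d / N) \<nu> N F x (\<lambda>j. b (J j))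
       = d / N / 8 * (\<Sum>j<N. (a (J j))\<^sup>2) - d / N * (\<Sum>j<N. a (J j) * (g \<bullet> b (J j)))"
      unfolding est by (simp add: inner_sum_right)
  qed
  also have "\<dots> = d / N / 8 * (\<Sum>j<N. \<integral>J. (a (J j))\<^sup>2 \<partial>?W) - d / N * (\<Sum>j<N. \<integral>J. a (J j) * (g \<bullet> b (J j)) \<partial>?W)"
    using Wint[of "\<lambda>i. (a i)\<^sup>2"] Wint[of "\<lambda>i. a i * (g \<bullet> b i)"] by simp
  also have "\<dots> = d / N / 8 * (\<Sum>j<N. (1 / d) * (\<Sum>i<d. (a i)\<^sup>2)) - d / N * (\<Sum>j<N. (1 / d) * (\<Sum>i<d. a i * (g \<bullet> b i)))"
    using without_replacement_marginal[OF N(2), of _ "\<lambda>i. (a i)\<^sup>2"]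
      without_replacement_marginal[OF N(2), of _ "\<lambda>i. a i * (g \<bullet> b i)"] by simp
  also have "\<dots> = (\<Sum>i<d. (a i)\<^sup>2) / 8 - (\<Sum>i<d. a i * (g \<bullet> b i))"
    using N by simp
  finally show ?thesis .
qed

end

subsection \<open>One step of each method\<close>

lemma admissible_imp_pos: "admissible m d N \<Longrightarrow> 1 \<le> N"
  by (simp add: admissible_def)

lemma (in isotropic) PiM_norm_6_integrable:
  assumes "j < N"
  shows "integrable (Pi\<^sub>M {..<N} (\<lambda>_. Q)) (\<lambda>u. norm (u j) ^ 6)"
proof -
  have d: "distr (Pi\<^sub>M {..<N} (\<lambda>_. Q)) Q (\<lambda>\<omega>. \<omega> j) = Q"
    using assms by (intro distr_PiM_component prob_space_axioms) auto
  have [measurable]: "(\<lambda>\<omega>. \<omega> j) \<in> measurable (Pi\<^sub>M {..<N} (\<lambda>_. Q)) Q"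
    using assms by simp
  have "integrable (distr (Pi\<^sub>M {..<N} (\<lambda>_. Q)) Q (\<lambda>\<omega>. \<omega> j)) (\<lambda>u. norm u ^ 6)"
    using integrable_norm_6 by (simp only: d)
  then show ?thesis by (subst (asm) integrable_distr_eq) auto
qed

lemma (in isotropic) sets_PiM_isotropic: "sets (Pi\<^sub>M {..<N} (\<lambda>_. Q)) = sets (tuple_space N)"
  by (rule sets_PiM_cong) auto

section \<open>Measurability and moments of the direction laws\<close>

lemma measurable_without_replacement:
  "(\<And>J. J \<in> {..<N} \<rightarrow>\<^sub>E {..<d} \<Longrightarrow> T J \<in> space K) \<Longrightarrow> T \<in> measurable (without_replacement d N) K"
  by (auto simp: without_replacement_def measurable_def sets_uniform_count_measure space_uniform_count_measure)

context
  fixes Q :: "(nat \<Rightarrow> 'a::euclidean_space) measure" and N :: nat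
  assumes Q: "prob_space Q" "sets Q = sets (tuple_space DIM('a))" and N: "N \<le> DIM('a)"
begin

text \<open>The basis is evaluated at a random index, which is not a fixed projection; since the
  index has finitely many values, a case split over them restores measurability.\<close>

lemma measurable_select:
  "(\<lambda>(b, J). \<lambda>j\<in>{..<N}. b (J j)) \<in> measurable (Q \<Otimes>\<^sub>M without_replacement DIM('a) N) (tuple_space N)"
proof -
  note [measurable_cong] = Q(2)
  have "(\<lambda>p. fst p (snd p j)) \<in> borel_measurable (Q \<Otimes>\<^sub>M without_replacement DIM('a) N)" if "j < N" for j
  proof (rule measurable_compose_countable'[where f="\<lambda>i p. fst p i" and g="\<lambda>p. snd p j" and I="{..<DIM('a)}"])
    have "(\<lambda>J. J j) \<in> measurable (without_replacement DIM('a) N) (count_space {..<DIM('a)})"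
      using that by (intro measurable_without_replacement) (auto simp: PiE_iff)
    then show "(\<lambda>p. snd p j) \<in> measurable (Q \<Otimes>\<^sub>M without_replacement DIM('a) N) (count_space {..<DIM('a)})"
      by (rule measurable_compose[OF measurable_snd])
    show "(\<lambda>p. fst p i) \<in> borel_measurable (Q \<Otimes>\<^sub>M without_replacement DIM('a) N)" if "i \<in> {..<DIM('a)}" for i
      using that by measurable
  qed auto
  then show ?thesis
    unfolding case_prod_beta by (intro measurable_restrict) auto
qed

lemma AE_select_norm:
  assumes "AE b in Q. \<forall>i<DIM('a). \<forall>j<DIM('a). b i \<bullet> b j = (if i = j then 1 else 0)"
  shows "AE u in distr (Q \<Otimes>\<^sub>M without_replacement DIM('a) N) (tuple_space N) (\<lambda>(b, J). \<lambda>j\<in>{..<N}. b (J j)).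
    \<forall>j<N. norm (u j) = 1"
proof -
  let ?W = "without_replacement DIM('a) N" and ?T = "\<lambda>(b, J). \<lambda>j\<in>{..<N}. b (J j)"
  interpret Q: prob_space Q by (rule Q)
  interpret W: prob_space ?W using N by (rule prob_space_without_replacement)
  interpret pair_sigma_finite Q ?W ..
  note [measurable] = measurable_select
  have "AE p in Q \<Otimes>\<^sub>M ?W. \<forall>j<N. norm (?T p j) = 1"
  proof (rule AE_pair_measure)
    have *: "AE J in ?W. \<forall>j<N. norm (?T (b, J) j) = 1"
      if "\<forall>i<DIM('a). \<forall>j<DIM('a). b i \<bullet> b j = (if i = j then 1 else 0)" for b
      using that
      by (intro AE_I2) (auto simp: without_replacement_def space_uniform_count_measure PiE_iff norm_eq_1)
    show "AE b in Q. AE J in ?W. \<forall>j<N. norm (?T (b, J) j) = 1"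
      using assms by (rule eventually_mono) (rule *)
  qed measurable
  then show ?thesis by (subst AE_distr_iff) auto
qed

end

text \<open>One case analysis yields all three facts. Outside the smoothing methods the sixth moment
  is finite because the directions have norm 1 almost surely.\<close>

lemma
  fixes D :: "(nat \<Rightarrow> 'a::euclidean_space) measure"
  assumes m: "admissible m DIM('a) N" and D: "direction_law m N D"
  shows direction_law_prob_space: "prob_space D"
    and direction_law_sets: "sets D = sets (tuple_space N)"
    and direction_law_integrable: "j < N \<Longrightarrow> integrable D (\<lambda>u. norm (u j) ^ 6)"
proof -
  have unit: "integrable D (\<lambda>u. norm (u j) ^ 6)"
    if "prob_space D" and s: "sets D = sets (tuple_space N)" and AE: "AE u in D. \<forall>j<N. norm (u j) = 1" and j: "j < N" for j
  proof -
    interpret prob_space D by fact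
    note [measurable_cong] = s
    show ?thesis
      by (rule integrable_const_bound[where B=1]) (use AE j in auto)
  qed
  have "prob_space D \<and> sets D = sets (tuple_space N) \<and> (\<forall>j<N. integrable D (\<lambda>u. norm (u j) ^ 6))"
  proof (cases m)
    case FD
    then obtain e where e: "bij_betw e {..<N} (Basis :: 'a set)" and D': "D = return (tuple_space N) (restrict e {..<N})"
      using D by (auto simp: direction_law_def)
    have sp: "restrict e {..<N} \<in> space (tuple_space N)" by (simp add: space_PiM)
    have "prob_space D" unfolding D' using sp by (rule prob_space_return)
    moreover have "sets D = sets (tuple_space N)" by (simp add: D')
    moreover have "AE u in D. \<forall>j<N. norm (u j) = 1"
      unfolding D' using sp bij_betwE[OF e] by (subst AE_return) auto
    ultimately show ?thesis using unit by blast
  next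
    case GS
    interpret isotropic "std_gaussian :: 'a measure" by (rule isotropic_std_gaussian)
    show ?thesis using GS D PiM_norm_6_integrable sets_PiM_isotropic
      by (auto simp: direction_law_def intro!: prob_space_PiM prob_space_axioms)
  next
    case SS
    interpret isotropic "uniform_sphere :: 'a measure" by (rule isotropic_uniform_sphere)
    show ?thesis using SS D PiM_norm_6_integrable sets_PiM_isotropic
      by (auto simp: direction_law_def intro!: prob_space_PiM prob_space_axioms)
  next
    case RC
    let ?W = "without_replacement DIM('a) N"
    obtain e where e: "bij_betw e {..<DIM('a)} (Basis :: 'a set)"
      and D': "D = distr ?W (tuple_space N) (\<lambda>J. \<lambda>j\<in>{..<N}. e (J j))"
      using RC D by (auto simp: direction_law_def)
    have N: "N \<le> DIM('a)" using m RC by (simp add: admissible_def)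
    interpret W: prob_space ?W using N by (rule prob_space_without_replacement)
    have T [measurable]: "(\<lambda>J. \<lambda>j\<in>{..<N}. e (J j)) \<in> measurable ?W (tuple_space N)"
      by (rule measurable_without_replacement) (simp add: space_PiM)
    have "prob_space D" unfolding D' by (rule W.prob_space_distr[OF T])
    moreover have "sets D = sets (tuple_space N)" by (simp add: D')
    moreover have "AE u in D. \<forall>j<N. norm (u j) = 1"
      unfolding D' using bij_betwE[OF e]
      by (subst AE_distr_iff)
         (auto intro!: AE_I2 simp: without_replacement_def space_uniform_count_measure PiE_iff)
    ultimately show ?thesis using unit by blast
  next
    case RS
    let ?W = "without_replacement DIM('a) N"
    obtain Q where Q: "prob_space Q" "sets Q = sets (tuple_space DIM('a))"
      "AE b in Q. \<forall>i<DIM('a). \<forall>j<DIM('a). b i \<bullet> b j = (if i = j then 1 else (0::real))"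
      and D': "D = distr (Q \<Otimes>\<^sub>M ?W) (tuple_space N) (\<lambda>(b, J). \<lambda>j\<in>{..<N}. b (J j))"
      using RS D by (auto simp: direction_law_def)
    have N: "N \<le> DIM('a)" using m RS by (simp add: admissible_def)
    interpret Q: prob_space Q by (rule Q)
    interpret W: prob_space ?W using N by (rule prob_space_without_replacement)
    interpret pair_prob_space Q ?W ..
    have "prob_space D" unfolding D' by (rule P.prob_space_distr[OF measurable_select[OF Q(1,2) N]])
    moreover have "sets D = sets (tuple_space N)" by (simp add: D')
    moreover have "AE u in D. \<forall>j<N. norm (u j) = 1"
      unfolding D' by (rule AE_select_norm[OF Q(1,2) N Q(3)])
    ultimately show ?thesis using unit by blast
  qed
  then show "prob_space D" "sets D = sets (tuple_space N)" "j < N \<Longrightarrow> integrable D (\<lambda>u. norm (u j) ^ 6)"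
    by auto
qed

lemma radius_pos:
  assumes "admissible m d N" "1 \<le> d" "0 < L" "0 < \<mu>" "0 < \<epsilon>" "0 < p"
  shows "0 < radius m d N \<mu> L \<epsilon> p"
proof -
  have "0 < Omega5 d \<mu> L \<epsilon> p" using assms by (simp add: Omega5_def)
  moreover have "0 < 2 * (real N + 4.5 * real d)" using assms by simp
  moreover have "0 < 8 * real N + 24 * real d + (real d + 2) * (real d + 4)"
    using assms by (intro add_pos_pos mult_pos_pos) (auto simp: admissible_def)
  moreover have "0 < 8 * real N + 24 * real d + (real d)\<^sup>2"
    using assms by (intro add_pos_nonneg) (auto simp: admissible_def)
  ultimately show ?thesis using assms by (cases m) (auto simp: radius_def)
qed

text \<open>The relation that converts the radius into the admissible error
  \<open>\<mu> * \<epsilon> * p\<close> of one step.\<close>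

lemma Omega5_square:
  assumes "1 \<le> d" "0 < L" "0 < \<mu>" "0 < \<epsilon>" "0 < p"
  shows "3 * L\<^sup>2 * (Omega5 d \<mu> L \<epsilon> p)\<^sup>2 * d = 4 * (\<mu> * \<epsilon> * p)"
  using assms by (simp add: Omega5_def field_simps)

lemma method_descent:
  fixes F :: "'a::euclidean_space \<Rightarrow> real" and D :: "(nat \<Rightarrow> 'a) measure"
  assumes F: "\<And>y. GDERIV F y :> G y" and L: "L-lipschitz_on UNIV G" "0 < L"
    and m: "admissible m DIM('a) N" and D: "direction_law m N D"
    and pos: "0 < \<mu>" "0 < \<epsilon>" "0 < p"
  defines "\<nu> \<equiv> radius m DIM('a) N \<mu> L \<epsilon> p"
    and "s \<equiv> step_factor m DIM('a) N" and "\<gamma> \<equiv> scaling m DIM('a) N"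
  shows "(\<integral>u. s / 8 * (norm (grad_est \<gamma> \<nu> N F x u))\<^sup>2 - G x \<bullet> grad_est \<gamma> \<nu> N F x u \<partial>D)
    \<le> \<mu> * \<epsilon> * p / 4 - (norm (G x))\<^sup>2 / 4"
proof -
  define d where "d = real DIM('a)"
  define \<kappa> where "\<kappa> = \<mu> * \<epsilon> * p"
  have d1: "1 \<le> d" "1 \<le> DIM('a)" by (simp_all add: d_def Suc_le_eq)
  have N1: "1 \<le> N" using m by (rule admissible_imp_pos)
  have \<nu>: "0 < \<nu>" unfolding \<nu>_def using m d1(2) L(2) pos by (rule radius_pos)
  have \<kappa>0: "0 \<le> \<kappa>" using pos by (simp add: \<kappa>_def)
  have \<Omega>: "3 * L\<^sup>2 * (Omega5 DIM('a) \<mu> L \<epsilon> p)\<^sup>2 * d = 4 * \<kappa>"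
    unfolding \<kappa>_def d_def by (rule Omega5_square[OF d1(2) L(2) pos])
  note [measurable] = borel_measurable_continuous_onI[OF GDERIV_imp_continuous_on[OF F]]
  show ?thesis
    unfolding \<kappa>_def[symmetric]
  proof (cases m)
    case FD
    then obtain e where e: "bij_betw e {..<N} (Basis :: 'a set)" and D': "D = return (tuple_space N) (restrict e {..<N})"
      using D by (auto simp: direction_law_def)
    have N: "N = DIM('a)" using m FD by (simp add: admissible_def)
    have orth: "e i \<bullet> e j = (if i = j then 1 else 0)" if "i < DIM('a)" "j < DIM('a)" for i j
      using that bij_betwE[OF e] bij_betw_imp_inj_on[OF e] by (auto simp: N inner_Basis inj_on_def)
    let ?a = "\<lambda>i. (F (x + \<nu> *\<^sub>R e i) - F x) / \<nu>"
    have est: "grad_est \<gamma> \<nu> N F x (restrict e {..<N}) = (\<Sum>i\<in>{..<DIM('a)}. ?a (id i) *\<^sub>R e (id i))"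
      using FD by (simp add: grad_est_def \<gamma>_def scaling_def N)
    have "(norm (\<Sum>i\<in>{..<DIM('a)}. ?a (id i) *\<^sub>R e (id i)))\<^sup>2 = (\<Sum>i<DIM('a). (?a i)\<^sup>2)"
      by (subst norm_orthonormal_sum[OF orth]) auto
    then have "s / 8 * (norm (grad_est \<gamma> \<nu> N F x (restrict e {..<N})))\<^sup>2 - G x \<bullet> grad_est \<gamma> \<nu> N F x (restrict e {..<N})
       = (\<Sum>i<DIM('a). (?a i)\<^sup>2) / 8 - (\<Sum>i<DIM('a). ?a i * (G x \<bullet> e i))"
      unfolding est using FD by (simp add: s_def step_factor_def inner_sum_right)
    also have "\<dots> \<le> \<kappa> / 4 - (norm (G x))\<^sup>2 / 4"
      using \<Omega> FD by (intro orthonormal_descent[OF orth F L(1) \<nu> _ \<kappa>0]) (auto simp: \<nu>_def radius_def d_def)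
    finally show "(\<integral>u. s / 8 * (norm (grad_est \<gamma> \<nu> N F x u))\<^sup>2 - G x \<bullet> grad_est \<gamma> \<nu> N F x u \<partial>D)
        \<le> \<kappa> / 4 - (norm (G x))\<^sup>2 / 4"
      unfolding D' by (subst integral_return) (auto simp: space_PiM)
  next
    case GS
    interpret isotropic "std_gaussian :: 'a measure" by (rule isotropic_std_gaussian)
    define Z where "Z = 8 * real N + 24 * d + (d + 2) * (d + 4)"
    have Z: "0 < Z" unfolding Z_def using d1 by (intro add_pos_pos add_nonneg_pos mult_pos_pos) auto
    have "\<nu>\<^sup>2 = 2 * (N + 4.5 * d) / Z * (Omega5 DIM('a) \<mu> L \<epsilon> p)\<^sup>2"
      unfolding \<nu>_def radius_def using GS Z d1 by (simp add: power_mult_distrib d_def Z_def)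
    then have "Z * \<nu>\<^sup>2 = 2 * (N + 4.5 * d) * (Omega5 DIM('a) \<mu> L \<epsilon> p)\<^sup>2"
      using Z by simp
    moreover have "3 * (L\<^sup>2 * \<nu>\<^sup>2 * d * Z) = 3 * L\<^sup>2 * d * (Z * \<nu>\<^sup>2)" by simp
    ultimately have "3 * (L\<^sup>2 * \<nu>\<^sup>2 * d * Z) = 2 * (N + 4.5 * d) * (3 * L\<^sup>2 * (Omega5 DIM('a) \<mu> L \<epsilon> p)\<^sup>2 * d)"
      by (simp only: mult_ac)
    \<comment> \<open>The definition of the radius with \<open>Omega5\<close> eliminated: it says
      how much error \<open>\<kappa>\<close> allows.\<close>
    then have \<nu>2: "3 * (L\<^sup>2 * \<nu>\<^sup>2 * d * Z) = 8 * \<kappa> * (N + 4.5 * d)" unfolding \<Omega> by simp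
    have "(\<integral>u. (N / (N + 4.5 * real DIM('a))) / 8 * (norm (grad_est (1 / N) \<nu> N F x u))\<^sup>2
              - G x \<bullet> grad_est (1 / N) \<nu> N F x u \<partial>Pi\<^sub>M {..<N} (\<lambda>_. std_gaussian)) \<le> \<kappa> / 4 - (norm (G x))\<^sup>2 / 4"
    proof (rule smoothing_descent[OF F L(1) \<nu> N1, of 1, where B="L * \<nu> * sqrt d"])
      show "1 * (\<integral>u. taylor_rem F (G x) x \<nu> u * (v \<bullet> u) \<partial>std_gaussian) \<le> L * \<nu> * sqrt d" if v: "norm v = 1" for v
      proof -
        \<comment> \<open>The fourth moments \<open>d * (d + 2)\<close> and 3 leave
          \<open>d / c + c\<close> in the bias bound; \<open>c = sqrt d\<close> minimizes it, with
          value \<open>2 * sqrt d\<close>.\<close>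
        have "(\<integral>u. taylor_rem F (G x) x \<nu> u * (v \<bullet> u) \<partial>std_gaussian)
          \<le> L * \<nu> / 2 * ((d * (d + 2) / d - 2 / 3 * 3) / sqrt d + sqrt d * d / d)"
          using integral_taylor_rem_inner_le[OF F L(1) \<nu> v, of "sqrt d" x] d1
          unfolding std_gaussian_moments std_gaussian_inner_power_4[OF v] by (simp add: d_def)
        also have "(d * (d + 2) / d - 2 / 3 * 3) / sqrt d = sqrt d"
          using d1 by (simp add: real_div_sqrt)
        finally show ?thesis using d1 by simp
      qed
      show "(L * \<nu> * sqrt d)\<^sup>2 * (12 * real N + 36 * real DIM('a))
          + 2 * (L\<^sup>2 * \<nu>\<^sup>2 / 2 * (1\<^sup>2 * (\<integral>u. norm u ^ 6 \<partial>(std_gaussian :: 'a measure))))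
        \<le> 4 * \<kappa> * (real N + 4.5 * real DIM('a))"
      proof -
        have "(L * \<nu> * sqrt d)\<^sup>2 * (12 * real N + 36 * d) + 2 * (L\<^sup>2 * \<nu>\<^sup>2 / 2 * (d * (d + 2) * (d + 4)))
          = L\<^sup>2 * \<nu>\<^sup>2 * d * (12 * real N + 36 * d + (d + 2) * (d + 4))"
          using d1 by (simp add: power_mult_distrib algebra_simps)
        \<comment> \<open>The terms in \<open>N\<close> and \<open>d\<close> agree exactly; the
          inequality only gives away half of the sixth-moment term.\<close>
        also have "\<dots> \<le> L\<^sup>2 * \<nu>\<^sup>2 * d * (3 / 2 * Z)"
          using d1 by (intro mult_left_mono) (auto simp: Z_def)
        also have "\<dots> = 4 * \<kappa> * (N + 4.5 * d)" using \<nu>2 by simp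
        finally show ?thesis by (simp add: std_gaussian_moments d_def)
      qed
    qed (use L \<nu> d1 in \<open>auto simp: std_gaussian_moments d_def\<close>)
    then show "(\<integral>u. s / 8 * (norm (grad_est \<gamma> \<nu> N F x u))\<^sup>2 - G x \<bullet> grad_est \<gamma> \<nu> N F x u \<partial>D)
        \<le> \<kappa> / 4 - (norm (G x))\<^sup>2 / 4"
      using GS D by (simp add: s_def step_factor_def \<gamma>_def scaling_def direction_law_def)
  next
    case SS
    interpret isotropic "uniform_sphere :: 'a measure" by (rule isotropic_uniform_sphere)
    define Z where "Z = 8 * real N + 24 * d + d\<^sup>2"
    have Z: "0 < Z" unfolding Z_def using d1 by (intro add_pos_nonneg add_nonneg_pos) auto
    have "\<nu>\<^sup>2 = 2 * (N + 4.5 * d) * d / Z * (Omega5 DIM('a) \<mu> L \<epsilon> p)\<^sup>2"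
      unfolding \<nu>_def radius_def using SS Z d1 by (simp add: power_mult_distrib d_def Z_def)
    then have "Z * \<nu>\<^sup>2 = 2 * (N + 4.5 * d) * d * (Omega5 DIM('a) \<mu> L \<epsilon> p)\<^sup>2"
      using Z by simp
    moreover have "3 * (L\<^sup>2 * \<nu>\<^sup>2 * Z) = 3 * L\<^sup>2 * (Z * \<nu>\<^sup>2)" by simp
    ultimately have "3 * (L\<^sup>2 * \<nu>\<^sup>2 * Z) = 2 * (N + 4.5 * d) * (3 * L\<^sup>2 * (Omega5 DIM('a) \<mu> L \<epsilon> p)\<^sup>2 * d)"
      by (simp only: mult_ac)
    then have \<nu>2: "3 * (L\<^sup>2 * \<nu>\<^sup>2 * Z) = 8 * \<kappa> * (N + 4.5 * d)" unfolding \<Omega> by simp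
    have "(\<integral>u. (N / (N + 4.5 * real DIM('a))) / 8 * (norm (grad_est (d / N) \<nu> N F x u))\<^sup>2
              - G x \<bullet> grad_est (d / N) \<nu> N F x u \<partial>Pi\<^sub>M {..<N} (\<lambda>_. uniform_sphere)) \<le> \<kappa> / 4 - (norm (G x))\<^sup>2 / 4"
    proof (rule smoothing_descent[OF F L(1) \<nu> N1, where B="L * \<nu>"])
      show "d * (\<integral>u. taylor_rem F (G x) x \<nu> u * (v \<bullet> u) \<partial>uniform_sphere) \<le> L * \<nu>" if v: "norm v = 1" for v
      proof -
        \<comment> \<open>The fourth moment of \<open>v \<bullet> u\<close> enters with a negative
          sign and is discarded. On the sphere \<open>c = 1\<close> minimizes
          \<open>(1 / d) / c + c / d\<close>, and the scaling \<open>d\<close> turns the resulting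
          \<open>L * \<nu> / d\<close> into \<open>L * \<nu>\<close>.\<close>
        have "0 \<le> (\<integral>u. (v \<bullet> u) ^ 4 \<partial>uniform_sphere)" by simp
        then have "L * \<nu> / 2 * ((1 / d - 2 / 3 * (\<integral>u. (v \<bullet> u) ^ 4 \<partial>uniform_sphere)) / 1 + 1 * 1 / d)
            \<le> L * \<nu> / 2 * (1 / d + 1 / d)"
          using L \<nu> by (intro mult_left_mono) auto
        moreover have "(\<integral>u. taylor_rem F (G x) x \<nu> u * (v \<bullet> u) \<partial>uniform_sphere)
          \<le> L * \<nu> / 2 * ((1 / d - 2 / 3 * (\<integral>u. (v \<bullet> u) ^ 4 \<partial>uniform_sphere)) / 1 + 1 * 1 / d)"
          using integral_taylor_rem_inner_le[OF F L(1) \<nu> v, of 1 x]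
          unfolding uniform_sphere_norm_power by (simp add: d_def)
        ultimately have "(\<integral>u. taylor_rem F (G x) x \<nu> u * (v \<bullet> u) \<partial>uniform_sphere) \<le> L * \<nu> / 2 * (1 / d + 1 / d)"
          by (rule order_trans[rotated])
        then show ?thesis using d1 by (simp add: field_simps)
      qed
      show "(L * \<nu>)\<^sup>2 * (12 * real N + 36 * real DIM('a))
          + 2 * (L\<^sup>2 * \<nu>\<^sup>2 / 2 * (d\<^sup>2 * (\<integral>u. norm u ^ 6 \<partial>(uniform_sphere :: 'a measure))))
        \<le> 4 * \<kappa> * (real N + 4.5 * real DIM('a))"
      proof -
        have "(L * \<nu>)\<^sup>2 * (12 * real N + 36 * d) + 2 * (L\<^sup>2 * \<nu>\<^sup>2 / 2 * (d\<^sup>2 * 1))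
          = L\<^sup>2 * \<nu>\<^sup>2 * (12 * real N + 36 * d + d\<^sup>2)"
          by (simp add: power_mult_distrib algebra_simps)
        also have "\<dots> \<le> L\<^sup>2 * \<nu>\<^sup>2 * (3 / 2 * Z)"
          by (intro mult_left_mono) (auto simp: Z_def)
        also have "\<dots> = 4 * \<kappa> * (N + 4.5 * d)" using \<nu>2 by simp
        finally show ?thesis by (simp add: uniform_sphere_norm_power d_def)
      qed
    qed (use L \<nu> d1 in \<open>auto simp: uniform_sphere_norm_power d_def power2_eq_square[of "real DIM('a)"]\<close>)
    then show "(\<integral>u. s / 8 * (norm (grad_est \<gamma> \<nu> N F x u))\<^sup>2 - G x \<bullet> grad_est \<gamma> \<nu> N F x u \<partial>D)
        \<le> \<kappa> / 4 - (norm (G x))\<^sup>2 / 4"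
      using SS D by (simp add: s_def step_factor_def \<gamma>_def scaling_def direction_law_def d_def)
  next
    case RC
    let ?W = "without_replacement DIM('a) N"
    obtain e where e: "bij_betw e {..<DIM('a)} (Basis :: 'a set)"
      and D': "D = distr ?W (tuple_space N) (\<lambda>J. \<lambda>j\<in>{..<N}. e (J j))"
      using RC D by (auto simp: direction_law_def)
    have N: "N \<le> DIM('a)" using m RC by (simp add: admissible_def)
    have orth: "e i \<bullet> e j = (if i = j then 1 else 0)" if "i < DIM('a)" "j < DIM('a)" for i j
      using that bij_betwE[OF e] bij_betw_imp_inj_on[OF e] by (auto simp: inner_Basis inj_on_def)
    have T [measurable]: "(\<lambda>J. \<lambda>j\<in>{..<N}. e (J j)) \<in> measurable ?W (tuple_space N)"
      by (rule measurable_without_replacement) (simp add: space_PiM)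
    have restr: "grad_est \<gamma> \<nu> N F x (\<lambda>j\<in>{..<N}. e (J j)) = grad_est \<gamma> \<nu> N F x (\<lambda>j. e (J j))" for J
      by (rule grad_est_cong) simp
    have "(\<integral>u. s / 8 * (norm (grad_est \<gamma> \<nu> N F x u))\<^sup>2 - G x \<bullet> grad_est \<gamma> \<nu> N F x u \<partial>D)
      = (\<integral>J. s / 8 * (norm (grad_est \<gamma> \<nu> N F x (\<lambda>j. e (J j))))\<^sup>2 - G x \<bullet> grad_est \<gamma> \<nu> N F x (\<lambda>j. e (J j)) \<partial>?W)"
      unfolding D' by (subst integral_distr) (auto simp: restr)
    also have "\<dots> = (\<Sum>i<DIM('a). ((F (x + \<nu> *\<^sub>R e i) - F x) / \<nu>)\<^sup>2) / 8
        - (\<Sum>i<DIM('a). (F (x + \<nu> *\<^sub>R e i) - F x) / \<nu> * (G x \<bullet> e i))"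
      using orthonormal_without_replacement[OF orth N1 N, where F=F and x=x and \<nu>=\<nu> and g="G x"] RC
      by (simp add: s_def \<gamma>_def step_factor_def scaling_def)
    also have "\<dots> \<le> \<kappa> / 4 - (norm (G x))\<^sup>2 / 4"
      using \<Omega> RC by (intro orthonormal_descent[OF orth F L(1) \<nu> _ \<kappa>0]) (auto simp: \<nu>_def radius_def d_def)
    finally show "(\<integral>u. s / 8 * (norm (grad_est \<gamma> \<nu> N F x u))\<^sup>2 - G x \<bullet> grad_est \<gamma> \<nu> N F x u \<partial>D)
        \<le> \<kappa> / 4 - (norm (G x))\<^sup>2 / 4" .
  next
    case RS
    let ?W = "without_replacement DIM('a) N" and ?T = "\<lambda>(b, J). \<lambda>j\<in>{..<N}. b (J j)"
    obtain Q where Q: "prob_space Q" "sets Q = sets (tuple_space DIM('a))"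
      "AE b in Q. \<forall>i<DIM('a). \<forall>j<DIM('a). b i \<bullet> b j = (if i = j then 1 else (0::real))"
      and D': "D = distr (Q \<Otimes>\<^sub>M ?W) (tuple_space N) ?T"
      using RS D by (auto simp: direction_law_def)
    have N: "N \<le> DIM('a)" using m RS by (simp add: admissible_def)
    interpret Q: prob_space Q by (rule Q)
    interpret W: prob_space ?W using N by (rule prob_space_without_replacement)
    interpret pair_prob_space Q ?W ..
    note T [measurable] = measurable_select[OF Q(1,2) N]
    let ?h = "\<lambda>u. s / 8 * (norm (grad_est \<gamma> \<nu> N F x u))\<^sup>2 - G x \<bullet> grad_est \<gamma> \<nu> N F x u"
    have \<gamma>0: "0 \<le> \<gamma>" by (simp add: \<gamma>_def scaling_def RS)
    note int = integrable_grad_est[OF direction_law_prob_space[OF m D] direction_law_sets[OF m D]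
        direction_law_integrable[OF m D] F L(1) \<nu> \<gamma>0, of x]
    have int_D: "integrable D ?h" using int by auto
    have int_T: "integrable (Q \<Otimes>\<^sub>M ?W) (\<lambda>p. ?h (?T p))"
      using int_D unfolding D' by (subst (asm) integrable_distr_eq) auto
    have "(\<integral>u. ?h u \<partial>D) = (\<integral>p. ?h (?T p) \<partial>(Q \<Otimes>\<^sub>M ?W))"
      unfolding D' by (subst integral_distr) auto
    \<comment> \<open>Averaging over the index tuple first gives the bound for almost every fixed
      orthonormal basis, so the law of the basis does not affect it.\<close>
    also have "\<dots> = (\<integral>b. \<integral>J. ?h (?T (b, J)) \<partial>?W \<partial>Q)"
      by (rule integral_fst'[OF int_T, symmetric])
    also have "\<dots> \<le> (\<integral>b. \<kappa> / 4 - (norm (G x))\<^sup>2 / 4 \<partial>Q)"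
    proof (rule integral_mono_AE)
      show "integrable Q (\<lambda>b. \<integral>J. ?h (?T (b, J)) \<partial>?W)" by (rule integrable_fst'[OF int_T])
      show "AE b in Q. (\<integral>J. ?h (?T (b, J)) \<partial>?W) \<le> \<kappa> / 4 - (norm (G x))\<^sup>2 / 4"
        using Q(3)
      proof eventually_elim
        case (elim b)
        then have orth: "b i \<bullet> b j = (if i = j then 1 else 0)" if "i < DIM('a)" "j < DIM('a)" for i j
          using that by blast
        have restr: "grad_est \<gamma> \<nu> N F x (\<lambda>j\<in>{..<N}. b (J j)) = grad_est \<gamma> \<nu> N F x (\<lambda>j. b (J j))" for J
          by (rule grad_est_cong) simp
        have "(\<integral>J. ?h (?T (b, J)) \<partial>?W) = (\<integral>J. ?h (\<lambda>j. b (J j)) \<partial>?W)"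
          by (simp add: restr)
        also have "\<dots> = (\<Sum>i<DIM('a). ((F (x + \<nu> *\<^sub>R b i) - F x) / \<nu>)\<^sup>2) / 8
            - (\<Sum>i<DIM('a). (F (x + \<nu> *\<^sub>R b i) - F x) / \<nu> * (G x \<bullet> b i))"
          using orthonormal_without_replacement[OF orth N1 N, where F=F and x=x and \<nu>=\<nu> and g="G x"] RS
          by (simp add: s_def \<gamma>_def step_factor_def scaling_def)
        also have "\<dots> \<le> \<kappa> / 4 - (norm (G x))\<^sup>2 / 4"
          using \<Omega> RS by (intro orthonormal_descent[OF orth F L(1) \<nu> _ \<kappa>0]) (auto simp: \<nu>_def radius_def d_def)
        finally show ?case .
      qed
    qed auto
    finally show "(\<integral>u. ?h u \<partial>D) \<le> \<kappa> / 4 - (norm (G x))\<^sup>2 / 4" by (simp add: Q.prob_space)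
  qed
qed

subsection \<open>Freezing the past\<close>

text \<open>Used twice per iteration: for the directions relative to the past, and for the whole
  sample sequence relative to the past enlarged by the directions.\<close>

locale fresh_variable = prob_space M for M :: "'w measure" +
  fixes G :: "'w measure" and S :: "'s measure" and Z :: "'w \<Rightarrow> 's" and Q :: "'s measure"
  assumes subalg: "subalgebra M G"
    and Z_meas: "Z \<in> measurable M S"
    and fresh: "indep_of_algebra M G S Z"
    and Q: "distr M S Z = Q"
begin

lemma prob_space_Q: "prob_space Q"
  unfolding Q[symmetric] using Z_meas by (rule prob_space_distr)

lemma sets_Q [measurable_cong]: "sets Q = sets S"
  unfolding Q[symmetric] by simp

lemma id_measurable: "(\<lambda>\<omega>. \<omega>) \<in> measurable M G"
  using subalg by (auto simp: measurable_def subalgebra_def Int_absorb2 sets.sets_into_space dest: sets.sets_into_space)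

lemma pair_measurable: "(\<lambda>\<omega>. (\<omega>, Z \<omega>)) \<in> measurable M (G \<Otimes>\<^sub>M S)"
  using id_measurable Z_meas by measurable

lemma sets_pair [measurable_cong]: "sets (restr_to_subalg M G \<Otimes>\<^sub>M Q) = sets (G \<Otimes>\<^sub>M S)"
  by (intro sets_pair_measure_cong sets_restr_to_subalg subalg sets_Q)

lemma pair_sigma_finite: "pair_sigma_finite (restr_to_subalg M G) Q"
proof -
  interpret Q: prob_space Q by (rule prob_space_Q)
  interpret G: prob_space "restr_to_subalg M G" using subalg prob_space_axioms by (intro prob_space_restr_to_subalg)
  show ?thesis ..
qed

text \<open>The outcome itself, seen through the coarser \<open>\<sigma>\<close>-algebra
  \<open>G\<close>, serves as first component. Independence is then a product law on rectangles, and
  a \<open>G\<close>-measurable quantity need not be written as a function of some generating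
  variable.\<close>

lemma distr_pair: "distr M (G \<Otimes>\<^sub>M S) (\<lambda>\<omega>. (\<omega>, Z \<omega>)) = restr_to_subalg M G \<Otimes>\<^sub>M Q"
proof -
  interpret pair_sigma_finite "restr_to_subalg M G" Q by (rule pair_sigma_finite)
  have sp: "space G = space M" "sets G \<subseteq> sets M" using subalg by (auto simp: subalgebra_def)
  have "indep_set (sigma_sets (space M) {Z -` A \<inter> space M | A. A \<in> sets S}) (sets G)"
    using fresh by (simp add: indep_of_algebra_def sets_vimage_algebra)
  note indep = indep_setD[OF this]
  have "restr_to_subalg M G \<Otimes>\<^sub>M Q = distr M (G \<Otimes>\<^sub>M S) (\<lambda>\<omega>. (\<omega>, Z \<omega>))"
  proof (rule pair_measure_eqI)
    fix A B assume "A \<in> sets (restr_to_subalg M G)" "B \<in> sets Q"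
    then have A: "A \<in> sets G" and B: "B \<in> sets S"
      by (simp_all add: sets_restr_to_subalg[OF subalg] sets_Q)
    have AM: "A \<subseteq> space M" "A \<in> sets M" using sets.sets_into_space[OF A] A sp by auto
    have "Z -` B \<inter> space M \<in> sigma_sets (space M) {Z -` A \<inter> space M | A. A \<in> sets S}"
      using B by blast
    then have "prob ((Z -` B \<inter> space M) \<inter> A) = prob (Z -` B \<inter> space M) * prob A"
      using A by (rule indep)
    moreover have "(\<lambda>\<omega>. (\<omega>, Z \<omega>)) -` (A \<times> B) \<inter> space M = (Z -` B \<inter> space M) \<inter> A"
      using AM by auto
    ultimately show "emeasure (restr_to_subalg M G) A * emeasure Q B
        = emeasure (distr M (G \<Otimes>\<^sub>M S) (\<lambda>\<omega>. (\<omega>, Z \<omega>))) (A \<times> B)"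
      using A B pair_measurable Z_meas
      by (simp add: emeasure_distr emeasure_restr_to_subalg[OF subalg A] Q[symmetric] emeasure_eq_measure
          ennreal_mult[symmetric] mult.commute)
  qed (simp_all add: M1.sigma_finite_measure_axioms M2.sigma_finite_measure_axioms sets_pair)
  then show ?thesis by simp
qed

text \<open>Tonelli for the product law of outcome and fresh variable. The nonnegative version
  establishes finiteness before any integrability is known.\<close>

lemma nn_integral_freeze:
  assumes [measurable]: "(\<lambda>p. h (fst p) (snd p)) \<in> borel_measurable (G \<Otimes>\<^sub>M S)"
  shows "(\<integral>\<^sup>+\<omega>. h \<omega> (Z \<omega>) \<partial>M) = (\<integral>\<^sup>+\<omega>. \<integral>\<^sup>+z. h \<omega> z \<partial>Q \<partial>M)"
    and "(\<lambda>\<omega>. \<integral>\<^sup>+z. h \<omega> z \<partial>Q) \<in> borel_measurable G"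
proof -
  interpret Q: prob_space Q by (rule prob_space_Q)
  have h: "(\<lambda>p. h (fst p) (snd p)) \<in> borel_measurable (restr_to_subalg M G \<Otimes>\<^sub>M Q)"
    using assms by (simp add: measurable_cong_sets[OF sets_pair refl])
  have h2: "(\<lambda>p. h (fst p) (snd p)) \<in> borel_measurable (G \<Otimes>\<^sub>M Q)"
    by measurable
  show meas: "(\<lambda>\<omega>. \<integral>\<^sup>+z. h \<omega> z \<partial>Q) \<in> borel_measurable G"
    using Q.borel_measurable_nn_integral_fst[OF h2] by simp
  have "(\<integral>\<^sup>+\<omega>. h \<omega> (Z \<omega>) \<partial>M) = (\<integral>\<^sup>+p. h (fst p) (snd p) \<partial>distr M (G \<Otimes>\<^sub>M S) (\<lambda>\<omega>. (\<omega>, Z \<omega>)))"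
    by (subst nn_integral_distr[OF pair_measurable]) auto
  also have "\<dots> = (\<integral>\<^sup>+\<omega>. \<integral>\<^sup>+z. h \<omega> z \<partial>Q \<partial>restr_to_subalg M G)"
    unfolding distr_pair using Q.nn_integral_fst[OF h] by simp
  also have "\<dots> = (\<integral>\<^sup>+\<omega>. \<integral>\<^sup>+z. h \<omega> z \<partial>Q \<partial>M)"
    by (rule nn_integral_subalgebra2[OF subalg meas])
  finally show "(\<integral>\<^sup>+\<omega>. h \<omega> (Z \<omega>) \<partial>M) = (\<integral>\<^sup>+\<omega>. \<integral>\<^sup>+z. h \<omega> z \<partial>Q \<partial>M)" .
qed

lemma integral_freeze:
  fixes h :: "'w \<Rightarrow> 's \<Rightarrow> 'b::{banach, second_countable_topology}"
  assumes h [measurable]: "(\<lambda>p. h (fst p) (snd p)) \<in> borel_measurable (G \<Otimes>\<^sub>M S)"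
    and int: "integrable M (\<lambda>\<omega>. h \<omega> (Z \<omega>))"
  shows "(\<integral>\<omega>. h \<omega> (Z \<omega>) \<partial>M) = (\<integral>\<omega>. \<integral>z. h \<omega> z \<partial>Q \<partial>M)"
    and "integrable M (\<lambda>\<omega>. \<integral>z. h \<omega> z \<partial>Q)"
    and "(\<lambda>\<omega>. \<integral>z. h \<omega> z \<partial>Q) \<in> borel_measurable G"
proof -
  interpret Q: prob_space Q by (rule prob_space_Q)
  interpret pair_sigma_finite "restr_to_subalg M G" Q by (rule pair_sigma_finite)
  have h2: "(\<lambda>p. h (fst p) (snd p)) \<in> borel_measurable (G \<Otimes>\<^sub>M Q)" by measurable
  show meas: "(\<lambda>\<omega>. \<integral>z. h \<omega> z \<partial>Q) \<in> borel_measurable G"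
    using Q.borel_measurable_lebesgue_integral[of "\<lambda>\<omega> z. h \<omega> z" G] h2 by (simp add: case_prod_beta)
  have int': "integrable (restr_to_subalg M G \<Otimes>\<^sub>M Q) (\<lambda>p. h (fst p) (snd p))"
    unfolding distr_pair[symmetric] using int by (subst integrable_distr_eq[OF pair_measurable]) auto
  show "integrable M (\<lambda>\<omega>. \<integral>z. h \<omega> z \<partial>Q)"
    using integrable_fst'[OF int'] by (intro integrable_from_subalg[OF subalg]) simp
  have "(\<integral>\<omega>. h \<omega> (Z \<omega>) \<partial>M) = (\<integral>p. h (fst p) (snd p) \<partial>distr M (G \<Otimes>\<^sub>M S) (\<lambda>\<omega>. (\<omega>, Z \<omega>)))"
    by (subst integral_distr[OF pair_measurable]) auto
  also have "\<dots> = (\<integral>\<omega>. \<integral>z. h \<omega> z \<partial>Q \<partial>restr_to_subalg M G)"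
    unfolding distr_pair using integral_fst'[OF int'] by simp
  also have "\<dots> = (\<integral>\<omega>. \<integral>z. h \<omega> z \<partial>Q \<partial>M)"
    by (rule integral_subalgebra2[OF subalg meas])
  finally show "(\<integral>\<omega>. h \<omega> (Z \<omega>) \<partial>M) = (\<integral>\<omega>. \<integral>z. h \<omega> z \<partial>Q \<partial>M)" .
qed

lemma sigma_finite_subalgebra_G: "sigma_finite_subalgebra M G"
  using subalg finite_measure_axioms
  by (intro finite_measure_subalgebra_is_sigma_finite finite_measure_subalgebra.intro
      finite_measure_subalgebra_axioms.intro)

text \<open>The inner integral is \<open>G\<close>-measurable and has the right integral over every
  \<open>A\<close> in \<open>G\<close>: the indicator of \<open>A\<close> depends on the outcome
  through \<open>G\<close> and may be frozen along with \<open>h\<close>.\<close>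

lemma real_cond_exp_freeze:
  fixes h :: "'w \<Rightarrow> 's \<Rightarrow> real"
  assumes h [measurable]: "(\<lambda>p. h (fst p) (snd p)) \<in> borel_measurable (G \<Otimes>\<^sub>M S)"
    and int: "integrable M (\<lambda>\<omega>. h \<omega> (Z \<omega>))"
  shows "AE \<omega> in M. real_cond_exp M G (\<lambda>\<omega>. h \<omega> (Z \<omega>)) \<omega> = (\<integral>z. h \<omega> z \<partial>Q)"
proof -
  interpret sigma_finite_subalgebra M G by (rule sigma_finite_subalgebra_G)
  note fr = integral_freeze[OF h int]
  show ?thesis
  proof (rule real_cond_exp_charact[OF _ int fr(2,3)])
    fix A assume A [measurable]: "A \<in> sets G"
    then have "A \<in> sets M" using subalg by (auto simp: subalgebra_def)
    then have intA: "integrable M (\<lambda>\<omega>. indicator A \<omega> *\<^sub>R h \<omega> (Z \<omega>))"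
      using int by (rule integrable_mult_indicator)
    have "(\<integral>\<omega>. indicator A \<omega> *\<^sub>R h \<omega> (Z \<omega>) \<partial>M) = (\<integral>\<omega>. \<integral>z. indicator A \<omega> *\<^sub>R h \<omega> z \<partial>Q \<partial>M)"
      using h intA by (intro integral_freeze(1)[where h="\<lambda>\<omega> z. indicator A \<omega> *\<^sub>R h \<omega> z"]) measurable
    then show "(\<integral>\<omega>\<in>A. h \<omega> (Z \<omega>) \<partial>M) = (\<integral>\<omega>\<in>A. (\<integral>z. h \<omega> z \<partial>Q) \<partial>M)"
      by (simp add: set_lebesgue_integral_def)
  qed
qed

end

subsection \<open>Sample size conditions\<close>

text \<open>
  For the third condition, \<open>V / n \<le> V * (Y / W)\<close> wherever the conditional expectation \<open>W\<close> of \<open>V\<close>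
  is positive, and \<open>V\<close> vanishes almost everywhere on the rest.
\<close>

lemma (in sigma_finite_subalgebra) integral_ratio_le:
  fixes V Y :: "'a \<Rightarrow> real" and n :: "'a \<Rightarrow> real"
  assumes V: "integrable M V" "\<And>\<omega>. 0 \<le> V \<omega>" and Y: "integrable M Y" "\<And>\<omega>. 0 \<le> Y \<omega>"
    and n [measurable]: "n \<in> borel_measurable M" and n1: "\<And>\<omega>. \<omega> \<in> space M \<Longrightarrow> 1 \<le> n \<omega>"
    and cond: "AE \<omega> in M. real_cond_exp M F V \<omega> / n \<omega> \<le> c * real_cond_exp M F Y \<omega>" and c: "0 \<le> c"
  shows "(\<integral>\<omega>. V \<omega> / n \<omega> \<partial>M) \<le> c * (\<integral>\<omega>. Y \<omega> \<partial>M)"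
proof -
  note [measurable] = borel_measurable_integrable[OF V(1)] borel_measurable_integrable[OF Y(1)]
  define W where "W \<omega> = real_cond_exp M F V \<omega>" for \<omega>
  \<comment> \<open>Truncation at 0 makes the bound nonnegative everywhere and changes the
    conditional expectation on a null set only.\<close>
  define X where "X \<omega> = max 0 (real_cond_exp M F Y \<omega>)" for \<omega>
  have [measurable]: "W \<in> borel_measurable F" "X \<in> borel_measurable F"
    unfolding W_def X_def by measurable
  note [measurable] = this[THEN measurable_from_subalg[OF subalg]]
  have W0: "AE \<omega> in M. 0 \<le> W \<omega>" unfolding W_def using V by (intro real_cond_exp_pos) auto
  have X: "AE \<omega> in M. X \<omega> = real_cond_exp M F Y \<omega>"
    using real_cond_exp_pos[of Y] Y by (auto simp: X_def)
  have X_int: "integrable M X" "(\<integral>\<omega>. X \<omega> \<partial>M) = (\<integral>\<omega>. Y \<omega> \<partial>M)"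
    using integrable_cong_AE[OF _ _ X] integral_cong_AE[OF _ _ X] real_cond_exp_int[OF Y(1)] by auto
  have W_int: "integrable M W" unfolding W_def by (rule real_cond_exp_int(1)[OF V(1)])
  \<comment> \<open>A bound for \<open>1 / n\<close> that is measurable with respect to
    \<open>F\<close>, unlike \<open>n\<close> in general, and can therefore be moved through the
    conditional expectation.\<close>
  define r where "r \<omega> = (if 0 < W \<omega> then c * X \<omega> / W \<omega> else 0)" for \<omega>
  have r_meas [measurable]: "r \<in> borel_measurable F" unfolding r_def by measurable
  note [measurable] = measurable_from_subalg[OF subalg r_meas]
  have X0: "0 \<le> X \<omega>" for \<omega> by (simp add: X_def)
  have r0: "0 \<le> r \<omega>" for \<omega> using c by (simp add: r_def X_def)
  define A where "A = {\<omega> \<in> space M. W \<omega> \<le> 0}"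
  have AF: "A \<in> sets F"
  proof -
    have A_eq: "A = {\<omega> \<in> space F. W \<omega> \<le> 0}" using subalg by (simp add: A_def subalgebra_def)
    show ?thesis unfolding A_eq by measurable
  qed
  \<comment> \<open>On the \<open>F\<close>-measurable set \<open>A\<close> the integrals of
    \<open>V\<close> and \<open>W\<close> agree and the latter is 0; the nonnegative
    \<open>V\<close> must vanish there.\<close>
  have V_null: "AE \<omega> in M. \<omega> \<in> A \<longrightarrow> V \<omega> = 0"
  proof -
    have AM [measurable]: "A \<in> sets M" unfolding A_def by measurable
    have intA: "integrable M (\<lambda>\<omega>. indicator A \<omega> * V \<omega>)"
      using integrable_mult_indicator[OF AM V(1)] by simp
    have "(\<integral>\<omega>. indicator A \<omega> * V \<omega> \<partial>M) = (\<integral>\<omega>. indicator A \<omega> * W \<omega> \<partial>M)"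
      using real_cond_exp_intA[OF V(1) AF] by (simp add: set_lebesgue_integral_def W_def)
    also have "\<dots> = (\<integral>\<omega>. 0 \<partial>M)"
      using W0 by (intro integral_cong_AE) (auto simp: A_def indicator_def)
    finally have "AE \<omega> in M. indicator A \<omega> * V \<omega> = 0"
      using integral_nonneg_eq_0_iff_AE[OF intA] V by simp
    then show ?thesis by eventually_elim (auto simp: indicator_def)
  qed
  have le: "AE \<omega> in M. V \<omega> / n \<omega> \<le> r \<omega> * V \<omega>"
    using cond X V_null AE_space
  proof eventually_elim
    case (elim \<omega>)
    show ?case
    proof (cases "0 < W \<omega>")
      case True
      have "W \<omega> / n \<omega> \<le> c * X \<omega>" using elim by (simp add: W_def)
      then have "1 / n \<omega> \<le> c * X \<omega> / W \<omega>" using True by (simp add: field_simps)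
      then have "(1 / n \<omega>) * V \<omega> \<le> (c * X \<omega> / W \<omega>) * V \<omega>" using V by (intro mult_right_mono) auto
      then show ?thesis using True by (simp add: r_def)
    next
      case False
      then show ?thesis using elim by (auto simp: A_def r_def)
    qed
  qed
  \<comment> \<open>The factor \<open>r\<close> may be unbounded, so integrability of
    \<open>r * V\<close> is a result of this computation; hence the nonnegative conditional
    expectation.\<close>
  have "(\<integral>\<^sup>+\<omega>. ennreal (r \<omega> * V \<omega>) \<partial>M) = (\<integral>\<^sup>+\<omega>. ennreal (r \<omega>) * nn_cond_exp M F V \<omega> \<partial>M)"
    using nn_cond_exp_intg[of "\<lambda>\<omega>. ennreal (r \<omega>)" "\<lambda>\<omega>. ennreal (V \<omega>)"] r0 V by (simp add: ennreal_mult)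
  also have "\<dots> = (\<integral>\<^sup>+\<omega>. ennreal (r \<omega>) * ennreal (W \<omega>) \<partial>M)"
  proof (rule nn_integral_cong_AE)
    have "AE \<omega> in M. nn_cond_exp M F V \<omega> < \<infinity>"
    proof (rule nn_integral_PInf_AE[THEN AE_mp])
      have "(\<integral>\<^sup>+\<omega>. nn_cond_exp M F V \<omega> \<partial>M) = (\<integral>\<^sup>+\<omega>. ennreal (V \<omega>) \<partial>M)"
        using nn_cond_exp_intg[of "\<lambda>_. 1" "\<lambda>\<omega>. ennreal (V \<omega>)"] by simp
      also have "\<dots> < \<infinity>" using V integrableD(2)[OF V(1)] by (simp add: top.not_eq_extremum)
      finally show "(\<integral>\<^sup>+\<omega>. nn_cond_exp M F V \<omega> \<partial>M) \<noteq> \<infinity>" by simp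
    qed (auto simp: less_top)
    moreover have "AE \<omega> in M. nn_cond_exp M F (\<lambda>\<omega>. ennreal (- V \<omega>)) \<omega> = 0"
    proof -
      have "AE \<omega> in M. nn_cond_exp M F (\<lambda>\<omega>. ennreal (- V \<omega>)) \<omega> = nn_cond_exp M F (\<lambda>_. 0) \<omega>"
        using V by (intro nn_cond_exp_cong) (auto simp: ennreal_neg)
      moreover have "AE \<omega> in M. nn_cond_exp M F (\<lambda>_. 0) \<omega> = 0"
        using nn_cond_exp_F_meas[of "\<lambda>_. 0"] by simp
      ultimately show ?thesis by eventually_elim simp
    qed
    ultimately show "AE \<omega> in M. ennreal (r \<omega>) * nn_cond_exp M F V \<omega> = ennreal (r \<omega>) * ennreal (W \<omega>)"
      by eventually_elim (simp add: W_def real_cond_exp_def)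
  qed
  also have "\<dots> \<le> (\<integral>\<^sup>+\<omega>. ennreal (c * X \<omega>) \<partial>M)"
    using c by (intro nn_integral_mono) (auto simp: r_def X_def ennreal_mult[symmetric] ennreal_neg)
  also have "\<dots> = ennreal (c * (\<integral>\<omega>. Y \<omega> \<partial>M))"
    using X_int c X0 by (subst nn_integral_eq_integral) auto
  finally have bound: "(\<integral>\<^sup>+\<omega>. ennreal (r \<omega> * V \<omega>) \<partial>M) \<le> ennreal (c * (\<integral>\<omega>. Y \<omega> \<partial>M))" .
  have rV_int: "integrable M (\<lambda>\<omega>. r \<omega> * V \<omega>)"
    using r0 V by (intro integrableI_nonneg) (auto intro: le_less_trans[OF bound])
  have Vn_int: "integrable M (\<lambda>\<omega>. V \<omega> / n \<omega>)"
  proof (rule Bochner_Integration.integrable_bound[OF rV_int])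
    show "AE \<omega> in M. norm (V \<omega> / n \<omega>) \<le> norm (r \<omega> * V \<omega>)"
      using le AE_space
    proof eventually_elim
      case (elim \<omega>)
      then show ?case using V(2)[of \<omega>] r0[of \<omega>] n1[of \<omega>] by (simp add: abs_mult)
    qed
  qed measurable
  have "(\<integral>\<omega>. V \<omega> / n \<omega> \<partial>M) \<le> (\<integral>\<omega>. r \<omega> * V \<omega> \<partial>M)"
    by (rule integral_mono_AE[OF Vn_int rV_int le])
  also have "\<dots> \<le> c * (\<integral>\<omega>. Y \<omega> \<partial>M)"
  proof -
    have "ennreal (\<integral>\<omega>. r \<omega> * V \<omega> \<partial>M) \<le> ennreal (c * (\<integral>\<omega>. Y \<omega> \<partial>M))"
      using bound rV_int r0 V by (subst nn_integral_eq_integral[symmetric]) auto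
    moreover have "0 \<le> c * (\<integral>\<omega>. Y \<omega> \<partial>M)" using c Y by (intro mult_nonneg_nonneg integral_nonneg) auto
    ultimately show ?thesis by (simp add: ennreal_le_iff)
  qed
  finally show ?thesis .
qed

subsection \<open>Stochastic objectives\<close>

text \<open>Joint measurability of a Caratheodory function: the first argument is approximated by
  simple functions, and for finitely many values only measurability in the second argument
  matters.\<close>

lemma measurable_continuous_in_fst:
  fixes f :: "'a::euclidean_space \<Rightarrow> 'z \<Rightarrow> real"
  assumes meas: "\<And>y. f y \<in> borel_measurable P"
    and cont: "\<And>z. z \<in> space P \<Longrightarrow> continuous_on UNIV (\<lambda>y. f y z)"
  shows "(\<lambda>p. f (fst p) (snd p)) \<in> borel_measurable (borel \<Otimes>\<^sub>M P)"
proof -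
  obtain s where s: "\<And>i. simple_function borel (s i)" "\<And>y. (\<lambda>i. s i y) \<longlonglongrightarrow> (y::'a)"
    using borel_measurable_implies_sequence_metric[of "\<lambda>y::'a. y" borel 0] by auto
  show ?thesis
  proof (rule borel_measurable_LIMSEQ_real)
    fix p :: "'a \<times> 'z" assume p: "p \<in> space (borel \<Otimes>\<^sub>M P)"
    then have "isCont (\<lambda>y. f y (snd p)) (fst p)"
      using cont[of "snd p"] by (auto simp: space_pair_measure continuous_on_eq_continuous_at)
    then show "(\<lambda>i. f (s i (fst p)) (snd p)) \<longlonglongrightarrow> f (fst p) (snd p)"
      using s(2)[of "fst p"] by (rule isCont_tendsto_compose)
  next
    fix i
    have fin: "finite (range (s i))" using simple_functionD(1)[OF s(1)[of i]] by simp
    have "s i \<in> measurable borel (count_space (range (s i)))"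
    proof -
      have "s i -` {a} \<inter> space borel \<in> sets borel" for a
        by (rule measurable_sets[OF measurable_simple_function[OF s(1)[of i]]]) simp
      then show ?thesis using fin by (auto simp: measurable_count_space_eq2)
    qed
    then show "(\<lambda>p. f (s i (fst p)) (snd p)) \<in> borel_measurable (borel \<Otimes>\<^sub>M P)"
      using fin meas
      by (intro measurable_compose_countable'[where f="\<lambda>y p. f y (snd p)" and g="\<lambda>p. s i (fst p)" and I="range (s i)"])
         (auto intro: countable_finite)
  qed
qed

locale stoch_objective =
  fixes P :: "'z measure" and f :: "'a::euclidean_space \<Rightarrow> 'z \<Rightarrow> real" and F :: "'a \<Rightarrow> real"
    and gradf :: "'a \<Rightarrow> 'z \<Rightarrow> 'a" and gradF :: "'a \<Rightarrow> 'a" and Lf LF \<beta>\<^sub>1 \<beta>\<^sub>2 :: real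
  assumes P: "prob_space P"
    and f_int: "\<And>y. integrable P (f y)"
    and F_def: "\<And>y. F y = (\<integral>z. f y z \<partial>P)"
    and F_grad: "\<And>y. GDERIV F y :> gradF y"
    and f_grad: "\<And>y z. z \<in> space P \<Longrightarrow> GDERIV (\<lambda>v. f v z) y :> gradf y z"
    and f_lip: "\<And>z. z \<in> space P \<Longrightarrow> Lf-lipschitz_on UNIV (\<lambda>v. gradf v z)"
    and F_lip: "LF-lipschitz_on UNIV gradF" and LF: "0 < LF" "LF \<le> Lf"
    and \<beta>: "0 \<le> \<beta>\<^sub>1" "0 \<le> \<beta>\<^sub>2"
    and noise: "\<And>y. (\<integral>\<^sup>+z. ennreal ((norm (gradf y z - gradF y))\<^sup>2) \<partial>P)
                  \<le> ennreal (\<beta>\<^sub>1 * (norm (gradF y))\<^sup>2 + \<beta>\<^sub>2)"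
begin

sublocale P: prob_space P by (rule P)

lemma F_meas [measurable]: "F \<in> borel_measurable borel"
  by (rule borel_measurable_continuous_onI[OF GDERIV_imp_continuous_on[OF F_grad]])

lemma gradF_meas [measurable]: "gradF \<in> borel_measurable borel"
  by (rule borel_measurable_continuous_onI[OF lipschitz_on_continuous_on[OF F_lip]])

lemma f_meas: "(\<lambda>p. f (fst p) (snd p)) \<in> borel_measurable (borel \<Otimes>\<^sub>M P)"
  by (rule measurable_continuous_in_fst[OF borel_measurable_integrable[OF f_int] GDERIV_imp_continuous_on[OF f_grad]])

lemma f_meas_compose [measurable (raw)]:
  assumes "g \<in> borel_measurable K" "q \<in> measurable K P"
  shows "(\<lambda>p. f (g p) (q p)) \<in> borel_measurable K"
  using measurable_compose[OF measurable_Pair[OF assms] f_meas] by simp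

text \<open>Each component of the gradient is the limit of the measurable difference quotients with
  step \<open>1 / (i + 1)\<close>.\<close>

lemma gradf_meas [measurable]: "gradf y \<in> borel_measurable P"
proof (rule borel_measurable_euclidean_space[THEN iffD2], rule ballI)
  fix b :: 'a assume "b \<in> Basis"
  show "(\<lambda>z. gradf y z \<bullet> b) \<in> borel_measurable P"
  proof (rule borel_measurable_LIMSEQ_real)
    fix z assume z: "z \<in> space P"
    have "((\<lambda>t. f (y + t *\<^sub>R b) z) has_real_derivative (b \<bullet> gradf (y + 0 *\<^sub>R b) z)) (at 0)"
      by (rule GDERIV_along_line[OF f_grad[OF z]])
    then have lim: "((\<lambda>h. (f (y + h *\<^sub>R b) z - f y z) / h) \<longlongrightarrow> b \<bullet> gradf y z) (at 0)"
      unfolding DERIV_def by simp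
    have "filterlim (\<lambda>i. inverse (real (Suc i))) (at 0) sequentially"
      by (rule filterlim_atI[OF LIMSEQ_inverse_real_of_nat], rule always_eventually) simp
    then show "(\<lambda>i. (f (y + inverse (real (Suc i)) *\<^sub>R b) z - f y z) / inverse (real (Suc i))) \<longlonglongrightarrow> gradf y z \<bullet> b"
      unfolding inner_commute[of "gradf y z" b] by (rule filterlim_compose[OF lim])
  next
    show "(\<lambda>z. (f (y + inverse (real (Suc i)) *\<^sub>R b) z - f y z) / inverse (real (Suc i))) \<in> borel_measurable P" for i
      by (intro borel_measurable_divide borel_measurable_diff borel_measurable_const
          borel_measurable_integrable[OF f_int])
  qed
qed

lemma
  shows gradf_square_integrable: "integrable P (\<lambda>z. (norm (gradf y z))\<^sup>2)"
    and gradf_square_le: "(\<integral>z. (norm (gradf y z))\<^sup>2 \<partial>P) \<le> 2 * (1 + \<beta>\<^sub>1) * (norm (gradF y))\<^sup>2 + 2 * \<beta>\<^sub>2"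
proof -
  have int: "integrable P (\<lambda>z. (norm (gradf y z - gradF y))\<^sup>2)"
    using noise[of y] by (intro integrableI_nonneg) (auto simp: less_top[symmetric] top_unique)
  have le: "(norm (gradf y z))\<^sup>2 \<le> 2 * (norm (gradf y z - gradF y))\<^sup>2 + 2 * (norm (gradF y))\<^sup>2" for z
  proof -
    have "norm (gradf y z) \<le> norm (gradf y z - gradF y) + norm (gradF y)"
      using norm_triangle_ineq[of "gradf y z - gradF y" "gradF y"] by simp
    then have "(norm (gradf y z))\<^sup>2 \<le> (norm (gradf y z - gradF y) + norm (gradF y))\<^sup>2"
      by (rule power_mono) simp
    also have "\<dots> \<le> 2 * (norm (gradf y z - gradF y))\<^sup>2 + 2 * (norm (gradF y))\<^sup>2"
      using zero_le_power2[of "norm (gradf y z - gradF y) - norm (gradF y)"]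
      by (simp add: power2_sum power2_diff)
    finally show ?thesis .
  qed
  have dom: "integrable P (\<lambda>z. 2 * (norm (gradf y z - gradF y))\<^sup>2 + 2 * (norm (gradF y))\<^sup>2)"
    using int by auto
  show *: "integrable P (\<lambda>z. (norm (gradf y z))\<^sup>2)"
    by (rule Bochner_Integration.integrable_bound[OF dom]) (use le in auto)
  have "(\<integral>z. (norm (gradf y z))\<^sup>2 \<partial>P) \<le> (\<integral>z. 2 * (norm (gradf y z - gradF y))\<^sup>2 + 2 * (norm (gradF y))\<^sup>2 \<partial>P)"
    by (rule integral_mono[OF * dom le])
  also have "\<dots> = 2 * (\<integral>z. (norm (gradf y z - gradF y))\<^sup>2 \<partial>P) + 2 * (norm (gradF y))\<^sup>2"
    using int by (simp add: P.prob_space)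
  also have "(\<integral>z. (norm (gradf y z - gradF y))\<^sup>2 \<partial>P) \<le> \<beta>\<^sub>1 * (norm (gradF y))\<^sup>2 + \<beta>\<^sub>2"
    using noise[of y] int \<beta> by (subst (asm) nn_integral_eq_integral) (auto simp: ennreal_le_iff simp del: ennreal_plus)
  finally show "(\<integral>z. (norm (gradf y z))\<^sup>2 \<partial>P) \<le> 2 * (1 + \<beta>\<^sub>1) * (norm (gradF y))\<^sup>2 + 2 * \<beta>\<^sub>2"
    by (simp add: algebra_simps)
qed

text \<open>The factor in the iterate of a second-moment bound for a single-sample estimator: (A5)
  controls \<open>gradf\<close> by \<open>gradF\<close>, and
  \<open>(p + q)^2 <= 2 p^2 + 2 q^2\<close> is applied once for the noise and once for the term
  \<open>Lf * \<nu>\<close>.\<close>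

definition moment_bound :: "real \<Rightarrow> 'a \<Rightarrow> real" where
  "moment_bound \<nu> y = 4 * (1 + \<beta>\<^sub>1) * (norm (gradF y))\<^sup>2 + 4 * \<beta>\<^sub>2 + 2 * (Lf * \<nu>)\<^sup>2"

lemma moment_bound_nonneg: "0 \<le> moment_bound \<nu> y"
  using \<beta> by (simp add: moment_bound_def)

context
  fixes \<gamma> \<nu> :: real and N :: nat
  assumes \<gamma>: "0 \<le> \<gamma>" and \<nu>: "0 < \<nu>"
begin

lemma est_meas [measurable]: "(\<lambda>z. grad_est \<gamma> \<nu> N (\<lambda>y. f y z) x u) \<in> borel_measurable P"
  unfolding grad_est_def by measurable

lemma
  shows est_square_integrable: "integrable P (\<lambda>z. (norm (grad_est \<gamma> \<nu> N (\<lambda>y. f y z) x u))\<^sup>2)"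
    and est_square_le: "(\<integral>z. (norm (grad_est \<gamma> \<nu> N (\<lambda>y. f y z) x u))\<^sup>2 \<partial>P)
      \<le> moment_bound \<nu> x * dir_weight \<gamma> N u"
proof -
  let ?B = "\<lambda>z. (2 * (norm (gradf x z))\<^sup>2 + 2 * (Lf * \<nu>)\<^sup>2) * dir_weight \<gamma> N u"
  have le: "(norm (grad_est \<gamma> \<nu> N (\<lambda>y. f y z) x u))\<^sup>2 \<le> ?B z" if z: "z \<in> space P" for z
  proof -
    have "(norm (grad_est \<gamma> \<nu> N (\<lambda>y. f y z) x u))\<^sup>2 \<le> (norm (gradf x z) + Lf * \<nu>)\<^sup>2 * dir_weight \<gamma> N u"
      by (rule norm_grad_est_le[OF f_grad[OF z] f_lip[OF z] \<nu> \<gamma>])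
    also have "\<dots> \<le> ?B z"
      using zero_le_power2[of "norm (gradf x z) - Lf * \<nu>"]
      by (intro mult_right_mono dir_weight_nonneg) (simp add: power2_sum power2_diff)
    finally show ?thesis .
  qed
  have dom: "integrable P ?B" using gradf_square_integrable by auto
  show *: "integrable P (\<lambda>z. (norm (grad_est \<gamma> \<nu> N (\<lambda>y. f y z) x u))\<^sup>2)"
    by (rule Bochner_Integration.integrable_bound[OF dom])
       (use le in \<open>auto intro!: AE_I2 simp: dir_weight_nonneg abs_mult\<close>)
  have "(\<integral>z. (norm (grad_est \<gamma> \<nu> N (\<lambda>y. f y z) x u))\<^sup>2 \<partial>P) \<le> (\<integral>z. ?B z \<partial>P)"
    by (rule integral_mono[OF * dom le])
  also have "\<dots> = (2 * (\<integral>z. (norm (gradf x z))\<^sup>2 \<partial>P) + 2 * (Lf * \<nu>)\<^sup>2) * dir_weight \<gamma> N u"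
    using gradf_square_integrable by (simp add: P.prob_space)
  also have "\<dots> \<le> moment_bound \<nu> x * dir_weight \<gamma> N u"
    using gradf_square_le[of x] by (intro mult_right_mono dir_weight_nonneg) (simp add: moment_bound_def algebra_simps)
  finally show "(\<integral>z. (norm (grad_est \<gamma> \<nu> N (\<lambda>y. f y z) x u))\<^sup>2 \<partial>P)
      \<le> moment_bound \<nu> x * dir_weight \<gamma> N u" .
qed

lemma est_mean: "(\<integral>z. grad_est \<gamma> \<nu> N (\<lambda>y. f y z) x u \<partial>P) = grad_est \<gamma> \<nu> N F x u"
  unfolding grad_est_def using f_int by (simp add: F_def)

lemma est_variance:
  "(\<integral>z. (norm (grad_est \<gamma> \<nu> N (\<lambda>y. f y z) x u - grad_est \<gamma> \<nu> N F x u))\<^sup>2 \<partial>P)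
      = (\<integral>z. (norm (grad_est \<gamma> \<nu> N (\<lambda>y. f y z) x u))\<^sup>2 \<partial>P) - (norm (grad_est \<gamma> \<nu> N F x u))\<^sup>2"
  using P.integral_norm_sub_mean_square[OF est_meas[where x=x and u=u] est_square_integrable[where x=x and u=u]]
  by (simp add: est_mean)

text \<open>The estimator is linear in the function to which it is applied, hence a batch estimate
  is an average of single-sample estimates.\<close>

lemma grad_est_sample_mean:
  assumes "1 \<le> n"
  shows "grad_est \<gamma> \<nu> N (sample_mean f n \<zeta>) x u
    = (1 / real (card {..<n})) *\<^sub>R (\<Sum>i<n. grad_est \<gamma> \<nu> N (\<lambda>y. f y (\<zeta> i)) x u)"
proof -
  have "(\<Sum>i<n. grad_est \<gamma> \<nu> N (\<lambda>y. f y (\<zeta> i)) x u)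
      = \<gamma> *\<^sub>R (\<Sum>j<N. (\<Sum>i<n. (f (x + \<nu> *\<^sub>R u j) (\<zeta> i) - f x (\<zeta> i)) / \<nu>) *\<^sub>R u j)"
    unfolding grad_est_def by (simp add: scaleR_sum_right[symmetric] scaleR_sum_left) (rule disjI1, rule sum.swap)
  then show ?thesis
    by (simp add: grad_est_def sample_mean_def scaleR_sum_right sum_subtractf sum_divide_distrib[symmetric]
        diff_divide_distrib mult_ac)
qed

lemma
  fixes n :: nat and x :: 'a and u :: "nat \<Rightarrow> 'a"
  assumes n: "1 \<le> n"
  defines "g \<equiv> (\<lambda>\<zeta>. grad_est \<gamma> \<nu> N (sample_mean f n \<zeta>) x u)"
  shows batch_integrable: "integrable (Pi\<^sub>M UNIV (\<lambda>_. P)) g"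
    and batch_mean: "(\<integral>\<zeta>. g \<zeta> \<partial>Pi\<^sub>M UNIV (\<lambda>_. P)) = grad_est \<gamma> \<nu> N F x u"
    and batch_square_integrable: "integrable (Pi\<^sub>M UNIV (\<lambda>_. P)) (\<lambda>\<zeta>. (norm (g \<zeta>))\<^sup>2)"
    and batch_square: "(\<integral>\<zeta>. (norm (g \<zeta>))\<^sup>2 \<partial>Pi\<^sub>M UNIV (\<lambda>_. P)) = (norm (grad_est \<gamma> \<nu> N F x u))\<^sup>2
      + (\<integral>z. (norm (grad_est \<gamma> \<nu> N (\<lambda>y. f y z) x u - grad_est \<gamma> \<nu> N F x u))\<^sup>2 \<partial>P) / n"
proof -
  have g: "g = (\<lambda>\<zeta>. (1 / real (card {..<n})) *\<^sub>R (\<Sum>i<n. grad_est \<gamma> \<nu> N (\<lambda>y. f y (\<zeta> i)) x u))"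
    unfolding g_def grad_est_sample_mean[OF n] ..
  have J: "finite {..<n}" "{..<n} \<noteq> {}" "{..<n} \<subseteq> UNIV" using n by (auto simp: lessThan_empty_iff)
  note avg = iid_average[OF P est_meas[where x=x and u=u] est_square_integrable[where x=x and u=u] J, folded g]
  show sq: "integrable (Pi\<^sub>M UNIV (\<lambda>_. P)) (\<lambda>\<zeta>. (norm (g \<zeta>))\<^sup>2)"
    using avg(2) unfolding g .
  show "integrable (Pi\<^sub>M UNIV (\<lambda>_. P)) g"
    by (rule norm_square_integrable_imp_integrable[OF prob_space_PiM[OF P] avg(1) sq])
  show "(\<integral>\<zeta>. g \<zeta> \<partial>Pi\<^sub>M UNIV (\<lambda>_. P)) = grad_est \<gamma> \<nu> N F x u"
    using avg(3) by (simp add: est_mean)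
  show "(\<integral>\<zeta>. (norm (g \<zeta>))\<^sup>2 \<partial>Pi\<^sub>M UNIV (\<lambda>_. P)) = (norm (grad_est \<gamma> \<nu> N F x u))\<^sup>2
      + (\<integral>z. (norm (grad_est \<gamma> \<nu> N (\<lambda>y. f y z) x u - grad_est \<gamma> \<nu> N F x u))\<^sup>2 \<partial>P) / n"
    using avg(4) unfolding g est_mean by simp
qed

end

end

subsection \<open>One iteration\<close>

text \<open>The function may itself vary with the outcome, as the sample mean does; it is only
  required to be measurable along measurable choices of the point.\<close>

lemma measurable_grad_est_at:
  fixes Y :: "'k \<Rightarrow> 'a::euclidean_space"
  assumes [measurable]: "Y \<in> borel_measurable K" and v: "\<And>j. j < N \<Longrightarrow> v j \<in> borel_measurable K"
    and h [measurable]: "\<And>g. g \<in> borel_measurable K \<Longrightarrow> (\<lambda>p. h p (g p)) \<in> borel_measurable K"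
  shows "(\<lambda>p. grad_est \<gamma> \<nu> N (h p) (Y p) (\<lambda>j. v j p)) \<in> borel_measurable K"
  unfolding grad_est_def
proof (intro borel_measurable_scaleR borel_measurable_const borel_measurable_sum)
  fix j assume "j \<in> {..<N}"
  then have [measurable]: "v j \<in> borel_measurable K" using v by simp
  show "(\<lambda>p. (h p (Y p + \<nu> *\<^sub>R v j p) - h p (Y p)) / \<nu>) \<in> borel_measurable K" by measurable
  show "v j \<in> borel_measurable K" by measurable
qed

text \<open>One iteration with its index suppressed: \<open>A\<close> is the past, which determines
  the iterate, and \<open>H\<close> adds the directions and determines the sample size. The
  assumption \<open>grad_sq\<close> is what the induction over the iterations supplies.\<close>

locale zo_step =
  obj: stoch_objective P f F gradf gradF Lf LF \<beta>\<^sub>1 \<beta>\<^sub>2 +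
  AU: fresh_variable M A "tuple_space N" "\<lambda>\<omega>. \<lambda>j\<in>{..<N}. u j \<omega>" D +
  HZ: fresh_variable M H "Pi\<^sub>M UNIV (\<lambda>_. P)" "\<lambda>\<omega> i. \<zeta> i \<omega>" "Pi\<^sub>M UNIV (\<lambda>_. P)"
  for P :: "'z measure" and f :: "'a::euclidean_space \<Rightarrow> 'z \<Rightarrow> real" and F gradf gradF Lf LF \<beta>\<^sub>1 \<beta>\<^sub>2
    and M A H :: "'w measure" and N :: nat and u :: "nat \<Rightarrow> 'w \<Rightarrow> 'a" and D and \<zeta> :: "nat \<Rightarrow> 'w \<Rightarrow> 'z" +
  fixes \<gamma> \<nu> :: real and n :: "'w \<Rightarrow> nat" and X :: "'w \<Rightarrow> 'a"
  assumes \<gamma>: "0 \<le> \<gamma>" and \<nu>: "0 < \<nu>"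
    and X_A: "X \<in> borel_measurable A" and AH: "sets A \<subseteq> sets H"
    and u_H: "\<And>j. j < N \<Longrightarrow> u j \<in> borel_measurable H"
    and n_H: "n \<in> measurable H (count_space UNIV)" and n1: "\<And>\<omega>. \<omega> \<in> space M \<Longrightarrow> 1 \<le> n \<omega>"
    and D6: "\<And>j. j < N \<Longrightarrow> integrable D (\<lambda>v. norm (v j) ^ 6)"
    and grad_sq: "integrable M (\<lambda>\<omega>. (norm (gradF (X \<omega>)))\<^sup>2)"
begin

text \<open>The sample sequence is a separate argument so that everything known to \<open>H\<close>
  can be frozen while it is integrated out.\<close>

definition batch_est :: "'w \<Rightarrow> (nat \<Rightarrow> 'z) \<Rightarrow> 'a" where
  "batch_est \<omega> zs = grad_est \<gamma> \<nu> N (sample_mean f (n \<omega>) zs) (X \<omega>) (\<lambda>j. u j \<omega>)"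

abbreviation "gS \<omega> \<equiv> batch_est \<omega> (\<lambda>i. \<zeta> i \<omega>)"

abbreviation "G \<omega> \<equiv> grad_est \<gamma> \<nu> N F (X \<omega>) (\<lambda>j. u j \<omega>)"

text \<open>The variance in the sample size conditions is centred at a conditional expectation,
  which is determined only up to a null set; here it is centred at the pointwise defined
  \<open>G\<close>.\<close>

definition Vx :: "'w \<Rightarrow> real" where
  "Vx \<omega> = (\<integral>z. (norm (grad_est \<gamma> \<nu> N (\<lambda>y. f y z) (X \<omega>) (\<lambda>j. u j \<omega>) - G \<omega>))\<^sup>2 \<partial>P)"

abbreviation "wt \<omega> \<equiv> obj.moment_bound \<nu> (X \<omega>) * dir_weight \<gamma> N (\<lambda>j. u j \<omega>)"

lemma spaces: "space A = space M" "space H = space M"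
  using AU.subalg HZ.subalg by (auto simp: subalgebra_def)

lemma X_H: "X \<in> borel_measurable H"
  using X_A AH spaces by (intro measurable_from_subalg[of H A]) (auto simp: subalgebra_def)

lemma X_M: "X \<in> borel_measurable M" and n_M: "n \<in> measurable M (count_space UNIV)"
  using measurable_from_subalg[OF HZ.subalg] X_H n_H by auto

lemma G_H: "G \<in> borel_measurable H"
  by (rule measurable_grad_est_at[OF X_H u_H]) measurable

lemma G_M [measurable]: "G \<in> borel_measurable M"
  by (rule measurable_from_subalg[OF HZ.subalg G_H])

lemma batch_est_meas: "(\<lambda>p. batch_est (fst p) (snd p)) \<in> borel_measurable (H \<Otimes>\<^sub>M Pi\<^sub>M UNIV (\<lambda>_. P))"
  unfolding batch_est_def
proof (rule measurable_compose_countable[where g="\<lambda>p. n (fst p)"])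
  let ?K = "H \<Otimes>\<^sub>M Pi\<^sub>M UNIV (\<lambda>_. P)"
  note [measurable] = X_H n_H
  show "(\<lambda>p. n (fst p)) \<in> measurable ?K (count_space UNIV)" by measurable
  fix k
  show "(\<lambda>p. grad_est \<gamma> \<nu> N (sample_mean f k (snd p)) (X (fst p)) (\<lambda>j. u j (fst p))) \<in> borel_measurable ?K"
  proof (rule measurable_grad_est_at)
    show "(\<lambda>p. u j (fst p)) \<in> borel_measurable ?K" if "j < N" for j
      using u_H[OF that] by measurable
    show "(\<lambda>p. sample_mean f k (snd p) (g p)) \<in> borel_measurable ?K" if [measurable]: "g \<in> borel_measurable ?K" for g
      unfolding sample_mean_def by measurable
  qed measurable
qed

lemma est_meas: "(\<lambda>p. grad_est \<gamma> \<nu> N (\<lambda>y. f y (snd p)) (X (fst p)) (\<lambda>j. u j (fst p))) \<in> borel_measurable (H \<Otimes>\<^sub>M P)"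
proof (rule measurable_grad_est_at)
  note [measurable] = X_H
  show "(\<lambda>p. X (fst p)) \<in> borel_measurable (H \<Otimes>\<^sub>M P)" by measurable
  show "(\<lambda>p. u j (fst p)) \<in> borel_measurable (H \<Otimes>\<^sub>M P)" if "j < N" for j
    using u_H[OF that] by measurable
qed (rule obj.f_meas_compose[OF _ measurable_snd])

lemma gS_meas [measurable]: "gS \<in> borel_measurable M"
  using measurable_compose[OF HZ.pair_measurable batch_est_meas] by simp

lemma variance_measurable:
  assumes [measurable]: "T \<in> borel_measurable H"
  shows "(\<lambda>\<omega>. \<integral>z. (norm (grad_est \<gamma> \<nu> N (\<lambda>y. f y z) (X \<omega>) (\<lambda>j. u j \<omega>) - T \<omega>))\<^sup>2 \<partial>P) \<in> borel_measurable M"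
proof (rule measurable_from_subalg[OF HZ.subalg])
  note [measurable] = est_meas
  have "(\<lambda>p. (norm (grad_est \<gamma> \<nu> N (\<lambda>y. f y (snd p)) (X (fst p)) (\<lambda>j. u j (fst p)) - T (fst p)))\<^sup>2)
      \<in> borel_measurable (H \<Otimes>\<^sub>M P)" by measurable
  then show "(\<lambda>\<omega>. \<integral>z. (norm (grad_est \<gamma> \<nu> N (\<lambda>y. f y z) (X \<omega>) (\<lambda>j. u j \<omega>) - T \<omega>))\<^sup>2 \<partial>P) \<in> borel_measurable H"
    by (intro obj.P.borel_measurable_lebesgue_integral) (simp add: case_prod_beta)
qed

lemma Vx_meas [measurable]: "Vx \<in> borel_measurable M"
  unfolding Vx_def using G_H by (rule variance_measurable)

lemma Vx_nonneg: "0 \<le> Vx \<omega>"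
  unfolding Vx_def by simp

text \<open>The iterate is known to \<open>A\<close> and the directions are independent of
  \<open>A\<close>, so the expectation is that of the moment bound times the mean direction
  weight.\<close>

lemma wt_integrable: "integrable M wt"
proof -
  interpret D: prob_space D by (rule AU.prob_space_Q)
  note [measurable] = X_A
  have D_int: "integrable D (dir_weight \<gamma> N)"
    by (rule integrable_dir_weight[OF D.prob_space_axioms AU.sets_Q D6])
  have mb_int: "integrable M (\<lambda>\<omega>. obj.moment_bound \<nu> (X \<omega>))"
    unfolding obj.moment_bound_def using grad_sq by auto
  have restr: "dir_weight \<gamma> N (\<lambda>j\<in>{..<N}. u j \<omega>) = dir_weight \<gamma> N (\<lambda>j. u j \<omega>)" for \<omega>
    by (simp add: dir_weight_def)
  have wm: "dir_weight \<gamma> N \<in> borel_measurable (tuple_space N)"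
    unfolding dir_weight_def by measurable
  have "(\<integral>\<^sup>+\<omega>. ennreal (obj.moment_bound \<nu> (X \<omega>) * dir_weight \<gamma> N (\<lambda>j\<in>{..<N}. u j \<omega>)) \<partial>M)
      = (\<integral>\<^sup>+\<omega>. \<integral>\<^sup>+v. ennreal (obj.moment_bound \<nu> (X \<omega>) * dir_weight \<gamma> N v) \<partial>D \<partial>M)"
  proof (rule AU.nn_integral_freeze(1))
    note [measurable] = wm
    show "(\<lambda>p. ennreal (obj.moment_bound \<nu> (X (fst p)) * dir_weight \<gamma> N (snd p))) \<in> borel_measurable (A \<Otimes>\<^sub>M tuple_space N)"
      unfolding obj.moment_bound_def by measurable
  qed
  also have "\<dots> = (\<integral>\<^sup>+\<omega>. ennreal (obj.moment_bound \<nu> (X \<omega>) * (\<integral>v. dir_weight \<gamma> N v \<partial>D)) \<partial>M)"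
    using D_int
    by (intro nn_integral_cong)
       (subst nn_integral_eq_integral, auto simp: obj.moment_bound_nonneg dir_weight_nonneg)
  also have "\<dots> < \<infinity>"
    using integrableD(2)[OF integrable_mult_left[OF mb_int, of "\<integral>v. dir_weight \<gamma> N v \<partial>D"]]
    by (simp add: obj.moment_bound_nonneg dir_weight_nonneg less_top)
  finally have fin: "(\<integral>\<^sup>+\<omega>. ennreal (wt \<omega>) \<partial>M) < \<infinity>" unfolding restr .
  have "wt \<in> borel_measurable M"
  proof -
    have [measurable]: "X \<in> borel_measurable M" by (rule X_M)
    have [measurable]: "(\<lambda>\<omega>. dir_weight \<gamma> N (\<lambda>j\<in>{..<N}. u j \<omega>)) \<in> borel_measurable M"
      using measurable_compose[OF AU.Z_meas wm] .
    show ?thesis unfolding restr[symmetric] obj.moment_bound_def by measurable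
  qed
  then show ?thesis
    using fin by (intro integrableI_nonneg) (auto simp: obj.moment_bound_nonneg dir_weight_nonneg)
qed

lemma Vx_eq: "Vx \<omega> = (\<integral>z. (norm (grad_est \<gamma> \<nu> N (\<lambda>y. f y z) (X \<omega>) (\<lambda>j. u j \<omega>)))\<^sup>2 \<partial>P) - (norm (G \<omega>))\<^sup>2"
  unfolding Vx_def by (rule obj.est_variance[OF \<gamma> \<nu>])

lemma G_Vx_le: "(norm (G \<omega>))\<^sup>2 + Vx \<omega> \<le> wt \<omega>"
  unfolding Vx_eq using obj.est_square_le[OF \<gamma> \<nu>] by simp

lemma G_sq_integrable: "integrable M (\<lambda>\<omega>. (norm (G \<omega>))\<^sup>2)"
proof (rule Bochner_Integration.integrable_bound[OF wt_integrable])
  have "(norm (G \<omega>))\<^sup>2 \<le> wt \<omega>" for \<omega> using G_Vx_le[of \<omega>] Vx_nonneg[of \<omega>] by linarith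
  then show "AE \<omega> in M. norm ((norm (G \<omega>))\<^sup>2) \<le> norm (wt \<omega>)"
    by (auto intro!: AE_I2 intro: order_trans[OF _ abs_ge_self])
qed measurable

lemma Vx_integrable: "integrable M Vx"
proof (rule Bochner_Integration.integrable_bound[OF wt_integrable])
  have "Vx \<omega> \<le> wt \<omega>" for \<omega> using G_Vx_le[of \<omega>] zero_le_power2[of "norm (G \<omega>)"] by linarith
  then show "AE \<omega> in M. norm (Vx \<omega>) \<le> norm (wt \<omega>)"
    using Vx_nonneg by (auto intro!: AE_I2 intro: order_trans[OF _ abs_ge_self])
qed measurable

lemma Vx_n_integrable: "integrable M (\<lambda>\<omega>. Vx \<omega> / n \<omega>)"
proof (rule Bochner_Integration.integrable_bound[OF Vx_integrable])
  note [measurable] = n_M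
  show "(\<lambda>\<omega>. Vx \<omega> / n \<omega>) \<in> borel_measurable M" by measurable
  show "AE \<omega> in M. norm (Vx \<omega> / n \<omega>) \<le> norm (Vx \<omega>)"
  proof (rule AE_I2)
    fix \<omega> assume "\<omega> \<in> space M"
    then have "1 \<le> real (n \<omega>)" using n1 by simp
    then have "Vx \<omega> / n \<omega> \<le> Vx \<omega> / 1" using Vx_nonneg[of \<omega>] by (intro divide_left_mono) auto
    then show "norm (Vx \<omega> / n \<omega>) \<le> norm (Vx \<omega>)" using Vx_nonneg[of \<omega>] by simp
  qed
qed

lemma batch:
  assumes "\<omega> \<in> space M"
  shows "integrable (Pi\<^sub>M UNIV (\<lambda>_. P)) (batch_est \<omega>)"
    and "(\<integral>zs. batch_est \<omega> zs \<partial>Pi\<^sub>M UNIV (\<lambda>_. P)) = G \<omega>"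
    and "integrable (Pi\<^sub>M UNIV (\<lambda>_. P)) (\<lambda>zs. (norm (batch_est \<omega> zs))\<^sup>2)"
    and "(\<integral>zs. (norm (batch_est \<omega> zs))\<^sup>2 \<partial>Pi\<^sub>M UNIV (\<lambda>_. P)) = (norm (G \<omega>))\<^sup>2 + Vx \<omega> / n \<omega>"
  unfolding batch_est_def Vx_def
  using obj.batch_integrable[OF \<gamma> \<nu> n1[OF assms]] obj.batch_mean[OF \<gamma> \<nu> n1[OF assms]]
    obj.batch_square_integrable[OF \<gamma> \<nu> n1[OF assms]] obj.batch_square[OF \<gamma> \<nu> n1[OF assms]] by auto

lemma gS_sq_integrable: "integrable M (\<lambda>\<omega>. (norm (gS \<omega>))\<^sup>2)"
proof (rule integrableI_nonneg)
  note [measurable] = batch_est_meas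
  have "(\<integral>\<^sup>+\<omega>. ennreal ((norm (gS \<omega>))\<^sup>2) \<partial>M)
      = (\<integral>\<^sup>+\<omega>. \<integral>\<^sup>+zs. ennreal ((norm (batch_est \<omega> zs))\<^sup>2) \<partial>Pi\<^sub>M UNIV (\<lambda>_. P) \<partial>M)"
    by (rule HZ.nn_integral_freeze(1)[where h="\<lambda>\<omega> zs. ennreal ((norm (batch_est \<omega> zs))\<^sup>2)"]) measurable
  also have "\<dots> = (\<integral>\<^sup>+\<omega>. ennreal ((norm (G \<omega>))\<^sup>2 + Vx \<omega> / n \<omega>) \<partial>M)"
    by (intro nn_integral_cong, subst nn_integral_eq_integral) (simp_all add: batch)
  also have "\<dots> < \<infinity>"
    using integrableD(2)[OF Bochner_Integration.integrable_add[OF G_sq_integrable Vx_n_integrable]] Vx_nonneg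
    by (simp add: less_top del: ennreal_plus)
  finally show "(\<integral>\<^sup>+\<omega>. ennreal ((norm (gS \<omega>))\<^sup>2) \<partial>M) < \<infinity>" .
qed auto

text \<open>The sample size is known to \<open>H\<close>. With \<open>H\<close> frozen, the
  estimator averages a fixed number of independent terms and has mean \<open>G\<close> and variance
  \<open>Vx / n\<close>.\<close>

lemma gS_sq_integral: "(\<integral>\<omega>. (norm (gS \<omega>))\<^sup>2 \<partial>M) = (\<integral>\<omega>. (norm (G \<omega>))\<^sup>2 \<partial>M) + (\<integral>\<omega>. Vx \<omega> / n \<omega> \<partial>M)"
proof -
  note [measurable] = batch_est_meas
  have "(\<integral>\<omega>. (norm (gS \<omega>))\<^sup>2 \<partial>M) = (\<integral>\<omega>. \<integral>zs. (norm (batch_est \<omega> zs))\<^sup>2 \<partial>Pi\<^sub>M UNIV (\<lambda>_. P) \<partial>M)"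
    using gS_sq_integrable
    by (intro HZ.integral_freeze(1)[where h="\<lambda>\<omega> zs. (norm (batch_est \<omega> zs))\<^sup>2"]) measurable
  also have "\<dots> = (\<integral>\<omega>. (norm (G \<omega>))\<^sup>2 + Vx \<omega> / n \<omega> \<partial>M)"
    by (intro Bochner_Integration.integral_cong refl batch)
  finally show ?thesis using G_sq_integrable Vx_n_integrable by simp
qed

lemma inner_integrable:
  "integrable M (\<lambda>\<omega>. gradF (X \<omega>) \<bullet> gS \<omega>)" "integrable M (\<lambda>\<omega>. gradF (X \<omega>) \<bullet> G \<omega>)"
proof -
  note [measurable] = X_M
  show "integrable M (\<lambda>\<omega>. gradF (X \<omega>) \<bullet> gS \<omega>)" "integrable M (\<lambda>\<omega>. gradF (X \<omega>) \<bullet> G \<omega>)"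
    using grad_sq gS_sq_integrable G_sq_integrable by (auto intro!: square_integrable_inner)
qed

lemma inner_integral: "(\<integral>\<omega>. gradF (X \<omega>) \<bullet> gS \<omega> \<partial>M) = (\<integral>\<omega>. gradF (X \<omega>) \<bullet> G \<omega> \<partial>M)"
proof -
  note [measurable] = batch_est_meas X_H
  have "(\<integral>\<omega>. gradF (X \<omega>) \<bullet> gS \<omega> \<partial>M) = (\<integral>\<omega>. \<integral>zs. gradF (X \<omega>) \<bullet> batch_est \<omega> zs \<partial>Pi\<^sub>M UNIV (\<lambda>_. P) \<partial>M)"
    using inner_integrable(1)
    by (intro HZ.integral_freeze(1)[where h="\<lambda>\<omega> zs. gradF (X \<omega>) \<bullet> batch_est \<omega> zs"]) measurable
  also have "\<dots> = (\<integral>\<omega>. gradF (X \<omega>) \<bullet> G \<omega> \<partial>M)"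
    by (intro Bochner_Integration.integral_cong refl) (simp add: batch)
  finally show ?thesis .
qed

text \<open>Freezing \<open>H\<close> in every coordinate integrates out the samples, and the mean
  of a batch estimate is the estimator applied to \<open>F\<close>.\<close>

lemma vec_cond_exp_gS: "AE \<omega> in M. vec_cond_exp M H gS \<omega> = G \<omega>"
proof -
  note [measurable] = batch_est_meas
  have gS_int: "integrable M gS"
    by (rule norm_square_integrable_imp_integrable[OF AU.prob_space_axioms gS_meas gS_sq_integrable])
  have "AE \<omega> in M. real_cond_exp M H (\<lambda>\<omega>. gS \<omega> \<bullet> b) \<omega> = (\<integral>zs. batch_est \<omega> zs \<bullet> b \<partial>Pi\<^sub>M UNIV (\<lambda>_. P))" for b
    using gS_int by (intro HZ.real_cond_exp_freeze[where h="\<lambda>\<omega> zs. batch_est \<omega> zs \<bullet> b"]) auto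
  then have "AE \<omega> in M. \<forall>b\<in>Basis. real_cond_exp M H (\<lambda>\<omega>. gS \<omega> \<bullet> b) \<omega> = (\<integral>zs. batch_est \<omega> zs \<bullet> b \<partial>Pi\<^sub>M UNIV (\<lambda>_. P))"
    by (intro AE_finite_allI) auto
  then show ?thesis
    using AE_space
  proof eventually_elim
    case (elim \<omega>)
    then have "real_cond_exp M H (\<lambda>\<omega>. gS \<omega> \<bullet> b) \<omega> = G \<omega> \<bullet> b" if "b \<in> Basis" for b
      using that by (simp add: batch)
    then show ?case unfolding vec_cond_exp_def by (simp add: euclidean_representation)
  qed
qed

lemma vec_cond_exp_meas: "vec_cond_exp M H gS \<in> borel_measurable H"
  unfolding vec_cond_exp_def by measurable

lemma descent_integral:
  assumes desc: "\<And>x. (\<integral>v. s / 8 * (norm (grad_est \<gamma> \<nu> N F x v))\<^sup>2 - gradF x \<bullet> grad_est \<gamma> \<nu> N F x v \<partial>D)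
      \<le> \<kappa> / 4 - (norm (gradF x))\<^sup>2 / 4"
  shows "s / 8 * (\<integral>\<omega>. (norm (G \<omega>))\<^sup>2 \<partial>M) - (\<integral>\<omega>. gradF (X \<omega>) \<bullet> G \<omega> \<partial>M)
      \<le> \<kappa> / 4 - (\<integral>\<omega>. (norm (gradF (X \<omega>)))\<^sup>2 \<partial>M) / 4"
proof -
  define h where "h \<omega> v = s / 8 * (norm (grad_est \<gamma> \<nu> N F (X \<omega>) v))\<^sup>2 - gradF (X \<omega>) \<bullet> grad_est \<gamma> \<nu> N F (X \<omega>) v" for \<omega> v
  note [measurable] = X_A
  have restr: "grad_est \<gamma> \<nu> N F y (\<lambda>j\<in>{..<N}. u j \<omega>) = grad_est \<gamma> \<nu> N F y (\<lambda>j. u j \<omega>)" for y \<omega>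
    by (rule grad_est_cong) simp
  have [measurable]: "(\<lambda>p. grad_est \<gamma> \<nu> N F (X (fst p)) (snd p)) \<in> borel_measurable (A \<Otimes>\<^sub>M tuple_space N)"
  proof (rule measurable_grad_est_at)
    show "(\<lambda>p. snd p j) \<in> borel_measurable (A \<Otimes>\<^sub>M tuple_space N)" if "j < N" for j
      using that by (intro measurable_compose[OF measurable_snd] measurable_component_singleton) simp
  qed measurable
  have h_meas: "(\<lambda>p. h (fst p) (snd p)) \<in> borel_measurable (A \<Otimes>\<^sub>M tuple_space N)"
    unfolding h_def by measurable
  have int_h: "integrable M (\<lambda>\<omega>. h \<omega> (\<lambda>j\<in>{..<N}. u j \<omega>))"
    unfolding h_def restr using G_sq_integrable inner_integrable by auto
  note fr = AU.integral_freeze[OF h_meas int_h]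
  have "s / 8 * (\<integral>\<omega>. (norm (G \<omega>))\<^sup>2 \<partial>M) - (\<integral>\<omega>. gradF (X \<omega>) \<bullet> G \<omega> \<partial>M) = (\<integral>\<omega>. h \<omega> (\<lambda>j\<in>{..<N}. u j \<omega>) \<partial>M)"
    unfolding h_def restr using G_sq_integrable inner_integrable by simp
  also have "\<dots> = (\<integral>\<omega>. \<integral>v. h \<omega> v \<partial>D \<partial>M)" by (rule fr(1))
  also have "\<dots> \<le> (\<integral>\<omega>. \<kappa> / 4 - (norm (gradF (X \<omega>)))\<^sup>2 / 4 \<partial>M)"
  proof (rule integral_mono[OF fr(2)])
    show "(\<integral>v. h \<omega> v \<partial>D) \<le> \<kappa> / 4 - (norm (gradF (X \<omega>)))\<^sup>2 / 4" for \<omega>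
      unfolding h_def by (rule desc)
  qed (use grad_sq in auto)
  also have "\<dots> = \<kappa> / 4 - (\<integral>\<omega>. (norm (gradF (X \<omega>)))\<^sup>2 \<partial>M) / 4"
    using grad_sq by (simp add: AU.prob_space)
  finally show ?thesis .
qed

lemma sample_size_condition:
  fixes V :: "'w \<Rightarrow> real" and gT :: "'w \<Rightarrow> 'a"
  defines "gT \<equiv> vec_cond_exp M H gS"
    and "V \<equiv> (\<lambda>\<omega>. \<integral>z. (norm (grad_est \<gamma> \<nu> N (\<lambda>y. f y z) (X \<omega>) (\<lambda>j. u j \<omega>) - gT \<omega>))\<^sup>2 \<partial>P)"
  assumes cond: "(AE \<omega> in M. V \<omega> / n \<omega> \<le> \<theta>\<^sup>2 * (norm (gT \<omega>))\<^sup>2)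
        \<or> (AE \<omega> in M. V \<omega> / n \<omega> \<le> \<theta>\<^sup>2 * real_cond_exp M A (\<lambda>\<omega>. (norm (gT \<omega>))\<^sup>2) \<omega>)
        \<or> (AE \<omega> in M. real_cond_exp M A V \<omega> / n \<omega> \<le> \<theta>\<^sup>2 * real_cond_exp M A (\<lambda>\<omega>. (norm (gT \<omega>))\<^sup>2) \<omega>)"
  shows "(\<integral>\<omega>. Vx \<omega> / n \<omega> \<partial>M) \<le> \<theta>\<^sup>2 * (\<integral>\<omega>. (norm (G \<omega>))\<^sup>2 \<partial>M)"
proof -
  interpret A: sigma_finite_subalgebra M A by (rule AU.sigma_finite_subalgebra_G)
  note [measurable] = n_M
  have gT_H: "gT \<in> borel_measurable H" unfolding gT_def by (rule vec_cond_exp_meas)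
  have [measurable]: "gT \<in> borel_measurable M" by (rule measurable_from_subalg[OF HZ.subalg gT_H])
  have [measurable]: "V \<in> borel_measurable M" unfolding V_def by (rule variance_measurable[OF gT_H])
  have gT: "AE \<omega> in M. gT \<omega> = G \<omega>" unfolding gT_def by (rule vec_cond_exp_gS)
  then have V: "AE \<omega> in M. V \<omega> = Vx \<omega>" by eventually_elim (simp add: V_def Vx_def)
  have "AE \<omega> in M. (norm (gT \<omega>))\<^sup>2 = (norm (G \<omega>))\<^sup>2" using gT by eventually_elim simp
  then have E_gT: "AE \<omega> in M. real_cond_exp M A (\<lambda>\<omega>. (norm (gT \<omega>))\<^sup>2) \<omega> = real_cond_exp M A (\<lambda>\<omega>. (norm (G \<omega>))\<^sup>2) \<omega>"
    by (rule A.real_cond_exp_cong) measurable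
  have E_V: "AE \<omega> in M. real_cond_exp M A V \<omega> = real_cond_exp M A Vx \<omega>"
    using V by (rule A.real_cond_exp_cong) measurable
  from cond show ?thesis
  proof (elim disjE)
    assume "AE \<omega> in M. V \<omega> / n \<omega> \<le> \<theta>\<^sup>2 * (norm (gT \<omega>))\<^sup>2"
    then have "AE \<omega> in M. Vx \<omega> / n \<omega> \<le> \<theta>\<^sup>2 * (norm (G \<omega>))\<^sup>2"
      using gT V by eventually_elim simp
    then have "(\<integral>\<omega>. Vx \<omega> / n \<omega> \<partial>M) \<le> (\<integral>\<omega>. \<theta>\<^sup>2 * (norm (G \<omega>))\<^sup>2 \<partial>M)"
      using Vx_n_integrable G_sq_integrable by (intro integral_mono_AE) auto
    then show ?thesis by simp
  next
    assume "AE \<omega> in M. V \<omega> / n \<omega> \<le> \<theta>\<^sup>2 * real_cond_exp M A (\<lambda>\<omega>. (norm (gT \<omega>))\<^sup>2) \<omega>"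
    then have "AE \<omega> in M. Vx \<omega> / n \<omega> \<le> \<theta>\<^sup>2 * real_cond_exp M A (\<lambda>\<omega>. (norm (G \<omega>))\<^sup>2) \<omega>"
      using E_gT V by eventually_elim simp
    then have "(\<integral>\<omega>. Vx \<omega> / n \<omega> \<partial>M) \<le> (\<integral>\<omega>. \<theta>\<^sup>2 * real_cond_exp M A (\<lambda>\<omega>. (norm (G \<omega>))\<^sup>2) \<omega> \<partial>M)"
      using Vx_n_integrable A.real_cond_exp_int(1)[OF G_sq_integrable] by (intro integral_mono_AE) auto
    then show ?thesis using A.real_cond_exp_int(2)[OF G_sq_integrable] by simp
  next
    assume "AE \<omega> in M. real_cond_exp M A V \<omega> / n \<omega> \<le> \<theta>\<^sup>2 * real_cond_exp M A (\<lambda>\<omega>. (norm (gT \<omega>))\<^sup>2) \<omega>"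
    then have "AE \<omega> in M. real_cond_exp M A Vx \<omega> / n \<omega> \<le> \<theta>\<^sup>2 * real_cond_exp M A (\<lambda>\<omega>. (norm (G \<omega>))\<^sup>2) \<omega>"
      using E_gT E_V by eventually_elim simp
    \<comment> \<open>The sample size need not be measurable with respect to \<open>A\<close>, so
      conditioning on \<open>A\<close> does not commute with division by \<open>n\<close>; the ratio
      argument bridges this.\<close>
    then show ?thesis
      using Vx_integrable Vx_nonneg G_sq_integrable n1 by (intro A.integral_ratio_le) auto
  qed
qed

lemma expected_gap_step:
  assumes c: "\<And>y. c \<le> F y" and gap: "integrable M (\<lambda>\<omega>. F (X \<omega>) - c)"
    and desc: "\<And>x. (\<integral>v. s / 8 * (norm (grad_est \<gamma> \<nu> N F x v))\<^sup>2 - gradF x \<bullet> grad_est \<gamma> \<nu> N F x v \<partial>D)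
      \<le> \<kappa> / 4 - (norm (gradF x))\<^sup>2 / 4"
    and var: "(\<integral>\<omega>. Vx \<omega> / n \<omega> \<partial>M) \<le> \<theta>\<^sup>2 * (\<integral>\<omega>. (norm (G \<omega>))\<^sup>2 \<partial>M)"
    and \<alpha>: "0 \<le> \<alpha>" "4 * (1 + \<theta>\<^sup>2) * LF * \<alpha> = s"
    and sc: "\<And>y. 2 * \<mu> * (F y - c) \<le> (norm (gradF y))\<^sup>2"
  shows "integrable M (\<lambda>\<omega>. F (X \<omega> - \<alpha> *\<^sub>R gS \<omega>) - c)"
    and "(\<integral>\<omega>. F (X \<omega> - \<alpha> *\<^sub>R gS \<omega>) - c \<partial>M)
      \<le> (1 - \<alpha> * \<mu> / 2) * (\<integral>\<omega>. F (X \<omega>) - c \<partial>M) + \<alpha> * \<kappa> / 4"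
proof -
  note [measurable] = X_M
  \<comment> \<open>The bound from the descent lemma. The next gap lies between 0 and this
    integrable function, so it is integrable as well.\<close>
  let ?dom = "\<lambda>\<omega>. (F (X \<omega>) - c) - \<alpha> * (gradF (X \<omega>) \<bullet> gS \<omega>) + LF * \<alpha>\<^sup>2 / 2 * (norm (gS \<omega>))\<^sup>2"
  have le: "F (X \<omega> - \<alpha> *\<^sub>R gS \<omega>) - c \<le> ?dom \<omega>" for \<omega>
    using lipschitz_gradient_upper[OF obj.F_grad obj.F_lip, of "X \<omega>" "- (\<alpha> *\<^sub>R gS \<omega>)"] \<alpha>(1)
    by (simp add: inner_commute power_mult_distrib mult_ac)
  have dom: "integrable M ?dom"
    using gap inner_integrable gS_sq_integrable by auto
  show int: "integrable M (\<lambda>\<omega>. F (X \<omega> - \<alpha> *\<^sub>R gS \<omega>) - c)"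
  proof (rule Bochner_Integration.integrable_bound[OF dom])
    have "norm (F (X \<omega> - \<alpha> *\<^sub>R gS \<omega>) - c) \<le> norm (?dom \<omega>)" for \<omega>
      using le[of \<omega>] c[of "X \<omega> - \<alpha> *\<^sub>R gS \<omega>"] unfolding real_norm_def by linarith
    then show "AE \<omega> in M. norm (F (X \<omega> - \<alpha> *\<^sub>R gS \<omega>) - c) \<le> norm (?dom \<omega>)" by (intro AE_I2)
  qed measurable
  define E where "E = (\<integral>\<omega>. F (X \<omega>) - c \<partial>M)"
  define g2 where "g2 = (\<integral>\<omega>. (norm (G \<omega>))\<^sup>2 \<partial>M)"
  define ip where "ip = (\<integral>\<omega>. gradF (X \<omega>) \<bullet> G \<omega> \<partial>M)"
  define v where "v = (\<integral>\<omega>. Vx \<omega> / n \<omega> \<partial>M)"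
  define q where "q = (\<integral>\<omega>. (norm (gradF (X \<omega>)))\<^sup>2 \<partial>M)"
  have "(\<integral>\<omega>. F (X \<omega> - \<alpha> *\<^sub>R gS \<omega>) - c \<partial>M) \<le> (\<integral>\<omega>. ?dom \<omega> \<partial>M)"
    by (rule integral_mono[OF int dom le])
  also have "\<dots> = E - \<alpha> * ip + LF * \<alpha>\<^sup>2 / 2 * (g2 + v)"
    using gap inner_integrable gS_sq_integrable
    by (simp add: E_def ip_def g2_def v_def inner_integral gS_sq_integral)
  also have "\<dots> \<le> E - \<alpha> * ip + LF * \<alpha>\<^sup>2 / 2 * ((1 + \<theta>\<^sup>2) * g2)"
    using var obj.LF by (intro add_left_mono mult_left_mono) (auto simp: v_def g2_def distrib_right)
  \<comment> \<open>The product \<open>4 * (1 + \<theta>\<^sup>2) * LF * \<alpha>\<close> is brought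
    out so that it can be replaced by the step factor \<open>s\<close>; this is the origin of
    \<open>s / 8\<close>.\<close>
  also have "LF * \<alpha>\<^sup>2 / 2 * ((1 + \<theta>\<^sup>2) * g2) = \<alpha> * ((4 * (1 + \<theta>\<^sup>2) * LF * \<alpha>) / 8 * g2)"
    by (simp add: power2_eq_square)
  also have "E - \<alpha> * ip + \<alpha> * ((4 * (1 + \<theta>\<^sup>2) * LF * \<alpha>) / 8 * g2) = E + \<alpha> * (s / 8 * g2 - ip)"
    unfolding \<alpha>(2) by (simp add: algebra_simps)
  also have "\<dots> \<le> E + \<alpha> * (\<kappa> / 4 - q / 4)"
    using descent_integral[OF desc] \<alpha>(1) by (intro add_left_mono mult_left_mono) (auto simp: g2_def ip_def q_def)
  also have "\<dots> \<le> E + \<alpha> * (\<kappa> / 4 - 2 * \<mu> * E / 4)"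
  proof -
    have "2 * \<mu> * E = (\<integral>\<omega>. 2 * \<mu> * (F (X \<omega>) - c) \<partial>M)" unfolding E_def by simp
    also have "\<dots> \<le> q"
      unfolding q_def by (intro integral_mono) (use gap grad_sq sc in auto)
    finally have "\<kappa> / 4 - q / 4 \<le> \<kappa> / 4 - 2 * \<mu> * E / 4" by linarith
    then show ?thesis using \<alpha>(1) by (intro add_left_mono mult_left_mono)
  qed
  also have "\<dots> = (1 - \<alpha> * \<mu> / 2) * E + \<alpha> * \<kappa> / 4" by (simp add: algebra_simps)
  finally show "(\<integral>\<omega>. F (X \<omega> - \<alpha> *\<^sub>R gS \<omega>) - c \<partial>M)
      \<le> (1 - \<alpha> * \<mu> / 2) * (\<integral>\<omega>. F (X \<omega>) - c \<partial>M) + \<alpha> * \<kappa> / 4" unfolding E_def .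
qed

end

subsection \<open>The filtration\<close>

locale sampling_history = prob_space M for M :: "'w measure" +
  fixes P :: "'z measure" and N :: nat
    and u :: "nat \<Rightarrow> nat \<Rightarrow> 'w \<Rightarrow> 'a::euclidean_space" and n :: "nat \<Rightarrow> 'w \<Rightarrow> nat" and \<zeta> :: "nat \<Rightarrow> nat \<Rightarrow> 'w \<Rightarrow> 'z"
  assumes u_meas: "\<And>k j. j < N \<Longrightarrow> u k j \<in> borel_measurable M"
    and \<zeta>_meas: "\<And>k i. \<zeta> k i \<in> measurable M P"
    and n_meas: "\<And>k. n k \<in> measurable (past_half M P N u n \<zeta> k) (count_space UNIV)"
begin

abbreviation "A k \<equiv> past M P N u n \<zeta> k"
abbreviation "H k \<equiv> past_half M P N u n \<zeta> k"

definition past_gen :: "nat \<Rightarrow> 'w set set" where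
  "past_gen k = (\<Union>l<k. \<Union>j<N. {u l j -` B \<inter> space M | B. B \<in> sets borel}) \<union>
      (\<Union>l<k. \<Union>i. {{\<omega> \<in> space M. i < n l \<omega> \<and> \<zeta> l i \<omega> \<in> S} | S. S \<in> sets P})"

lemma past_gen_Pow: "past_gen k \<subseteq> Pow (space M)"
  unfolding past_gen_def by auto

lemma A_eq: "A k = sigma (space M) (past_gen k)"
  unfolding past_def past_gen_def ..

lemma space_A [simp]: "space (A k) = space M" and sets_A: "sets (A k) = sigma_sets (space M) (past_gen k)"
  unfolding A_eq using past_gen_Pow[of k] by (simp_all add: space_measure_of sets_measure_of)

definition half_gen :: "nat \<Rightarrow> 'w set set" where
  "half_gen k = sets (A k) \<union> (\<Union>j<N. {u k j -` B \<inter> space M | B. B \<in> sets borel})"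

lemma half_gen_Pow: "half_gen k \<subseteq> Pow (space M)"
  unfolding half_gen_def using sets.sets_into_space[of _ "A k"] by auto

lemma space_H [simp]: "space (H k) = space M" and sets_H: "sets (H k) = sigma_sets (space M) (half_gen k)"
  unfolding past_half_def half_gen_def[symmetric] using half_gen_Pow[of k]
  by (simp_all add: space_measure_of sets_measure_of)

lemma A_subset_H: "sets (A k) \<subseteq> sets (H k)"
  unfolding sets_H half_gen_def by auto

lemma u_H: "j < N \<Longrightarrow> u k j \<in> borel_measurable (H k)"
  by (rule measurableI) (auto simp: sets_H half_gen_def)

lemma past_gen_mono: "k \<le> k' \<Longrightarrow> past_gen k \<subseteq> past_gen k'"
  unfolding past_gen_def by (intro Un_mono UN_mono) auto

lemma H_subset_A: "sets (H k) \<subseteq> sets (A (Suc k))"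
proof -
  have "sets (A k) \<subseteq> sets (A (Suc k))"
    unfolding sets_A by (intro sigma_sets_mono' past_gen_mono) simp
  moreover have "(\<Union>j<N. {u k j -` B \<inter> space M | B. B \<in> sets borel}) \<subseteq> past_gen (Suc k)"
    unfolding past_gen_def by auto
  then have "(\<Union>j<N. {u k j -` B \<inter> space M | B. B \<in> sets borel}) \<subseteq> sets (A (Suc k))"
    unfolding sets_A by (auto intro: sigma_sets.Basic)
  ultimately have "half_gen k \<subseteq> sets (A (Suc k))" unfolding half_gen_def by simp
  from sets.sigma_sets_subset[OF this] show ?thesis by (simp add: sets_H)
qed

lemma H_subset_M_if: "sets (A k) \<subseteq> sets M \<Longrightarrow> sets (H k) \<subseteq> sets M"
  unfolding sets_H
proof (rule sets.sigma_sets_subset)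
  assume "sets (A k) \<subseteq> sets M"
  then show "half_gen k \<subseteq> sets M"
    unfolding half_gen_def using u_meas by (auto intro: measurable_sets)
qed

text \<open>Course-of-values induction: events of the past involve earlier sample sizes, whose
  measurability is given relative to an earlier history, and that history must first be known to
  consist of events of \<open>M\<close>.\<close>

lemma A_subset_M: "sets (A k) \<subseteq> sets M"
proof (induction k rule: less_induct)
  case (less k)
  have n_M: "n l \<in> measurable M (count_space UNIV)" if "l < k" for l
    using n_meas[of l] H_subset_M_if[OF less[OF that]]
    by (intro measurable_from_subalg[of M "H l"]) (auto simp: subalgebra_def)
  have "past_gen k \<subseteq> sets M"
  proof
    fix S assume "S \<in> past_gen k"
    then consider l j B where "l < k" "j < N" "B \<in> sets borel" "S = u l j -` B \<inter> space M"
      | l i B where "l < k" "B \<in> sets P" "S = {\<omega> \<in> space M. i < n l \<omega> \<and> \<zeta> l i \<omega> \<in> B}"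
      unfolding past_gen_def by blast
    then show "S \<in> sets M"
    proof cases
      case 1
      then show ?thesis using u_meas by (auto intro: measurable_sets)
    next
      case 2
      have [measurable]: "n l \<in> measurable M (count_space UNIV)" "\<zeta> l i \<in> measurable M P" "B \<in> sets P"
        using n_M[OF 2(1)] \<zeta>_meas 2 by auto
      show ?thesis unfolding 2(3) by measurable
    qed
  qed
  then show ?case unfolding sets_A by (rule sets.sigma_sets_subset)
qed

lemma subalgebra_A: "subalgebra M (A k)" and subalgebra_H: "subalgebra M (H k)"
  using A_subset_M H_subset_M_if by (auto simp: subalgebra_def)

lemma measurable_H_A: "g \<in> measurable (H k) K \<Longrightarrow> g \<in> measurable (A (Suc k)) K"
  using H_subset_A by (intro measurable_from_subalg[of "A (Suc k)" "H k"]) (auto simp: subalgebra_def)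

text \<open>Only the samples that are used are measurable with respect to the history.\<close>

lemma used_sample_A:
  assumes z0: "z0 \<in> space P"
  shows "(\<lambda>\<omega>. if i < n k \<omega> then \<zeta> k i \<omega> else z0) \<in> measurable (A (Suc k)) P"
proof (rule measurableI)
  fix \<omega> assume "\<omega> \<in> space (A (Suc k))"
  then show "(if i < n k \<omega> then \<zeta> k i \<omega> else z0) \<in> space P"
    using measurable_space[OF \<zeta>_meas] z0 by simp
next
  fix S assume S: "S \<in> sets P"
  have used: "{\<omega> \<in> space M. i < n k \<omega> \<and> \<zeta> k i \<omega> \<in> S} \<in> sets (A (Suc k))"
    unfolding sets_A past_gen_def using S by (intro sigma_sets.Basic) blast
  note [measurable] = measurable_H_A[OF n_meas[of k]]
  have "{\<omega> \<in> space (A (Suc k)). \<not> i < n k \<omega> \<and> z0 \<in> S} \<in> sets (A (Suc k))" by measurable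
  then have "{\<omega> \<in> space M. i < n k \<omega> \<and> \<zeta> k i \<omega> \<in> S} \<union> {\<omega> \<in> space M. \<not> i < n k \<omega> \<and> z0 \<in> S} \<in> sets (A (Suc k))"
    using used by simp
  also have "{\<omega> \<in> space M. i < n k \<omega> \<and> \<zeta> k i \<omega> \<in> S} \<union> {\<omega> \<in> space M. \<not> i < n k \<omega> \<and> z0 \<in> S}
      = (\<lambda>\<omega>. if i < n k \<omega> then \<zeta> k i \<omega> else z0) -` S \<inter> space (A (Suc k))"
    by (auto split: if_splits)
  finally show "(\<lambda>\<omega>. if i < n k \<omega> then \<zeta> k i \<omega> else z0) -` S \<inter> space (A (Suc k)) \<in> sets (A (Suc k))" .
qed

end

subsection \<open>Complexity\<close>

lemma step_factor_bounds:
  assumes m: "admissible m d N" and d: "1 \<le> d"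
  shows "0 < step_factor m d N" "step_factor m d N \<le> 1" "1 / step_factor m d N \<le> 5.5 * dim_factor m d N"
    "1 \<le> dim_factor m d N"
proof -
  have N: "1 \<le> N" using m by (rule admissible_imp_pos)
  have p: "0 < real N + 4.5 * real d" using N by simp
  have Nd: "N \<le> d" if "m = RC \<or> m = RS" using m that by (auto simp: admissible_def)
  show "0 < step_factor m d N" using N d p by (cases m) (auto simp: step_factor_def)
  show "step_factor m d N \<le> 1" using N d p Nd by (cases m) (auto simp: step_factor_def)
  show df: "1 \<le> dim_factor m d N" using N d Nd by (cases m) (auto simp: dim_factor_def)
  show "1 / step_factor m d N \<le> 5.5 * dim_factor m d N"
  proof (cases "m = GS \<or> m = SS")
    case True
    have "real N + 4.5 * real d \<le> 5.5 * real (max N d)" by simp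
    then show ?thesis using True N p by (auto simp: step_factor_def dim_factor_def divide_right_mono)
  next
    case False
    then have "1 / step_factor m d N = dim_factor m d N"
      using N d by (cases m) (auto simp: step_factor_def dim_factor_def)
    then show ?thesis using df by linarith
  qed
qed

lemma rate_bounds:
  assumes "admissible m d N" "1 \<le> d" "0 < \<mu>" "\<mu> \<le> L"
  shows "0 < rate m d N \<theta> \<mu> L" "rate m d N \<theta> \<mu> L < 1"
proof -
  note sf = step_factor_bounds[OF assms(1,2)]
  have t: "1 \<le> 1 + \<theta>\<^sup>2" by simp
  have "L * 1 \<le> L * (1 + \<theta>\<^sup>2)" using assms t by (intro mult_left_mono) auto
  then have "\<mu> < 8 * (L * (1 + \<theta>\<^sup>2))" using assms by linarith
  then have "\<mu> < 8 * (1 + \<theta>\<^sup>2) * L" by (simp add: algebra_simps)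
  moreover have "0 < 8 * (1 + \<theta>\<^sup>2) * L" using assms by (auto intro!: mult_pos_pos add_pos_nonneg)
  ultimately have O: "0 < Omega3 \<theta> \<mu> L" "Omega3 \<theta> \<mu> L < 1"
    using assms by (simp_all add: Omega3_def)
  show "0 < rate m d N \<theta> \<mu> L" using sf O by (simp add: rate_def)
  have "step_factor m d N * Omega3 \<theta> \<mu> L \<le> 1 * Omega3 \<theta> \<mu> L" using sf O by (intro mult_right_mono) auto
  then show "rate m d N \<theta> \<mu> L < 1" using O unfolding rate_def by linarith
qed

lemma ln_inverse_ge:
  fixes \<rho> :: real
  assumes "0 < \<rho>" "\<rho> < 1"
  shows "\<rho> \<le> ln (inverse (1 - \<rho>))"
  using ln_le_minus_one[of "1 - \<rho>"] assms by (simp add: ln_inverse)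

lemma inverse_rate_le:
  assumes "admissible m d N" "1 \<le> d" "0 < \<mu>" "\<mu> \<le> L"
  shows "1 / rate m d N \<theta> \<mu> L \<le> 44 * (1 + \<theta>\<^sup>2) * (dim_factor m d N * (L / \<mu>))"
proof -
  have "1 / rate m d N \<theta> \<mu> L = 1 / step_factor m d N * (8 * (1 + \<theta>\<^sup>2) * L / \<mu>)"
    by (simp add: rate_def Omega3_def)
  also have "\<dots> \<le> 5.5 * dim_factor m d N * (8 * (1 + \<theta>\<^sup>2) * L / \<mu>)"
    using step_factor_bounds(3)[OF assms(1,2)] assms by (intro mult_right_mono) auto
  also have "5.5 * dim_factor m d N * (8 * (1 + \<theta>\<^sup>2) * L / \<mu>) = 44 * (1 + \<theta>\<^sup>2) * (dim_factor m d N * (L / \<mu>))"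
    using assms by (simp add: field_simps)
  finally show ?thesis .
qed

text \<open>The constant is fixed before method, dimension and accuracy and depends on
  \<open>\<Delta>\<close> and \<open>\<theta>\<close> alone. For \<open>\<Delta> = 0\<close> the
  bound is minus infinity, so its absolute value is controlled only for a positive gap.\<close>

lemma iteration_bound_complexity:
  fixes \<Delta> \<theta> :: real
  assumes \<Delta>: "0 \<le> \<Delta>"
  shows "\<exists>C. \<forall>m' d' N' \<mu>' L' \<epsilon>' p'.
            1 \<le> d' \<and> admissible m' d' N' \<and> 0 < \<mu>' \<and> \<mu>' \<le> L' \<and>
            0 < \<epsilon>' \<and> 0 < p' \<and> p' \<le> 1 \<and> \<epsilon>' * p' \<le> 1 / 2 \<longrightarrow>
            (let \<rho>' = rate m' d' N' \<theta> \<mu>' L';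
                 K' = iteration_bound \<Delta> \<epsilon>' p' \<rho>';
                 B\<^sub>1 = C * (ln (1 / (\<epsilon>' * p')) / \<rho>');
                 B\<^sub>2 = C * (dim_factor m' d' N' * Omega6 \<mu>' L' \<epsilon>' p')
             in K' \<le> ereal B\<^sub>1 \<and> K' \<le> ereal B\<^sub>2 \<and>
                (\<Delta> \<noteq> 0 \<longrightarrow> \<bar>K'\<bar> \<le> ereal B\<^sub>1 \<and> \<bar>K'\<bar> \<le> ereal B\<^sub>2))"
proof -
  \<comment> \<open>From \<open>\<epsilon> p <= 1/2\<close> the logarithm \<open>\<Lambda>\<close>
    below is at least \<open>ln 2\<close>; hence \<open>\<Lambda> / ln 2\<close> times the absolute
    value of \<open>ln \<Delta>\<close> dominates the latter, and \<open>2 * \<Lambda>\<close>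
    dominates \<open>ln 2 + \<Lambda>\<close>. The factor 44 in \<open>C\<close> is 8 from
    \<open>Omega3\<close> times 5.5 from \<open>N + 4.5 d <= 5.5 * max N d\<close>.\<close>
  define c where "c = \<bar>ln \<Delta>\<bar> / ln 2 + 2"
  define C where "C = c * (44 * (1 + \<theta>\<^sup>2))"
  have c0: "0 \<le> c" by (simp add: c_def)
  have "1 \<le> 44 * (1 + \<theta>\<^sup>2)" by simp
  then have cC: "c \<le> C" unfolding C_def using c0 mult_left_mono[of 1 "44 * (1 + \<theta>\<^sup>2)" c] by simp
  show ?thesis
  proof (intro exI[of _ C] allI impI)
    fix m d N and \<mu> L \<epsilon> p :: real
    assume "1 \<le> d \<and> admissible m d N \<and> 0 < \<mu> \<and> \<mu> \<le> L \<and> 0 < \<epsilon> \<and> 0 < p \<and> p \<le> 1 \<and> \<epsilon> * p \<le> 1 / 2"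
    then have a: "1 \<le> d" "admissible m d N" "0 < \<mu>" "\<mu> \<le> L" "0 < \<epsilon>" "0 < p" "p \<le> 1" "\<epsilon> * p \<le> 1 / 2"
      by auto
    define \<rho> where "\<rho> = rate m d N \<theta> \<mu> L"
    define \<Lambda> where "\<Lambda> = ln (1 / (\<epsilon> * p))"
    define K where "K = iteration_bound \<Delta> \<epsilon> p \<rho>"
    have ep: "0 < \<epsilon> * p" using a by simp
    have \<rho>: "0 < \<rho>" "\<rho> < 1" unfolding \<rho>_def using rate_bounds[OF a(2,1,3,4)] by auto
    have lr: "\<rho> \<le> ln (inverse (1 - \<rho>))" by (rule ln_inverse_ge[OF \<rho>])
    have inv: "1 < inverse (1 - \<rho>)" using \<rho> by (intro one_less_inverse) auto
    have \<Lambda>: "ln 2 \<le> \<Lambda>" unfolding \<Lambda>_def using a ep by (subst ln_le_cancel_iff) (auto simp: field_simps)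
    then have \<Lambda>0: "0 < \<Lambda>" using ln_gt_zero[of "2::real"] by linarith
    define B1 where "B1 = C * (\<Lambda> / \<rho>)"
    define B2 where "B2 = C * (dim_factor m d N * Omega6 \<mu> L \<epsilon> p)"
    have B1: "c * (\<Lambda> / \<rho>) \<le> B1" unfolding B1_def using cC \<Lambda>0 \<rho> by (intro mult_right_mono) auto
    have B2: "c * (\<Lambda> / \<rho>) \<le> B2"
    proof -
      have "c * (\<Lambda> / \<rho>) = c * (\<Lambda> * (1 / \<rho>))" by simp
      also have "\<dots> \<le> c * (\<Lambda> * (44 * (1 + \<theta>\<^sup>2) * (dim_factor m d N * (L / \<mu>))))"
        unfolding \<rho>_def using inverse_rate_le[OF a(2,1,3,4)] \<Lambda>0 c0 by (intro mult_left_mono) auto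
      also have "\<dots> = B2" by (simp add: B2_def C_def Omega6_def \<Lambda>_def)
      finally show ?thesis .
    qed
    have nonneg: "0 \<le> c * (\<Lambda> / \<rho>)" using c0 \<Lambda>0 \<rho> by simp
    have "K \<le> ereal (c * (\<Lambda> / \<rho>)) \<and> (\<Delta> \<noteq> 0 \<longrightarrow> \<bar>K\<bar> \<le> ereal (c * (\<Lambda> / \<rho>)))"
    proof (cases "\<Delta> = 0")
      case True
      then have "K = -\<infinity>"
        using ep inv \<rho> a by (simp add: K_def iteration_bound_def log_ext_def divide_ereal_def)
      then show ?thesis using True by simp
    next
      case False
      define t where "t = (ln \<Delta> - ln (\<epsilon> * p / 2)) / ln (inverse (1 - \<rho>))"
      have K: "K = ereal t"
        using False ep lr \<rho> a by (simp add: K_def iteration_bound_def log_ext_def t_def)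
      have "ln \<Delta> - ln (\<epsilon> * p / 2) = ln \<Delta> + ln 2 + \<Lambda>"
        unfolding \<Lambda>_def using ep a by (simp add: ln_div)
      then have "\<bar>ln \<Delta> - ln (\<epsilon> * p / 2)\<bar> \<le> \<bar>ln \<Delta>\<bar> + 2 * \<Lambda>"
        using \<Lambda> \<Lambda>0 ln_gt_zero[of "2::real"] by linarith
      also have "\<dots> \<le> c * \<Lambda>"
      proof -
        have "\<bar>ln \<Delta>\<bar> / ln 2 * ln 2 \<le> \<bar>ln \<Delta>\<bar> / ln 2 * \<Lambda>" using \<Lambda> by (intro mult_left_mono) auto
        then show ?thesis by (simp add: c_def distrib_right)
      qed
      finally have "\<bar>ln \<Delta> - ln (\<epsilon> * p / 2)\<bar> \<le> c * \<Lambda>" .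
      then have "\<bar>t\<bar> \<le> c * \<Lambda> / ln (inverse (1 - \<rho>))"
      proof -
        have l0: "0 < ln (inverse (1 - \<rho>))" using lr \<rho> by linarith
        show ?thesis
          unfolding t_def abs_divide abs_of_pos[OF l0]
          using \<open>\<bar>ln \<Delta> - ln (\<epsilon> * p / 2)\<bar> \<le> c * \<Lambda>\<close> l0 by (intro divide_right_mono) auto
      qed
      also have "\<dots> \<le> c * \<Lambda> / \<rho>" 
        by (rule divide_left_mono[OF lr _ mult_pos_pos[OF less_le_trans[OF \<rho>(1) lr] \<rho>(1)]])
           (use c0 \<Lambda>0 in simp)
      finally show ?thesis unfolding K by auto
    qed
    then show "let \<rho>' = rate m d N \<theta> \<mu> L; K' = iteration_bound \<Delta> \<epsilon> p \<rho>';
           B\<^sub>1 = C * (ln (1 / (\<epsilon> * p)) / \<rho>'); B\<^sub>2 = C * (dim_factor m d N * Omega6 \<mu> L \<epsilon> p)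
       in K' \<le> ereal B\<^sub>1 \<and> K' \<le> ereal B\<^sub>2 \<and> (\<Delta> \<noteq> 0 \<longrightarrow> \<bar>K'\<bar> \<le> ereal B\<^sub>1 \<and> \<bar>K'\<bar> \<le> ereal B\<^sub>2)"
      unfolding Let_def \<rho>_def[symmetric] K_def[symmetric] \<Lambda>_def[symmetric] B1_def[symmetric] B2_def[symmetric]
      using B1 B2 by (auto intro: order_trans)
  qed
qed

text \<open>The iteration bound is the solution of the claimed inequality for \<open>k\<close> after
  taking logarithms; with a zero gap the left side vanishes.\<close>

lemma iteration_bound_decay:
  assumes \<Delta>: "0 \<le> \<Delta>" and \<rho>: "0 < \<rho>" "\<rho> < 1" and ep: "0 < \<epsilon>" "0 < p"
    and k: "iteration_bound \<Delta> \<epsilon> p \<rho> \<le> ereal (real k)"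
  shows "(1 - \<rho>) ^ k * \<Delta> \<le> \<epsilon> * p / 2"
proof (cases "\<Delta> = 0")
  case False
  then have \<Delta>: "0 < \<Delta>" using \<Delta> by simp
  have ep2: "0 < \<epsilon> * p / 2" using ep by simp
  have lr: "0 < ln (inverse (1 - \<rho>))" using ln_inverse_ge[OF \<rho>] \<rho> by linarith
  have "(ln \<Delta> - ln (\<epsilon> * p / 2)) / ln (inverse (1 - \<rho>)) \<le> real k"
    using k False ep lr by (simp add: iteration_bound_def log_ext_def)
  then have "ln \<Delta> - ln (\<epsilon> * p / 2) \<le> real k * ln (inverse (1 - \<rho>))"
    using lr by (simp add: pos_divide_le_eq)
  then have "ln ((1 - \<rho>) ^ k * \<Delta>) \<le> ln (\<epsilon> * p / 2)"
    using \<rho> \<Delta> by (simp add: ln_mult ln_realpow ln_inverse)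
  then show ?thesis using \<Delta> \<rho> ep2 by (subst (asm) ln_le_cancel_iff) auto
qed (use ep in simp)

text \<open>The iterates of an affine map are convex combinations of the initial value and the fixed
  point \<open>b\<close>.\<close>

lemma affine_recursion_le:
  fixes e :: "nat \<Rightarrow> real"
  assumes "\<And>k. e (Suc k) \<le> (1 - \<rho>) * e k + \<rho> * b" and \<rho>: "\<rho> \<le> 1"
  shows "e k \<le> (1 - \<rho>) ^ k * e 0 + (1 - (1 - \<rho>) ^ k) * b"
proof (induction k)
  case (Suc k)
  have "e (Suc k) \<le> (1 - \<rho>) * e k + \<rho> * b" by (rule assms(1))
  also have "\<dots> \<le> (1 - \<rho>) * ((1 - \<rho>) ^ k * e 0 + (1 - (1 - \<rho>) ^ k) * b) + \<rho> * b"
    using Suc \<rho> by (intro add_right_mono mult_left_mono) auto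
  also have "\<dots> = (1 - \<rho>) ^ Suc k * e 0 + (1 - (1 - \<rho>) ^ Suc k) * b"
    by (simp add: algebra_simps)
  finally show ?case .
qed simp

section \<open>Recursion for the expected gap and Markov's inequality\<close>

theorem theorem3p8:
  fixes M :: "'w measure" and P :: "'z measure"
    and f :: "'a::euclidean_space \<Rightarrow> 'z \<Rightarrow> real" and F :: "'a \<Rightarrow> real"
    and gradf :: "'a \<Rightarrow> 'z \<Rightarrow> 'a" and gradF :: "'a \<Rightarrow> 'a"
    and Lf LF \<mu> \<beta>\<^sub>1 \<beta>\<^sub>2 \<theta> \<epsilon> p \<nu> :: real and x0 xstar :: 'a
    and m :: grad_method and N :: nat
    and u :: "nat \<Rightarrow> nat \<Rightarrow> 'w \<Rightarrow> 'a" and \<zeta> :: "nat \<Rightarrow> nat \<Rightarrow> 'w \<Rightarrow> 'z" and n :: "nat \<Rightarrow> 'w \<Rightarrow> nat"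
    and x :: "nat \<Rightarrow> 'w \<Rightarrow> 'a" and \<alpha> :: "nat \<Rightarrow> real"
    and gS gT :: "nat \<Rightarrow> 'w \<Rightarrow> 'a" and V :: "nat \<Rightarrow> 'w \<Rightarrow> real"
    and ET :: "nat \<Rightarrow> ('w \<Rightarrow> real) \<Rightarrow> 'w \<Rightarrow> real"
  assumes M: "prob_space M" and P: "prob_space P"
    \<comment> \<open>the objective\<close>
    and f_int: "\<And>y. integrable P (f y)"
    and F_def: "\<And>y. F y = (\<integral>z. f y z \<partial>P)"
    and F_grad: "\<And>y. GDERIV F y :> gradF y"
    and F_C1: "continuous_on UNIV gradF"
    and xstar: "\<And>y. F xstar \<le> F y"
    \<comment> \<open>(A4): smoothness of the realizations\<close>
    and f_grad: "\<And>y z. z \<in> space P \<Longrightarrow> GDERIV (\<lambda>v. f v z) y :> gradf y z"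
    and f_lip: "\<And>z. z \<in> space P \<Longrightarrow> Lf-lipschitz_on UNIV (\<lambda>v. gradf v z)"
    and F_lip: "LF-lipschitz_on UNIV gradF" and LF: "0 < LF" "LF \<le> Lf"
    \<comment> \<open>(A5): gradient noise\<close>
    and \<beta>: "0 \<le> \<beta>\<^sub>1" "0 \<le> \<beta>\<^sub>2"
    and A5: "\<And>y. (\<integral>\<^sup>+z. ennreal ((norm (gradf y z - gradF y))\<^sup>2) \<partial>P)
                  \<le> ennreal (\<beta>\<^sub>1 * (norm (gradF y))\<^sup>2 + \<beta>\<^sub>2)"
    \<comment> \<open>strong convexity\<close>
    and \<mu>: "0 < \<mu>" "\<mu> \<le> LF"
    and strong_convex: "\<And>y. (norm (gradF y))\<^sup>2 \<ge> 2 * \<mu> * (F y - F xstar)"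
    \<comment> \<open>parameters\<close>
    and \<theta>: "0 < \<theta>" and \<epsilon>: "0 < \<epsilon>" and p: "0 < p" "p \<le> 1"
    and N: "admissible m DIM('a) N"
    and \<nu>: "\<nu> = radius m DIM('a) N \<mu> LF \<epsilon> p"
    and \<alpha>: "\<And>k. \<alpha> k = step_size m DIM('a) N \<theta> LF"
    \<comment> \<open>directions, drawn afresh at each iteration\<close>
    and u_meas: "\<And>k j. j < N \<Longrightarrow> u k j \<in> borel_measurable M"
    and u_law: "\<And>k. direction_law m N (distr M (tuple_space N) (\<lambda>\<omega>. \<lambda>j\<in>{..<N}. u k j \<omega>))"
    and u_fresh: "\<And>k. indep_of_algebra M (past M P N u n \<zeta> k) (tuple_space N)
                          (\<lambda>\<omega>. \<lambda>j\<in>{..<N}. u k j \<omega>)"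
    \<comment> \<open>(A1) and (A2): i.i.d. samples, independent of the directions and of the past\<close>
    and \<zeta>_meas: "\<And>k i. \<zeta> k i \<in> measurable M P"
    and \<zeta>_law: "\<And>k i. distr M P (\<zeta> k i) = P"
    and \<zeta>_indep: "\<And>k. prob_space.indep_vars M (\<lambda>_. P) (\<zeta> k) UNIV"
    and \<zeta>_fresh: "\<And>k. indep_of_algebra M (past_half M P N u n \<zeta> k) (Pi\<^sub>M UNIV (\<lambda>_. P))
                          (\<lambda>\<omega> i. \<zeta> k i \<omega>)"
    \<comment> \<open>sample sizes\<close>
    and n_meas: "\<And>k. n k \<in> measurable (past_half M P N u n \<zeta> k) (count_space UNIV)"
    and n_pos: "\<And>k \<omega>. \<omega> \<in> space M \<Longrightarrow> 1 \<le> n k \<omega>"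
    \<comment> \<open>iterates and gradient estimates\<close>
    and x_0: "\<And>\<omega>. \<omega> \<in> space M \<Longrightarrow> x 0 \<omega> = x0"
    and x_Suc: "\<And>k \<omega>. \<omega> \<in> space M \<Longrightarrow> x (Suc k) \<omega> = x k \<omega> - \<alpha> k *\<^sub>R gS k \<omega>"
    and gS: "\<And>k \<omega>. gS k \<omega> = grad_est (scaling m DIM('a) N) \<nu> N
                        (sample_mean f (n k \<omega>) (\<lambda>i. \<zeta> k i \<omega>)) (x k \<omega>) (\<lambda>j. u k j \<omega>)"
    and gT: "\<And>k. gT k = vec_cond_exp M (past_half M P N u n \<zeta> k) (gS k)"
    and V: "\<And>k \<omega>. V k \<omega> = (\<integral>z. (norm (grad_est (scaling m DIM('a) N) \<nu> N (\<lambda>y. f y z) (x k \<omega>)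
                        (\<lambda>j. u k j \<omega>) - gT k \<omega>))\<^sup>2 \<partial>P)"
    and ET: "\<And>k. ET k = real_cond_exp M (past M P N u n \<zeta> k)"
    \<comment> \<open>Conditions 1, 2, 3\<close>
    and conditions: "\<And>k.
          (AE \<omega> in M. V k \<omega> / n k \<omega> \<le> \<theta>\<^sup>2 * (norm (gT k \<omega>))\<^sup>2)
        \<or> (AE \<omega> in M. V k \<omega> / n k \<omega> \<le> \<theta>\<^sup>2 * ET k (\<lambda>\<omega>. (norm (gT k \<omega>))\<^sup>2) \<omega>)
        \<or> (AE \<omega> in M. ET k (V k) \<omega> / n k \<omega> \<le> \<theta>\<^sup>2 * ET k (\<lambda>\<omega>. (norm (gT k \<omega>))\<^sup>2) \<omega>)"
  shows "(\<forall>k. iteration_bound (F x0 - F xstar) \<epsilon> p (rate m DIM('a) N \<theta> \<mu> LF) \<le> ereal (real k) \<longrightarrow>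
            measure M {\<omega> \<in> space M. F (x k \<omega>) - F xstar \<le> \<epsilon>} \<ge> 1 - p)
       \<and> (\<exists>C. \<forall>m' d' N' \<mu>' L' \<epsilon>' p'.
            1 \<le> d' \<and> admissible m' d' N' \<and> 0 < \<mu>' \<and> \<mu>' \<le> L' \<and>
            0 < \<epsilon>' \<and> 0 < p' \<and> p' \<le> 1 \<and> \<epsilon>' * p' \<le> 1 / 2 \<longrightarrow>
            (let \<rho>' = rate m' d' N' \<theta> \<mu>' L';
                 K' = iteration_bound (F x0 - F xstar) \<epsilon>' p' \<rho>';
                 B\<^sub>1 = C * (ln (1 / (\<epsilon>' * p')) / \<rho>');
                 B\<^sub>2 = C * (dim_factor m' d' N' * Omega6 \<mu>' L' \<epsilon>' p')
             in K' \<le> ereal B\<^sub>1 \<and> K' \<le> ereal B\<^sub>2 \<and>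
                (F x0 \<noteq> F xstar \<longrightarrow> \<bar>K'\<bar> \<le> ereal B\<^sub>1 \<and> \<bar>K'\<bar> \<le> ereal B\<^sub>2)))"
proof -
  define s where "s = step_factor m DIM('a) N"
  define a where "a = step_size m DIM('a) N \<theta> LF"
  define \<gamma> where "\<gamma> = scaling m DIM('a) N"
  define \<rho> where "\<rho> = rate m DIM('a) N \<theta> \<mu> LF"
  define \<kappa> where "\<kappa> = \<mu> * \<epsilon> * p"
  have d1: "1 \<le> DIM('a)" by (simp add: Suc_le_eq)
  note sf = step_factor_bounds[OF N d1, folded s_def]
  have \<rho>01: "0 < \<rho>" "\<rho> < 1" unfolding \<rho>_def using rate_bounds[OF N d1 \<mu>] by auto
  have \<nu>0: "0 < \<nu>" unfolding \<nu> by (rule radius_pos[OF N d1 LF(1) \<mu>(1) \<epsilon> p(1)])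
  have \<gamma>0: "0 \<le> \<gamma>" by (cases m) (auto simp: \<gamma>_def scaling_def)
  have tL: "0 < 4 * (1 + \<theta>\<^sup>2) * LF" using LF by (auto intro!: mult_pos_pos add_pos_nonneg)
  \<comment> \<open>The second relation turns the quadratic term of the descent lemma into
    \<open>s / 8\<close>, the third turns strong convexity into the contraction factor
    \<open>1 - \<rho>\<close>.\<close>
  have a: "0 \<le> a" "4 * (1 + \<theta>\<^sup>2) * LF * a = s" "a * \<mu> / 2 = \<rho>"
  proof -
    show "0 \<le> a" using sf tL by (simp add: a_def step_size_def Omega1_def s_def)
    have "c * (s * (1 / c)) = s" if "0 < c" for c :: real using that by simp
    from this[OF tL] show "4 * (1 + \<theta>\<^sup>2) * LF * a = s" by (simp only: a_def step_size_def Omega1_def s_def)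
    show "a * \<mu> / 2 = \<rho>"
      by (simp add: a_def \<rho>_def step_size_def rate_def Omega1_def Omega3_def)
  qed
  interpret M: prob_space M by (rule M)
  interpret obj: stoch_objective P f F gradf gradF Lf LF \<beta>\<^sub>1 \<beta>\<^sub>2
    by (rule stoch_objective.intro) (rule P f_int F_def F_grad f_grad f_lip F_lip LF \<beta> A5; assumption?)+
  interpret hist: sampling_history M P N u n \<zeta>
    by (intro sampling_history.intro sampling_history_axioms.intro)
       (rule M u_meas \<zeta>_meas n_meas; assumption?)+
  define D where "D k = distr M (tuple_space N) (\<lambda>\<omega>. \<lambda>j\<in>{..<N}. u k j \<omega>)" for k
  have U_meas: "(\<lambda>\<omega>. \<lambda>j\<in>{..<N}. u k j \<omega>) \<in> measurable M (tuple_space N)" for k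
    using u_meas by (intro measurable_restrict) auto
  interpret AU: fresh_variable M "hist.A k" "tuple_space N" "\<lambda>\<omega>. \<lambda>j\<in>{..<N}. u k j \<omega>" "D k" for k
    by (intro fresh_variable.intro fresh_variable_axioms.intro) (rule M hist.subalgebra_A U_meas u_fresh D_def[symmetric])+
  have \<zeta>_seq_meas: "(\<lambda>\<omega> i. \<zeta> k i \<omega>) \<in> measurable M (Pi\<^sub>M UNIV (\<lambda>_. P))" for k
    using \<zeta>_meas by (intro measurable_PiM_single') (auto simp: measurable_space[OF \<zeta>_meas])
  have \<zeta>_seq_law: "distr M (Pi\<^sub>M UNIV (\<lambda>_. P)) (\<lambda>\<omega> i. \<zeta> k i \<omega>) = Pi\<^sub>M UNIV (\<lambda>_. P)" for k
    using M.indep_vars_iff_distr_eq_PiM[of "UNIV :: nat set" "\<zeta> k" "\<lambda>_. P"] \<zeta>_meas \<zeta>_indep[of k]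
    by (simp add: \<zeta>_law restrict_UNIV)
  interpret HZ: fresh_variable M "hist.H k" "Pi\<^sub>M UNIV (\<lambda>_. P)" "\<lambda>\<omega> i. \<zeta> k i \<omega>" "Pi\<^sub>M UNIV (\<lambda>_. P)" for k
    by (intro fresh_variable.intro fresh_variable_axioms.intro) (rule M hist.subalgebra_H \<zeta>_seq_meas \<zeta>_fresh \<zeta>_seq_law)+
  have D6: "integrable (D k) (\<lambda>v. norm (v j) ^ 6)" if "j < N" for k j
    using that unfolding D_def by (rule direction_law_integrable[OF N u_law])
  have desc: "(\<integral>v. s / 8 * (norm (grad_est \<gamma> \<nu> N F y v))\<^sup>2 - gradF y \<bullet> grad_est \<gamma> \<nu> N F y v \<partial>D k)
      \<le> \<kappa> / 4 - (norm (gradF y))\<^sup>2 / 4" for k y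
    unfolding s_def \<gamma>_def \<nu> \<kappa>_def D_def
    by (rule method_descent[OF F_grad F_lip LF(1) N u_law \<mu>(1) \<epsilon> p(1)])
  obtain z0 where z0: "z0 \<in> space P" using obj.P.not_empty by blast
  have x_A: "x k \<in> borel_measurable (hist.A k)" for k
  proof (induction k)
    case 0
    have "x 0 \<in> borel_measurable (hist.A 0) \<longleftrightarrow> (\<lambda>_. x0) \<in> borel_measurable (hist.A 0)"
      by (rule measurable_cong) (simp add: x_0)
    then show ?case by simp
  next
    case (Suc k)
    let ?A = "hist.A (Suc k)"
    \<comment> \<open>Samples beyond the batch need not be measurable with respect to the past.
      Replacing them by a fixed \<open>z0\<close> leaves the sample mean unchanged, as it reads only
      the first \<open>n k\<close> members.\<close>
    define \<zeta>' where "\<zeta>' i \<omega> = (if i < n k \<omega> then \<zeta> k i \<omega> else z0)" for i \<omega>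
    have [measurable]: "\<zeta>' i \<in> measurable ?A P" for i
      unfolding \<zeta>'_def by (rule hist.used_sample_A[OF z0])
    have [measurable]: "n k \<in> measurable ?A (count_space UNIV)" by (rule hist.measurable_H_A[OF n_meas])
    have [measurable]: "x k \<in> borel_measurable ?A"
      using Suc hist.A_subset_H[of k]
      by (intro hist.measurable_H_A measurable_from_subalg[of "hist.H k" "hist.A k"]) (auto simp: subalgebra_def)
    have "(\<lambda>\<omega>. grad_est \<gamma> \<nu> N (sample_mean f (n k \<omega>) (\<lambda>i. \<zeta>' i \<omega>)) (x k \<omega>) (\<lambda>j. u k j \<omega>)) \<in> borel_measurable ?A"
    proof (rule measurable_compose_countable[where g="n k"])
      fix l
      show "(\<lambda>\<omega>. grad_est \<gamma> \<nu> N (sample_mean f l (\<lambda>i. \<zeta>' i \<omega>)) (x k \<omega>) (\<lambda>j. u k j \<omega>)) \<in> borel_measurable ?A"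
      proof (rule measurable_grad_est_at)
        show "u k j \<in> borel_measurable ?A" if "j < N" for j
          using that by (intro hist.measurable_H_A hist.u_H)
        show "(\<lambda>\<omega>. sample_mean f l (\<lambda>i. \<zeta>' i \<omega>) (g \<omega>)) \<in> borel_measurable ?A"
          if [measurable]: "g \<in> borel_measurable ?A" for g
          unfolding sample_mean_def by measurable
      qed measurable
    qed measurable
    then have meas: "(\<lambda>\<omega>. x k \<omega> - \<alpha> k *\<^sub>R grad_est \<gamma> \<nu> N (sample_mean f (n k \<omega>) (\<lambda>i. \<zeta>' i \<omega>)) (x k \<omega>) (\<lambda>j. u k j \<omega>))
        \<in> borel_measurable ?A" by measurable
    have "sample_mean f (n k \<omega>) (\<lambda>i. \<zeta>' i \<omega>) = sample_mean f (n k \<omega>) (\<lambda>i. \<zeta> k i \<omega>)" for \<omega>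
      by (auto simp: fun_eq_iff sample_mean_def \<zeta>'_def intro!: sum.cong)
    with meas have "(\<lambda>\<omega>. x k \<omega> - \<alpha> k *\<^sub>R gS k \<omega>) \<in> borel_measurable ?A" by (simp add: gS \<gamma>_def)
    then show ?case
      using measurable_cong[of ?A "x (Suc k)" "\<lambda>\<omega>. x k \<omega> - \<alpha> k *\<^sub>R gS k \<omega>" borel] by (simp add: x_Suc)
  qed
  have x_M [measurable]: "x k \<in> borel_measurable M" for k
    by (rule measurable_from_subalg[OF hist.subalgebra_A x_A])
  define e where "e k = (\<integral>\<omega>. F (x k \<omega>) - F xstar \<partial>M)" for k
  \<comment> \<open>Integrability is carried along with the estimate, because each iteration needs a
    square-integrable gradient at its starting point.\<close>
  have step: "integrable M (\<lambda>\<omega>. F (x (Suc k) \<omega>) - F xstar)" "e (Suc k) \<le> (1 - \<rho>) * e k + \<rho> * (\<epsilon> * p / 2)"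
    if gap: "integrable M (\<lambda>\<omega>. F (x k \<omega>) - F xstar)" for k
  proof -
    have grad_sq: "integrable M (\<lambda>\<omega>. (norm (gradF (x k \<omega>)))\<^sup>2)"
    proof (rule Bochner_Integration.integrable_bound)
      show "integrable M (\<lambda>\<omega>. 2 * LF * (F (x k \<omega>) - F xstar))" using gap by simp
      show "AE \<omega> in M. norm ((norm (gradF (x k \<omega>)))\<^sup>2) \<le> norm (2 * LF * (F (x k \<omega>) - F xstar))"
      proof (rule AE_I2)
        fix \<omega>
        show "norm ((norm (gradF (x k \<omega>)))\<^sup>2) \<le> norm (2 * LF * (F (x k \<omega>) - F xstar))"
          using norm_gradient_le_gap[OF F_grad F_lip LF(1) xstar, of "x k \<omega>"]
          by (simp add: order_trans[OF _ abs_ge_self])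
      qed
    qed measurable
    interpret step: zo_step P f F gradf gradF Lf LF \<beta>\<^sub>1 \<beta>\<^sub>2 M "hist.A k" "hist.H k" N "u k" "D k" "\<zeta> k" \<gamma> \<nu> "n k" "x k"
      by (intro zo_step.intro zo_step_axioms.intro obj.stoch_objective_axioms AU.fresh_variable_axioms
          HZ.fresh_variable_axioms)
         (rule \<gamma>0 \<nu>0 x_A hist.A_subset_H hist.u_H n_meas n_pos D6 grad_sq; assumption?)+
    have gS_eq: "gS k = (\<lambda>\<omega>. step.batch_est \<omega> (\<lambda>i. \<zeta> k i \<omega>))"
    proof (rule ext)
      show "gS k \<omega> = step.batch_est \<omega> (\<lambda>i. \<zeta> k i \<omega>)" for \<omega>
        unfolding step.batch_est_def unfolding gS \<gamma>_def ..
    qed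
    have V_eq: "V k = (\<lambda>\<omega>. \<integral>z. (norm (grad_est \<gamma> \<nu> N (\<lambda>y. f y z) (x k \<omega>) (\<lambda>j. u k j \<omega>)
        - vec_cond_exp M (hist.H k) (gS k) \<omega>))\<^sup>2 \<partial>P)"
      by (simp add: fun_eq_iff V gT \<gamma>_def)
    have var: "(\<integral>\<omega>. step.Vx \<omega> / n k \<omega> \<partial>M) \<le> \<theta>\<^sup>2 * (\<integral>\<omega>. (norm (grad_est \<gamma> \<nu> N F (x k \<omega>) (\<lambda>j. u k j \<omega>)))\<^sup>2 \<partial>M)"
      using conditions[of k] unfolding V_eq gT ET gS_eq by (rule step.sample_size_condition)
    have xs: "x (Suc k) \<omega> = x k \<omega> - a *\<^sub>R step.batch_est \<omega> (\<lambda>i. \<zeta> k i \<omega>)" if "\<omega> \<in> space M" for \<omega>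
      using x_Suc[OF that, of k] by (simp add: gS_eq \<alpha> a_def)
    note gs = step.expected_gap_step[OF xstar gap desc var a(1,2) strong_convex]
    show "integrable M (\<lambda>\<omega>. F (x (Suc k) \<omega>) - F xstar)"
      using gs(1) by (simp add: xs cong: Bochner_Integration.integrable_cong)
    have "e (Suc k) = (\<integral>\<omega>. F (x k \<omega> - a *\<^sub>R step.batch_est \<omega> (\<lambda>i. \<zeta> k i \<omega>)) - F xstar \<partial>M)"
      unfolding e_def by (intro Bochner_Integration.integral_cong refl) (simp add: xs)
    also have "\<dots> \<le> (1 - a * \<mu> / 2) * e k + a * \<kappa> / 4" unfolding e_def by (rule gs(2))
    \<comment> \<open>This puts the fixed point of the recursion at
      \<open>\<epsilon> * p / 2\<close>, half of the value at which Markov's inequality is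
      applied.\<close>
    also have "a * \<kappa> / 4 = (a * \<mu> / 2) * (\<epsilon> * p / 2)" by (simp add: \<kappa>_def)
    finally show "e (Suc k) \<le> (1 - \<rho>) * e k + \<rho> * (\<epsilon> * p / 2)" unfolding a(3) .
  qed
  have x0_eq: "(\<integral>\<omega>. F (x 0 \<omega>) - F xstar \<partial>M) = (\<integral>\<omega>. F x0 - F xstar \<partial>M)"
    by (intro Bochner_Integration.integral_cong refl) (simp add: x_0)
  have gap: "integrable M (\<lambda>\<omega>. F (x k \<omega>) - F xstar)" for k
  proof (induction k)
    case 0
    show ?case by (simp add: x_0 cong: Bochner_Integration.integrable_cong)
  qed (rule step)
  have e0: "e 0 = F x0 - F xstar" unfolding e_def x0_eq by (simp add: M.prob_space)
  have ep: "0 < \<epsilon> * p" using \<epsilon> p by simp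
  have \<Delta>0: "0 \<le> F x0 - F xstar" using xstar[of x0] by simp
  have accurate: "1 - p \<le> measure M {\<omega> \<in> space M. F (x k \<omega>) - F xstar \<le> \<epsilon>}"
    if k: "iteration_bound (F x0 - F xstar) \<epsilon> p \<rho> \<le> ereal (real k)" for k
  proof -
    have "e k \<le> (1 - \<rho>) ^ k * e 0 + (1 - (1 - \<rho>) ^ k) * (\<epsilon> * p / 2)"
      using step(2)[OF gap] \<rho>01 by (intro affine_recursion_le) auto
    \<comment> \<open>One half accounts for the decayed initial gap, the other for the fixed
      point.\<close>
    also have "\<dots> \<le> \<epsilon> * p / 2 + 1 * (\<epsilon> * p / 2)"
      using iteration_bound_decay[OF \<Delta>0 \<rho>01 \<epsilon> p(1) k] \<rho>01 ep unfolding e0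
      by (intro add_mono mult_right_mono) auto
    finally have ek: "e k \<le> \<epsilon> * p" by simp
    have "measure M {\<omega> \<in> space M. \<epsilon> < F (x k \<omega>) - F xstar} \<le> measure M {\<omega> \<in> space M. \<epsilon> \<le> F (x k \<omega>) - F xstar}"
      by (intro M.finite_measure_mono) auto
    also have "\<dots> \<le> e k / \<epsilon>"
      unfolding e_def using xstar \<epsilon> by (intro integral_Markov_inequality_measure[OF gap, where A="space M"]) auto
    also have "\<dots> \<le> p" using ek \<epsilon> by (simp add: divide_le_eq mult.commute)
    finally have "measure M {\<omega> \<in> space M. \<epsilon> < F (x k \<omega>) - F xstar} \<le> p" .
    moreover have "measure M {\<omega> \<in> space M. \<not> \<epsilon> < F (x k \<omega>) - F xstar} = 1 - measure M {\<omega> \<in> space M. \<epsilon> < F (x k \<omega>) - F xstar}"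
      by (intro M.prob_neg) measurable
    ultimately show ?thesis by (simp add: not_less)
  qed
  show ?thesis
    using accurate iteration_bound_complexity[OF \<Delta>0, of \<theta>] unfolding \<rho>_def by simp
qed

end
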